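(* Let $\ell\ge 2$, let $G_\ell$ be the fundamental group of a closed connected oriented surface $\Sigma_\ell$ of genus $\ell$, and let $G_\ell'$ be its commutator subgroup. Then $\mathrm{scl}_{G_\ell}$ and $\mathrm{scl}_{G_\ell,G_\ell'}$ are not equivalent.
   Context: Write $[g,h]=ghg^{-1}h^{-1}$. For a group $G$ and a normal subgroup $N$, $[G,N]$ is the subgroup generated by the mixed commutators $[g,w]$ with $g\in G$, $w\in N$. For $x\in[G,N]$, $\mathrm{cl}_{G,N}(x)$ is the least number of mixed commutators whose product is $x$, and $\mathrm{scl}_{G,N}(x)=\lim_{m\to\infty}\mathrm{cl}_{G,N}(x^m)/m$ (the limit exists). For $N=G$ one writes $\mathrm{scl}_G=\mathrm{scl}_{G,G}$, the usual stable commutator length on $G'=[G,G]$. $\mathrm{scl}_G$ and $\mathrm{scl}_{G,N}$ are called equivalent if there is a real constant $C>0$ such that $\mathrm{scl}_{G,N}(x)\le C\cdot\mathrm{scl}_G(x)$ for every $x\in[G,N]$. *)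

theory Defs
  imports "HOL-Analysis.Analysis" "HOL-Algebra.Generated_Groups"
begin

section \<open>The fundamental group\<close>

definition loops :: "'a topology \<Rightarrow> 'a \<Rightarrow> (real \<Rightarrow> 'a) set" where
  "loops X x0 = {p. pathin X p \<and> p 0 = x0 \<and> p 1 = x0}"

text \<open>Homotopy of loops relative to the base point.  The values of a loop outside the unit
  interval are arbitrary; \<open>homotopic_with\<close> does not constrain them.\<close>

definition homotopic_rel_base :: "'a topology \<Rightarrow> 'a \<Rightarrow> (real \<Rightarrow> 'a) \<Rightarrow> (real \<Rightarrow> 'a) \<Rightarrow> bool" where
  "homotopic_rel_base X x0 =
     homotopic_with (\<lambda>h. h 0 = x0 \<and> h 1 = x0) (top_of_set {0..1}) X"

definition loop_class :: "'a topology \<Rightarrow> 'a \<Rightarrow> (real \<Rightarrow> 'a) \<Rightarrow> (real \<Rightarrow> 'a) set" where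
  "loop_class X x0 p = {q \<in> loops X x0. homotopic_rel_base X x0 p q}"

text \<open>The same formula as \<open>(+++)\<close>, which is tied to the canonical topology of its type
  and so is not available for an abstract \<open>'a topology\<close>.\<close>

definition loop_concat :: "(real \<Rightarrow> 'a) \<Rightarrow> (real \<Rightarrow> 'a) \<Rightarrow> real \<Rightarrow> 'a" where
  "loop_concat p q = (\<lambda>t. if t \<le> 1/2 then p (2 * t) else q (2 * t - 1))"

text \<open>The product of two classes is the union of the classes of the products of their
  representatives; all of these coincide.\<close>

definition fundamental_group :: "'a topology \<Rightarrow> 'a \<Rightarrow> (real \<Rightarrow> 'a) set monoid" where
  "fundamental_group X x0 =
     \<lparr> carrier = loop_class X x0 ` loops X x0,
       mult = (\<lambda>A B. \<Union>p\<in>A. \<Union>q\<in>B. loop_class X x0 (loop_concat p q)),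
       one = loop_class X x0 (\<lambda>_. x0) \<rparr>"

section \<open>Closed oriented surfaces\<close>

text \<open>The closed unit disc is regarded as a polygon with \<open>4 * l\<close> edges, and
  \<open>polygon_edge l k\<close> parametrises its \<open>k\<close>-th edge counterclockwise over \<open>{0..1}\<close>.
  The edges are glued in pairs according to the boundary word
  \<open>a\<^sub>1 b\<^sub>1 a\<^sub>1\<inverse> b\<^sub>1\<inverse> \<dots> a\<^sub>l b\<^sub>l a\<^sub>l\<inverse> b\<^sub>l\<inverse>\<close>.
  Both edges of each pair run in opposite directions, which makes the quotient orientable.\<close>

definition polygon_edge :: "nat \<Rightarrow> nat \<Rightarrow> real \<Rightarrow> complex" where
  "polygon_edge l k t = cis (2 * pi * (real k + t) / (4 * real l))"

inductive edge_gluing :: "nat \<Rightarrow> complex \<Rightarrow> complex \<Rightarrow> bool" for l :: nat where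
  a: "i < l \<Longrightarrow> 0 \<le> t \<Longrightarrow> t \<le> 1 \<Longrightarrow>
        edge_gluing l (polygon_edge l (4 * i) t) (polygon_edge l (4 * i + 2) (1 - t))"
| b: "i < l \<Longrightarrow> 0 \<le> t \<Longrightarrow> t \<le> 1 \<Longrightarrow>
        edge_gluing l (polygon_edge l (4 * i + 1) t) (polygon_edge l (4 * i + 3) (1 - t))"

text \<open>\<open>X\<close> is a closed connected oriented surface of genus \<open>l\<close> (for \<open>l \<ge> 1\<close>): up to
  homeomorphism, the quotient of the polygon by the equivalence relation generated by the
  gluing, i.e. the connected sum of \<open>l\<close> tori.  The condition is invariant under homeomorphism.
  No orientation is recorded, since the fundamental group does not depend on it.\<close>

definition closed_oriented_surface :: "nat \<Rightarrow> 'a topology \<Rightarrow> bool" where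
  "closed_oriented_surface l X \<longleftrightarrow>
     (\<exists>f. quotient_map (top_of_set (cball 0 1)) X f \<and>
          (\<forall>z \<in> cball 0 1. \<forall>w \<in> cball 0 1. f z = f w \<longleftrightarrow> equivclp (edge_gluing l) z w))"

section \<open>Mixed commutators and stable mixed commutator length\<close>

definition mixed_commutators :: "('a, 'b) monoid_scheme \<Rightarrow> 'a set \<Rightarrow> 'a set" where
  "mixed_commutators G N =
     {g \<otimes>\<^bsub>G\<^esub> w \<otimes>\<^bsub>G\<^esub> inv\<^bsub>G\<^esub> g \<otimes>\<^bsub>G\<^esub> inv\<^bsub>G\<^esub> w | g w. g \<in> carrier G \<and> w \<in> N}"

definition mixed_commutator_subgroup :: "('a, 'b) monoid_scheme \<Rightarrow> 'a set \<Rightarrow> 'a set" where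
  "mixed_commutator_subgroup G N = generate G (mixed_commutators G N)"

text \<open>Meaningful for \<open>N\<close> normal in \<open>G\<close> and \<open>x \<in> mixed_commutator_subgroup G N\<close>: the inverse of
  a mixed commutator is then again one, so \<open>x\<close> is a product of mixed commutators.\<close>

definition cl :: "('a, 'b) monoid_scheme \<Rightarrow> 'a set \<Rightarrow> 'a \<Rightarrow> nat" where
  "cl G N x = (LEAST k. \<exists>cs. length cs = k \<and> set cs \<subseteq> mixed_commutators G N \<and>
                              foldr (\<otimes>\<^bsub>G\<^esub>) cs \<one>\<^bsub>G\<^esub> = x)"

definition scl :: "('a, 'b) monoid_scheme \<Rightarrow> 'a set \<Rightarrow> 'a \<Rightarrow> real" where
  "scl G N x = lim (\<lambda>m::nat. real (cl G N (x [^]\<^bsub>G\<^esub> m)) / real m)"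

text \<open>Equivalence of \<open>scl\<^sub>G = scl G (carrier G)\<close> and \<open>scl\<^sub>G\<^sub>,\<^sub>N = scl G N\<close>.\<close>

definition scl_equivalent :: "('a, 'b) monoid_scheme \<Rightarrow> 'a set \<Rightarrow> bool" where
  "scl_equivalent G N \<longleftrightarrow>
     (\<exists>C::real. C > 0 \<and>
        (\<forall>x \<in> mixed_commutator_subgroup G N. scl G N x \<le> C * scl G (carrier G) x))"

end

theory Submission
  imports Defs
begin

text \<open>The distance between the two lengths is detected by a function \<open>s\<close> on the surface group \<open>G\<close> that is a
quasimorphism up to a bilinear correction: \<open>s (x y)\<close> differs from \<open>s x + s y + p x * q y\<close> by a
bounded amount, where \<open>p\<close> and \<open>q\<close> are homomorphisms to the reals.  On \<open>N = [G,G]\<close>, where \<open>p\<close> and \<open>q\<close>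
vanish, \<open>s\<close> is an honest quasimorphism, and it is bounded on mixed commutators \<open>[g,w]\<close> with \<open>w\<close> in \<open>N\<close>;
hence \<open>scl\<close> with respect to \<open>N\<close> grows at least linearly with \<open>\<bar>s x\<bar>\<close> (\<open>s_le_scl\<close>).  On an ordinary commutator, however,
\<open>s [x,y]\<close> is \<open>p x * q y - p y * q x\<close> up to a bounded error.  If \<open>a\<^sub>i, b\<^sub>i\<close> satisfy the surface
relation, then the product \<open>x\<^sub>n\<close> of the \<open>[a\<^sub>i\<^sup>n, b\<^sub>i]\<close> lies in \<open>[G,N]\<close>, since modulo \<open>[G,N]\<close> it is the
\<open>n\<close>-th power of the relator.  It is a product of \<open>l\<close> commutators, so its ordinary \<open>scl\<close> is at most
\<open>l\<close>, while \<open>s x\<^sub>n\<close> is \<open>n\<close> times the symplectic sum of the \<open>a\<^sub>i, b\<^sub>i\<close>, up to a bounded error.  If this sum is nonzero,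
no constant bounds one length by the other (\<open>not_scl_equivalent_derived\<close>).

Such an \<open>s\<close> exists because the second real cohomology of the surface group is one-dimensional: the
Euler class of an action on the circle, which is represented by a bounded cocycle, is a multiple of
the cup product of two classes of degree one.  This is made explicit by a group, \<open>euler_heisenberg\<close>, consisting of a
matrix in \<open>SL\<^sub>2\<close> and three real numbers \<open>p, q, s\<close>; the last coordinate is central and its
multiplication adds the cocycle \<open>4 p q'\<close> of the Heisenberg group and the sign cocycle, which
represents a multiple of the Euler class.  Two explicit pairs of matrices have commutators whose product is the
identity with nonzero Euler number, and the numbers \<open>p, q\<close> of the first pair are chosen so
that the two contributions cancel (\<open>handle_relation\<close>).  Thus the surface relation holds in
this group, and \<open>s\<close> is the pullback of the last coordinate along a homomorphism from \<open>G\<close>.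

Only half of the presentation of the surface group is used: loops \<open>a\<^sub>i, b\<^sub>i\<close> that satisfy the relation,
and, for every group in which elements \<open>A\<^sub>i, B\<^sub>i\<close> satisfy it, a homomorphism from the fundamental
group that takes the loops to conjugates of the inverses of \<open>B\<^sub>i\<close> and \<open>A\<^sub>i\<close>
(\<open>fundamental_group_hom\<close>).  The loops are the edges of the polygon, whose boundary
contracts in the disc.  The homomorphism is the holonomy of a flat bundle, glued from the trivial bundle
over the polygon by multiplication with \<open>A\<^sub>i\<close> or \<open>B\<^sub>i\<inverse>\<close> along the edges; the relation is
exactly what makes this bundle extend over the vertex of the surface.\<close>

section \<open>Stable mixed commutator length\<close>

text \<open>Fekete's lemma on subadditive sequences, in the bounded below case that makes \<open>scl\<close> a limit.\<close>

lemma fekete_nonneg: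
  fixes a :: "nat \<Rightarrow> real"
  assumes sub: "\<And>m n. a (m + n) \<le> a m + a n" and nonneg: "\<And>n. 0 \<le> a n"
  shows "convergent (\<lambda>n. a n / real n)"
proof -
  define L where "L = (INF n\<in>{1..}. a n / real n)"
  have bdd: "bdd_below ((\<lambda>n. a n / real n) ` {1..})"
    by (rule bdd_belowI[of _ 0]) (auto simp: nonneg)
  have mult: "a (k * n) \<le> real k * a n" if "k \<ge> 1" for k n
    using that
  proof (induction k rule: nat_induct_at_least)
    case (Suc k)
    then show ?case using sub[of n "k * n"] by (simp add: algebra_simps)
  qed simp
  have "(\<lambda>n. a n / real n) \<longlonglongrightarrow> L"
  proof (rule LIMSEQ_I)
    fix e :: real assume "e > 0"
    have "\<exists>n\<in>{1..}. a n / real n < L + e / 2"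
      using cINF_less_iff[of "{1..}", OF _ bdd, of "L + e/2"] \<open>e > 0\<close> unfolding L_def by auto
    then obtain n where n: "n \<ge> 1" "a n / real n < L + e / 2" by auto
    \<comment> \<open>a bound for the values at the remainders modulo \<open>n\<close>\<close>
    define M where "M = (\<Sum>r<n. a r)"
    have M: "a r \<le> M" if "r < n" for r
      unfolding M_def using member_le_sum[of r "{..<n}" a] that nonneg by auto
    have "M \<ge> 0" unfolding M_def by (simp add: nonneg sum_nonneg)
    obtain m0 :: nat where m0: "real m0 > 2 * M / e" using reals_Archimedean2 by blast
    have "norm (a m / real m - L) < e" if m: "m \<ge> max m0 n" for m
    proof -
      have m1: "m \<ge> 1" "m \<ge> n" "real m > 2 * M / e" using m n m0 by linarith+
      have "L \<le> a m / real m" unfolding L_def by (rule cINF_lower[OF bdd]) (use m1 in auto)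
      moreover have "a m \<le> real (m div n) * a n + M"
      proof -
        have "m div n \<ge> 1" using m1 n by (simp add: div_greater_zero_iff Suc_le_eq)
        then show ?thesis
          using sub[of "m div n * n" "m mod n"] mult[of "m div n" n] M[of "m mod n"] n by simp
      qed
      moreover have "real (m div n) * a n \<le> real m / real n * a n"
        by (intro mult_right_mono nonneg of_nat_div_le_of_nat)
      ultimately have "a m / real m \<le> a n / real n + M / real m"
        using m1 by (simp add: field_simps)
      moreover have "M / real m < e / 2"
        using m1 \<open>e > 0\<close> by (simp add: field_simps)
      ultimately have "a m / real m < L + e" using n by linarith
      then show ?thesis using \<open>L \<le> a m / real m\<close> by simp
    qed
    then show "\<exists>no. \<forall>m\<ge>no. norm (a m / real m - L) < e" by blast
  qed
  then show ?thesis by (auto simp: convergent_def)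
qed

definition commutator :: "('a, 'b) monoid_scheme \<Rightarrow> 'a \<Rightarrow> 'a \<Rightarrow> 'a" where
  "commutator G x y = x \<otimes>\<^bsub>G\<^esub> y \<otimes>\<^bsub>G\<^esub> inv\<^bsub>G\<^esub> x \<otimes>\<^bsub>G\<^esub> inv\<^bsub>G\<^esub> y"

abbreviation list_product :: "('a, 'b) monoid_scheme \<Rightarrow> 'a list \<Rightarrow> 'a" where
  "list_product G cs \<equiv> foldr (\<otimes>\<^bsub>G\<^esub>) cs \<one>\<^bsub>G\<^esub>"

context group
begin

lemma mixed_commutators_eq:
  "mixed_commutators G N = {commutator G g w | g w. g \<in> carrier G \<and> w \<in> N}"
  by (simp add: mixed_commutators_def commutator_def)

lemma commutator_closed [simp]:
  "x \<in> carrier G \<Longrightarrow> y \<in> carrier G \<Longrightarrow> commutator G x y \<in> carrier G"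
  by (simp add: commutator_def)

lemma list_product_closed [simp]:
  "set cs \<subseteq> carrier G \<Longrightarrow> list_product G cs \<in> carrier G"
  by (induction cs) auto

lemma list_product_append:
  "set cs \<subseteq> carrier G \<Longrightarrow> set ds \<subseteq> carrier G \<Longrightarrow>
    list_product G (cs @ ds) = list_product G cs \<otimes> list_product G ds"
  by (induction cs) (auto simp: m_assoc)

lemma inv_cancel:
  assumes "x \<in> carrier G" "y \<in> carrier G"
  shows "inv x \<otimes> (x \<otimes> y) = y" "x \<otimes> (inv x \<otimes> y) = y"
  using assms by (simp_all add: m_assoc[symmetric])

lemma inv_commutator:
  assumes "g \<in> carrier G" "w \<in> carrier G"
  shows "inv (commutator G g w) = commutator G (inv g) (g \<otimes> w \<otimes> inv g)"
  using assms by (simp add: commutator_def inv_mult_group m_assoc inv_cancel)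

lemma conj_commutator:
  assumes "g \<in> carrier G" "w \<in> carrier G" "h \<in> carrier G"
  shows "h \<otimes> commutator G g w \<otimes> inv h
           = commutator G (h \<otimes> g \<otimes> inv h) (h \<otimes> w \<otimes> inv h)"
  using assms by (simp add: commutator_def inv_mult_group m_assoc inv_cancel)

context
  fixes N assumes N: "N \<lhd> G"
begin

lemma mixed_commutators_closed: "mixed_commutators G N \<subseteq> carrier G"
  using N by (auto simp: mixed_commutators_eq normal_def subgroup.mem_carrier)

text \<open>Normality of \<open>N\<close> lets the inverse of \<open>[g,w]\<close> be written as \<open>[g\<inverse>, g w g\<inverse>]\<close>.  So the elements of the generated
subgroup are products of mixed commutators without inverses, as the definition of \<open>cl\<close> requires.\<close>

lemma inv_mixed_commutator:
  assumes "c \<in> mixed_commutators G N" shows "inv c \<in> mixed_commutators G N"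
proof -
  obtain g w where gw: "g \<in> carrier G" "w \<in> N" "c = commutator G g w"
    using assms by (auto simp: mixed_commutators_eq)
  then have "w \<in> carrier G" using N by (auto simp: normal_def subgroup.mem_carrier)
  then show ?thesis
    using gw normal.inv_op_closed2[OF N] by (auto simp: mixed_commutators_eq inv_commutator)
qed

lemma mixed_commutator_subgroup_normal: "mixed_commutator_subgroup G N \<lhd> G"
  unfolding mixed_commutator_subgroup_def
proof (rule normal_generateI[OF mixed_commutators_closed])
  fix c h assume "c \<in> mixed_commutators G N" "h \<in> carrier G"
  then obtain g w where gw: "g \<in> carrier G" "w \<in> N" "c = commutator G g w"
    by (auto simp: mixed_commutators_eq)
  then have "w \<in> carrier G" using N by (auto simp: normal_def subgroup.mem_carrier)
  then show "h \<otimes> c \<otimes> inv h \<in> mixed_commutators G N"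
    using gw \<open>h \<in> carrier G\<close> normal.inv_op_closed2[OF N]
    by (auto simp: mixed_commutators_eq conj_commutator intro!: exI)
qed

lemma mixed_commutator_subgroup_list:
  assumes "x \<in> mixed_commutator_subgroup G N"
  obtains cs where "set cs \<subseteq> mixed_commutators G N" "list_product G cs = x"
proof -
  have "\<exists>cs. set cs \<subseteq> mixed_commutators G N \<and> list_product G cs = x"
    using assms unfolding mixed_commutator_subgroup_def
  proof (induction rule: generate.induct)
    case one
    show ?case by (rule exI[of _ "[]"]) simp
  next
    case (incl h)
    then show ?case using mixed_commutators_closed by (intro exI[of _ "[h]"]) auto
  next
    case (inv h)
    then show ?case
      using mixed_commutators_closed inv_mixed_commutator by (intro exI[of _ "[inv h]"]) auto
  next
    case (eng g h)
    then obtain cs ds where "set cs \<subseteq> mixed_commutators G N" "list_product G cs = g"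
      "set ds \<subseteq> mixed_commutators G N" "list_product G ds = h" by blast
    then show ?case
      using mixed_commutators_closed by (intro exI[of _ "cs @ ds"]) (auto simp: list_product_append subset_trans simp del: foldr_append)
  qed
  then show ?thesis using that by blast
qed

lemma cl_le:
  assumes "set cs \<subseteq> mixed_commutators G N" "list_product G cs = x"
  shows "cl G N x \<le> length cs"
  unfolding cl_def using assms by (intro Least_le) blast

lemma cl_list:
  assumes "x \<in> mixed_commutator_subgroup G N"
  obtains cs where "set cs \<subseteq> mixed_commutators G N" "list_product G cs = x"
    "length cs = cl G N x"
proof -
  obtain cs where "set cs \<subseteq> mixed_commutators G N" "list_product G cs = x"
    using mixed_commutator_subgroup_list[OF assms] .
  then have "\<exists>k cs. length cs = k \<and> set cs \<subseteq> mixed_commutators G N \<and> list_product G cs = x"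
    by blast
  from LeastI_ex[OF this] show ?thesis using that unfolding cl_def by blast
qed

lemma pow_mixed_commutator_subgroup:
  assumes "x \<in> mixed_commutator_subgroup G N"
  shows "x [^] (n::nat) \<in> mixed_commutator_subgroup G N"
proof -
  interpret M: normal "mixed_commutator_subgroup G N" G
    by (rule mixed_commutator_subgroup_normal)
  show ?thesis using assms by (induction n) auto
qed

lemma cl_pow_subadditive:
  assumes x: "x \<in> mixed_commutator_subgroup G N"
  shows "cl G N (x [^] (m + n)) \<le> cl G N (x [^] m) + cl G N (x [^] (n::nat))"
proof -
  interpret M: normal "mixed_commutator_subgroup G N" G
    by (rule mixed_commutator_subgroup_normal)
  obtain cs where cs: "set cs \<subseteq> mixed_commutators G N" "list_product G cs = x [^] m"
    "length cs = cl G N (x [^] m)" using cl_list[OF pow_mixed_commutator_subgroup[OF x]] .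
  obtain ds where ds: "set ds \<subseteq> mixed_commutators G N" "list_product G ds = x [^] n"
    "length ds = cl G N (x [^] n)" using cl_list[OF pow_mixed_commutator_subgroup[OF x]] .
  have "list_product G (cs @ ds) = x [^] (m + n)"
    using cs ds mixed_commutators_closed x
    by (simp add: list_product_append subset_trans nat_pow_mult del: foldr_append)
  then show ?thesis using cl_le[of "cs @ ds"] cs ds by simp
qed

lemma scl_LIMSEQ:
  assumes x: "x \<in> mixed_commutator_subgroup G N"
  shows "(\<lambda>m::nat. real (cl G N (x [^] m)) / real m) \<longlonglongrightarrow> scl G N x"
  unfolding scl_def
proof (rule convergent_LIMSEQ_iff[THEN iffD1], rule fekete_nonneg)
  show "real (cl G N (x [^] (m + n))) \<le> real (cl G N (x [^] m)) + real (cl G N (x [^] n))"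
    for m n :: nat
    using cl_pow_subadditive[OF x, of m n] by linarith
qed simp

text \<open>Powers of a product of \<open>k\<close> mixed commutators repeat the product, so their length grows with
slope at most \<open>k\<close>.\<close>

lemma scl_le_length:
  assumes cs: "set cs \<subseteq> mixed_commutators G N"
  shows "scl G N (list_product G cs) \<le> length cs"
proof -
  let ?x = "list_product G cs"
  have csG: "set cs \<subseteq> carrier G" using cs mixed_commutators_closed by blast
  have x: "?x \<in> mixed_commutator_subgroup G N"
    unfolding mixed_commutator_subgroup_def using cs
    by (induction cs) (auto intro: generate.intros)
  have *: "\<exists>ds. set ds \<subseteq> mixed_commutators G N \<and> length ds = m * length cs
      \<and> list_product G ds = ?x [^] m" for m :: nat
  proof (induction m)
    case (Suc m)
    then obtain ds where "set ds \<subseteq> mixed_commutators G N" "length ds = m * length cs"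
      "list_product G ds = ?x [^] m" by blast
    then show ?case using cs mixed_commutators_closed
      by (intro exI[of _ "ds @ cs"]) (auto simp: list_product_append subset_trans simp del: foldr_append)
  qed simp
  have "real (cl G N (?x [^] m)) / real m \<le> length cs" if "m \<ge> 1" for m :: nat
  proof -
    obtain ds where "set ds \<subseteq> mixed_commutators G N" "length ds = m * length cs"
      "list_product G ds = ?x [^] m" using * by blast
    then have "cl G N (?x [^] m) \<le> m * length cs" using cl_le by metis
    then have "real (cl G N (?x [^] m)) \<le> real m * real (length cs)"
      by (metis of_nat_le_iff of_nat_mult)
    then show ?thesis using that by (simp add: field_simps)
  qed
  then show ?thesis using LIMSEQ_le_const2[OF scl_LIMSEQ[OF x]] by blast
qed

text \<open>The mixed commutators are the obstructions to the image of \<open>N\<close> being central.\<close>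

lemma mixed_commutator_trivial_mod:
  assumes gh: "group_hom G H \<phi>" "mixed_commutator_subgroup G N \<subseteq> kernel G H \<phi>"
    and "g \<in> carrier G" "w \<in> N"
  shows "\<phi> g \<otimes>\<^bsub>H\<^esub> \<phi> w = \<phi> w \<otimes>\<^bsub>H\<^esub> \<phi> g"
proof -
  have w: "w \<in> carrier G" using N assms by (auto simp: normal_def subgroup.mem_carrier)
  have "commutator G g w \<in> mixed_commutators G N"
    unfolding mixed_commutators_eq using assms(3,4) by blast
  then have "commutator G g w \<in> mixed_commutator_subgroup G N"
    unfolding mixed_commutator_subgroup_def by (rule generate.incl)
  have eq: "commutator G g w \<otimes> (w \<otimes> g) = g \<otimes> w"
    using assms(3) w by (simp add: commutator_def m_assoc inv_cancel)
  interpret group_hom G H \<phi> by fact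
  have "commutator G g w \<in> mixed_commutator_subgroup G N" by fact
  then have "\<phi> (commutator G g w) = \<one>\<^bsub>H\<^esub>" using gh(2) by (auto simp: kernel_def)
  then have "\<phi> (commutator G g w \<otimes> (w \<otimes> g)) = \<phi> (w \<otimes> g)" using assms(3) w by simp
  then show ?thesis using eq assms(3) w by simp
qed

end

lemma commutator_in_derived:
  "x \<in> carrier G \<Longrightarrow> y \<in> carrier G \<Longrightarrow> commutator G x y \<in> derived G (carrier G)"
  unfolding derived_def commutator_def by (auto intro!: generate.incl)

lemma commutator_mult_left:
  assumes xyz: "x \<in> carrier G" "y \<in> carrier G" "z \<in> carrier G"
    and central: "x \<otimes> commutator G y z = commutator G y z \<otimes> x"
  shows "commutator G (x \<otimes> y) z = commutator G y z \<otimes> commutator G x z"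
proof -
  have "commutator G (x \<otimes> y) z = x \<otimes> commutator G y z \<otimes> (z \<otimes> inv x \<otimes> inv z)"
    using xyz by (simp add: commutator_def m_assoc inv_mult_group inv_cancel)
  also have "\<dots> = commutator G y z \<otimes> commutator G x z"
    unfolding central using xyz by (simp add: commutator_def m_assoc)
  finally show ?thesis .
qed

lemma list_product_mult:
  assumes "\<And>i. i \<in> set is \<Longrightarrow> u i \<in> carrier G" "\<And>i. i \<in> set is \<Longrightarrow> v i \<in> carrier G"
    and central: "\<And>i g. i \<in> set is \<Longrightarrow> g \<in> carrier G \<Longrightarrow> g \<otimes> v i = v i \<otimes> g"
  shows "list_product G (map (\<lambda>i. u i \<otimes> v i) is)
           = list_product G (map u is) \<otimes> list_product G (map v is)"
  using assms
proof (induction "is")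
  case (Cons i "is")
  have U: "list_product G (map u is) \<in> carrier G" and V: "list_product G (map v is) \<in> carrier G"
    by (rule list_product_closed, use Cons.prems in auto)+
  have "list_product G (map (\<lambda>i. u i \<otimes> v i) (i # is))
     = u i \<otimes> v i \<otimes> (list_product G (map u is) \<otimes> list_product G (map v is))"
    using Cons by simp
  also have "\<dots> = u i \<otimes> (v i \<otimes> list_product G (map u is)) \<otimes> list_product G (map v is)"
    using Cons.prems(1,2)[of i] U V by (simp add: m_assoc)
  also have "v i \<otimes> list_product G (map u is) = list_product G (map u is) \<otimes> v i"
    using Cons.prems(3)[of i] U by simp
  finally show ?case using Cons.prems(1,2)[of i] U V by (simp add: m_assoc)
qed simp

text \<open>With central commutators, \<open>[a\<^sup>n, b] = [a, b]\<^sup>n\<close>, and a product of such powers is the \<open>n\<close>-th power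
of the product.\<close>

lemma list_product_commutator_pow_central:
  assumes "\<And>i. i \<in> set is \<Longrightarrow> a i \<in> carrier G" "\<And>i. i \<in> set is \<Longrightarrow> b i \<in> carrier G"
    and central: "\<And>i g. i \<in> set is \<Longrightarrow> g \<in> carrier G
       \<Longrightarrow> g \<otimes> commutator G (a i) (b i) = commutator G (a i) (b i) \<otimes> g"
    and rel: "list_product G (map (\<lambda>i. commutator G (a i) (b i)) is) = \<one>"
  shows "list_product G (map (\<lambda>i. commutator G (a i [^] (n::nat)) (b i)) is) = \<one>"
proof (induction n)
  case 0
  have "commutator G (a i [^] (0::nat)) (b i) = \<one>" if "i \<in> set is" for i
    using assms that by (simp add: commutator_def)
  then have "map (\<lambda>i. commutator G (a i [^] (0::nat)) (b i)) is = map (\<lambda>i. \<one>) is" by simp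
  moreover have "list_product G (map (\<lambda>i. \<one>) is) = \<one>" by (induction "is") auto
  ultimately show ?case by metis
next
  case (Suc n)
  have "commutator G (a i [^] Suc n) (b i)
      = commutator G (a i [^] n) (b i) \<otimes> commutator G (a i) (b i)" if "i \<in> set is" for i
    using commutator_mult_left[of "a i [^] n" "a i" "b i"] assms(1,2)[OF that] central[OF that] by simp
  then have "map (\<lambda>i. commutator G (a i [^] Suc n) (b i)) is =
       map (\<lambda>i. commutator G (a i [^] n) (b i) \<otimes> commutator G (a i) (b i)) is" by simp
  also have "list_product G \<dots> = list_product G (map (\<lambda>i. commutator G (a i [^] n) (b i)) is)
       \<otimes> list_product G (map (\<lambda>i. commutator G (a i) (b i)) is)"
    using assms by (intro list_product_mult) auto
  finally show ?case using Suc rel by simp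
qed

lemma (in group_hom) hom_list_product:
  "set cs \<subseteq> carrier G \<Longrightarrow> h (list_product G cs) = list_product H (map h cs)"
  by (induction cs) auto

lemma (in group_hom) hom_commutator:
  "x \<in> carrier G \<Longrightarrow> y \<in> carrier G \<Longrightarrow> h (commutator G x y) = commutator H (h x) (h y)"
  by (simp add: commutator_def)

text \<open>Passing to the quotient by \<open>[G,[G,G]]\<close> makes all commutators central, so that
\<open>list_product_commutator_pow_central\<close> applies.\<close>

lemma list_product_commutator_pow_mem:
  assumes ab: "\<And>i. i \<in> set is \<Longrightarrow> a i \<in> carrier G" "\<And>i. i \<in> set is \<Longrightarrow> b i \<in> carrier G"
    and rel: "list_product G (map (\<lambda>i. commutator G (a i) (b i)) is) = \<one>"
  shows "list_product G (map (\<lambda>i. commutator G (a i [^] (n::nat)) (b i)) is)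
           \<in> mixed_commutator_subgroup G (derived G (carrier G))"
proof -
  let ?N = "derived G (carrier G)"
  define M where "M = mixed_commutator_subgroup G ?N"
  have N: "?N \<lhd> G" by (rule derived_self_is_normal)
  interpret M: normal M G unfolding M_def by (rule mixed_commutator_subgroup_normal[OF N])
  interpret Q: group "G Mod M" by (rule M.factorgroup_is_group)
  interpret f: group_hom G "G Mod M" "(#>) M"
    by (intro group_hom.intro group_hom_axioms.intro M.r_coset_hom_Mod Q.group_axioms group_axioms)
  have ker: "M \<subseteq> kernel G (G Mod M) ((#>) M)"
    using M.rcos_const M.mem_carrier by (auto simp: kernel_def FactGroup_def)
  have surj: "\<exists>g\<in>carrier G. y = M #> g" if "y \<in> carrier (G Mod M)" for y
    using that by (auto simp: FactGroup_def RCOSETS_def)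
  let ?a = "\<lambda>i. M #> a i" and ?b = "\<lambda>i. M #> b i"
  have "list_product (G Mod M) (map (\<lambda>i. commutator (G Mod M) (?a i [^]\<^bsub>G Mod M\<^esub> n) (?b i)) is)
     = \<one>\<^bsub>G Mod M\<^esub>"
  proof (rule Q.list_product_commutator_pow_central)
    fix i g assume i: "i \<in> set is" and "g \<in> carrier (G Mod M)"
    then obtain g' where g: "g' \<in> carrier G" "g = M #> g'" using surj by blast
    show "g \<otimes>\<^bsub>G Mod M\<^esub> commutator (G Mod M) (?a i) (?b i)
       = commutator (G Mod M) (?a i) (?b i) \<otimes>\<^bsub>G Mod M\<^esub> g"
      using mixed_commutator_trivial_mod[OF N f.group_hom_axioms[unfolded M_def] ker[unfolded M_def] g(1)
          commutator_in_derived[OF ab(1)[OF i] ab(2)[OF i]], folded M_def]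
      using ab i g by (simp add: f.hom_commutator)
  next
    have "list_product (G Mod M) (map (\<lambda>i. commutator (G Mod M) (?a i) (?b i)) is)
      = M #> list_product G (map (\<lambda>i. commutator G (a i) (b i)) is)"
      using ab by (subst f.hom_list_product) (auto simp: f.hom_commutator o_def intro!: arg_cong2[where f="\<lambda>x y. foldr _ x y"])
    then show "list_product (G Mod M) (map (\<lambda>i. commutator (G Mod M) (?a i) (?b i)) is) = \<one>\<^bsub>G Mod M\<^esub>"
      using rel by simp
  qed (use ab in auto)
  also have "list_product (G Mod M) (map (\<lambda>i. commutator (G Mod M) (?a i [^]\<^bsub>G Mod M\<^esub> n) (?b i)) is)
      = M #> list_product G (map (\<lambda>i. commutator G (a i [^] n) (b i)) is)"
    using ab by (subst f.hom_list_product)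
      (auto simp: f.hom_commutator f.hom_nat_pow o_def intro!: arg_cong2[where f="\<lambda>x y. foldr _ x y"])
  finally have "M #> list_product G (map (\<lambda>i. commutator G (a i [^] n) (b i)) is) = M"
    by (simp add: FactGroup_def)
  moreover have "list_product G (map (\<lambda>i. commutator G (a i [^] n) (b i)) is) \<in> carrier G"
    using ab by (intro list_product_closed) auto
  from rcos_self[OF this M.subgroup_axioms] have
    "list_product G (map (\<lambda>i. commutator G (a i [^] n) (b i)) is)
      \<in> M #> list_product G (map (\<lambda>i. commutator G (a i [^] n) (b i)) is)" .
  ultimately show ?thesis unfolding M_def[symmetric] by (rule subst)
qed

end

lemma (in group) list_product_fours:
  assumes "\<And>k. k < 4 * m \<Longrightarrow> e k \<in> carrier G"
  shows "list_product G (map e [0..<4 * m])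
    = list_product G (map (\<lambda>i. e (4 * i) \<otimes> e (4 * i + 1) \<otimes> e (4 * i + 2) \<otimes> e (4 * i + 3)) [0..<m])"
  using assms
proof (induction m)
  case (Suc m)
  let ?f = "\<lambda>i. e (4 * i) \<otimes> e (4 * i + 1) \<otimes> e (4 * i + 2) \<otimes> e (4 * i + 3)"
  have f: "?f i \<in> carrier G" if "i \<le> m" for i using Suc.prems that by simp
  have "[0..<4 * Suc m] = [0..<4 * m] @ [4 * m, 4 * m + 1, 4 * m + 2, 4 * m + 3]"
    by (simp add: numeral_eq_Suc)
  then have "list_product G (map e [0..<4 * Suc m])
     = list_product G (map e [0..<4 * m]) \<otimes> list_product G [e (4 * m), e (4 * m + 1), e (4 * m + 2), e (4 * m + 3)]"
    using Suc.prems by (simp only: map_append list.map) (rule list_product_append; auto)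
  also have "\<dots> = list_product G (map ?f [0..<m]) \<otimes> list_product G [?f m]"
    using Suc by (simp add: m_assoc)
  also have "\<dots> = list_product G (map ?f [0..<m] @ [?f m])"
    using f by (intro list_product_append[symmetric]) auto
  finally show ?case by simp
qed simp

section \<open>Growth of a Heisenberg quasimorphism\<close>

text \<open>The function \<open>s\<close> behaves like the central coordinate of the Heisenberg group up to a bounded error.
On the common kernel of \<open>p\<close> and \<open>q\<close> it is a quasimorphism.\<close>

locale heisenberg_quasimorphism = group G for G (structure) +
  fixes p q s :: "'a \<Rightarrow> real" and c :: real
  assumes p_mult: "\<And>x y. x \<in> carrier G \<Longrightarrow> y \<in> carrier G \<Longrightarrow> p (x \<otimes> y) = p x + p y"
    and q_mult: "\<And>x y. x \<in> carrier G \<Longrightarrow> y \<in> carrier G \<Longrightarrow> q (x \<otimes> y) = q x + q y"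
    and s_mult: "\<And>x y. x \<in> carrier G \<Longrightarrow> y \<in> carrier G \<Longrightarrow>
          \<bar>s (x \<otimes> y) - s x - s y - p x * q y\<bar> \<le> c"
    and c_pos: "c > 0"
begin

lemma p_one: "p \<one> = 0" and q_one: "q \<one> = 0"
  using p_mult[of \<one> \<one>] q_mult[of \<one> \<one>] by auto

lemma s_one: "\<bar>s \<one>\<bar> \<le> c"
  using s_mult[of \<one> \<one>] p_one by auto

lemma p_inv: "x \<in> carrier G \<Longrightarrow> p (inv x) = - p x"
  using p_mult[of x "inv x"] p_one by simp

lemma q_inv: "x \<in> carrier G \<Longrightarrow> q (inv x) = - q x"
  using q_mult[of x "inv x"] q_one by simp

lemma s_inv: "x \<in> carrier G \<Longrightarrow> \<bar>s x + s (inv x) - p x * q x\<bar> \<le> 2 * c"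
  using s_mult[of x "inv x"] q_inv[of x] s_one by auto

text \<open>The error is \<open>c\<close> for each of three products and \<open>2 * c\<close> for each of two inverses.\<close>

lemma s_commutator:
  assumes x: "x \<in> carrier G" and y: "y \<in> carrier G"
  shows "\<bar>s (commutator G x y) - (p x * q y - p y * q x)\<bar> \<le> 7 * c"
proof -
  have 1: "\<bar>s (x \<otimes> y) - s x - s y - p x * q y\<bar> \<le> c" using s_mult[OF x y] .
  have 2: "\<bar>s (x \<otimes> y \<otimes> inv x) - s (x \<otimes> y) - s (inv x) + (p x + p y) * q x\<bar> \<le> c"
    using s_mult[of "x \<otimes> y" "inv x"] x y by (simp add: p_mult q_inv)
  have 3: "\<bar>s (commutator G x y) - s (x \<otimes> y \<otimes> inv x) - s (inv y) + p y * q y\<bar> \<le> c"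
    using s_mult[of "x \<otimes> y \<otimes> inv x" "inv y"] x y
    by (simp add: commutator_def p_mult p_inv q_inv)
  show ?thesis using 1 2 3 s_inv[OF x] s_inv[OF y] unfolding abs_le_iff
    by (simp add: algebra_simps)
qed

lemma derived_kernel:
  assumes "x \<in> derived G (carrier G)"
  shows "p x = 0 \<and> q x = 0"
proof -
  have "x \<in> generate G (derived_set G (carrier G))" using assms by (simp add: derived_def)
  then show ?thesis
  proof (induction rule: generate.induct)
    case (eng g h)
    then have "g \<in> carrier G" "h \<in> carrier G"
      using generate_in_carrier[OF derived_set_in_carrier] by auto
    with eng show ?case by (simp add: p_mult q_mult)
  qed (auto simp: p_one q_one p_mult q_mult p_inv q_inv)
qed

lemma s_list_product:
  assumes "\<And>i. i \<in> set is \<Longrightarrow> u i \<in> carrier G" "\<And>i. i \<in> set is \<Longrightarrow> p (u i) = 0"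
    and "\<And>i. i \<in> set is \<Longrightarrow> \<bar>s (u i) - t i\<bar> \<le> d"
  shows "\<bar>s (list_product G (map u is)) - (\<Sum>i\<leftarrow>is. t i)\<bar> \<le> (d + c) * length is + c"
  using assms
proof (induction "is")
  case Nil
  then show ?case using s_one by simp
next
  case (Cons i "is")
  let ?y = "list_product G (map u is)"
  have IH: "\<bar>s ?y - (\<Sum>i\<leftarrow>is. t i)\<bar> \<le> (d + c) * length is + c"
    by (rule Cons.IH) (use Cons.prems in auto)
  have ti: "\<bar>s (u i) - t i\<bar> \<le> d" and pi: "p (u i) = 0" and ui: "u i \<in> carrier G"
    using Cons.prems by auto
  have "?y \<in> carrier G" using Cons.prems by (intro list_product_closed) auto
  from s_mult[OF ui this] pi have "\<bar>s (u i \<otimes> ?y) - s (u i) - s ?y\<bar> \<le> c" by simp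
  with IH ti show ?case by (simp add: algebra_simps abs_le_iff)
qed

lemma s_pow:
  assumes x: "x \<in> carrier G" "p x = 0"
  shows "\<bar>s (x [^] (m::nat)) - m * s x\<bar> \<le> c * m + c"
proof (induction m)
  case 0
  then show ?case using s_one by simp
next
  case (Suc m)
  have "p (x [^] m) = 0" using x by (induction m) (auto simp: p_one p_mult)
  then have "\<bar>s (x [^] Suc m) - s (x [^] m) - s x\<bar> \<le> c"
    using s_mult[of "x [^] m" x] x by simp
  then show ?case using Suc by (simp add: algebra_simps abs_le_iff)
qed

text \<open>A mixed commutator \<open>[g,w]\<close> with \<open>w\<close> in the derived subgroup has \<open>p w = q w = 0\<close>, so the bilinear part of
\<open>s [g,w]\<close> vanishes and only the bounded error of \<open>s_commutator\<close> remains.\<close>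

lemma s_le_cl:
  assumes x: "x \<in> mixed_commutator_subgroup G (derived G (carrier G))"
  shows "\<bar>s x\<bar> \<le> 8 * c * cl G (derived G (carrier G)) x + c"
proof -
  let ?N = "derived G (carrier G)"
  obtain cs where cs: "set cs \<subseteq> mixed_commutators G ?N" "list_product G cs = x"
    "length cs = cl G ?N x"
    using cl_list[OF derived_self_is_normal x] .
  have *: "p d = 0 \<and> \<bar>s d - 0\<bar> \<le> 7 * c" if d: "d \<in> set cs" for d
  proof -
    obtain g w where gw: "g \<in> carrier G" "w \<in> ?N" "d = commutator G g w"
      using cs d by (auto simp: mixed_commutators_eq)
    then have w: "w \<in> carrier G" using derived_in_carrier by blast
    have "p d = 0" using commutator_in_derived[OF gw(1) w] derived_kernel gw(3) by blast
    then show ?thesis using s_commutator[OF gw(1) w] derived_kernel[OF gw(2)] gw(3) by simp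
  qed
  have "set cs \<subseteq> carrier G" using cs mixed_commutators_closed[OF derived_self_is_normal] by blast
  then show ?thesis
    using s_list_product[of cs "\<lambda>x. x" "\<lambda>_. 0" "7 * c"] * cs by auto
qed

text \<open>On the powers of \<open>x\<close> the function \<open>s\<close> grows linearly, because \<open>p x = 0\<close>, and \<open>cl\<close> bounds it from
above.\<close>

lemma s_le_scl:
  assumes x: "x \<in> mixed_commutator_subgroup G (derived G (carrier G))"
  shows "\<bar>s x\<bar> \<le> 8 * c * scl G (derived G (carrier G)) x + 3 * c"
proof -
  let ?N = "derived G (carrier G)"
  have xG: "x \<in> carrier G"
    using normal.axioms(1)[OF mixed_commutator_subgroup_normal[OF derived_self_is_normal]] x
    by (rule subgroup.mem_carrier)
  have "?N \<lhd> G" by (rule derived_self_is_normal)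
  have px: "p x = 0"
  proof -
    have "mixed_commutators G ?N \<subseteq> ?N"
      using commutator_in_derived derived_in_carrier by (auto simp: mixed_commutators_eq)
    then have "x \<in> ?N"
      using x generate_subgroup_incl[OF _ normal_imp_subgroup[OF derived_self_is_normal]]
      unfolding mixed_commutator_subgroup_def by blast
    then show ?thesis using derived_kernel by blast
  qed
  have "(\<bar>s x\<bar> - 3 * c) / (8 * c) \<le> real (cl G ?N (x [^] m)) / real m" if m: "m \<ge> 1" for m :: nat
  proof -
    have "m * \<bar>s x\<bar> \<le> \<bar>s (x [^] m)\<bar> + (c * m + c)"
    proof -
      have "m * \<bar>s x\<bar> = \<bar>m * s x\<bar>" by (simp add: abs_mult)
      then show ?thesis using s_pow[OF xG px, of m] by linarith
    qed
    also have "\<bar>s (x [^] m)\<bar> \<le> 8 * c * cl G ?N (x [^] m) + c"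
      by (rule s_le_cl[OF pow_mixed_commutator_subgroup[OF derived_self_is_normal x]])
    finally have "m * \<bar>s x\<bar> \<le> 8 * c * cl G ?N (x [^] m) + c * m + 2 * c" by simp
    moreover have "2 * c \<le> 2 * c * m" using m c_pos by simp
    ultimately have "m * (\<bar>s x\<bar> - 3 * c) \<le> 8 * c * cl G ?N (x [^] m)" by (simp add: algebra_simps)
    then show ?thesis using m c_pos by (simp add: field_simps)
  qed
  then have "(\<bar>s x\<bar> - 3 * c) / (8 * c) \<le> scl G ?N x"
    using LIMSEQ_le_const[OF scl_LIMSEQ[OF derived_self_is_normal x]] by blast
  then show ?thesis using c_pos by (simp add: field_simps)
qed

theorem not_scl_equivalent_derived:
  assumes ab: "\<And>i. i \<in> set is \<Longrightarrow> a i \<in> carrier G" "\<And>i. i \<in> set is \<Longrightarrow> b i \<in> carrier G"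
    and rel: "list_product G (map (\<lambda>i. commutator G (a i) (b i)) is) = \<one>"
    and nonzero: "(\<Sum>i\<leftarrow>is. p (a i) * q (b i) - p (b i) * q (a i)) \<noteq> 0"
  shows "\<not> scl_equivalent G (derived G (carrier G))"
proof
  let ?N = "derived G (carrier G)"
  define S where "S = (\<Sum>i\<leftarrow>is. p (a i) * q (b i) - p (b i) * q (a i))"
  define l where "l = length is"
  assume "scl_equivalent G ?N"
  then obtain C where C: "C > 0"
    "\<And>x. x \<in> mixed_commutator_subgroup G ?N \<Longrightarrow> scl G ?N x \<le> C * scl G (carrier G) x"
    by (auto simp: scl_equivalent_def)
  define cs where "cs n = map (\<lambda>i. commutator G (a i [^] n) (b i)) is" for n :: nat
  have bound: "n * \<bar>S\<bar> \<le> 8 * c * (C * l) + 3 * c + (8 * c * l + c)" for n :: nat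
  proof -
    define x where "x = list_product G (cs n)"
    have x: "x \<in> mixed_commutator_subgroup G ?N"
      unfolding x_def cs_def using list_product_commutator_pow_mem[OF ab rel] .
    have "set (cs n) \<subseteq> mixed_commutators G (carrier G)"
      unfolding cs_def mixed_commutators_eq using ab by (auto intro!: exI)
    from scl_le_length[OF normal_self this] have "scl G (carrier G) x \<le> l"
      by (simp add: x_def cs_def l_def)
    then have "scl G ?N x \<le> C * l" using C(2)[OF x] C(1) by (meson mult_left_mono less_imp_le order_trans)
    then have 1: "\<bar>s x\<bar> \<le> 8 * c * (C * l) + 3 * c"
      using s_le_scl[OF x] c_pos by (smt (verit) mult_left_mono)
    have pow: "p (a i [^] n) = n * p (a i)" "q (a i [^] n) = n * q (a i)" if "i \<in> set is" for i
      by (induction n) (use ab(1)[OF that] in \<open>auto simp: p_one q_one p_mult q_mult algebra_simps\<close>)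
    have "\<bar>s x - (\<Sum>i\<leftarrow>is. n * (p (a i) * q (b i) - p (b i) * q (a i)))\<bar> \<le> (7 * c + c) * length is + c"
      unfolding x_def cs_def
    proof (rule s_list_product)
      fix i assume i: "i \<in> set is"
      show "commutator G (a i [^] n) (b i) \<in> carrier G" using ab[OF i] by simp
      show "p (commutator G (a i [^] n) (b i)) = 0"
        using ab[OF i] derived_kernel[OF commutator_in_derived] by auto
      show "\<bar>s (commutator G (a i [^] n) (b i)) - n * (p (a i) * q (b i) - p (b i) * q (a i))\<bar> \<le> 7 * c"
        using s_commutator[of "a i [^] n" "b i"] ab[OF i] pow[OF i] by (simp add: algebra_simps)
    qed
    then have "\<bar>s x - n * S\<bar> \<le> 8 * c * l + c"
      by (simp add: S_def l_def sum_list_const_mult)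
    then have "\<bar>n * S\<bar> \<le> \<bar>s x\<bar> + (8 * c * l + c)" by linarith
    then show ?thesis using 1 by (simp add: abs_mult)
  qed
  obtain n :: nat where "real n > (8 * c * (C * l) + 3 * c + (8 * c * l + c)) / \<bar>S\<bar>"
    using reals_Archimedean2 by blast
  then have "n * \<bar>S\<bar> > 8 * c * (C * l) + 3 * c + (8 * c * l + c)"
    using nonzero by (simp add: S_def field_simps)
  with bound[of n] show False by simp
qed

end

section \<open>A central extension combining the Euler and the symplectic class\<close>

text \<open>The hypothesis is the Pluecker relation between the six determinants of four vectors in the plane.  It
forces \<open>x12 * x23\<close> to share its sign with one of the two summands unless these cancel, and the
conclusion depends on signs only.\<close>

lemma sgn_plucker:
  fixes x1 x2 x3 x12 x23 x123 :: real
  assumes plucker: "x12 * x23 = x1 * x3 + x2 * x123"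
    and nz: "x1 \<noteq> 0" "x2 \<noteq> 0" "x3 \<noteq> 0"
  shows "sgn (x1 * x2 * x12) + sgn (x12 * x3 * x123) = sgn (x2 * x3 * x23) + sgn (x1 * x23 * x123)"
proof -
  have sum: "sgn (y + z) = sgn y \<or> sgn z = - sgn y" if "y \<noteq> 0" for y z :: real
    using that by (auto simp: sgn_real_def split: if_splits)
  have key: "t1 * t2 * t12 + t12 * t3 * t123 = t2 * t3 * t23 + t1 * t23 * t123"
    if "t12 * t23 = t1 * t3 \<or> t2 * t123 = - (t1 * t3)" "t1 = -1 \<or> t1 = 1" "t2 = -1 \<or> t2 = 1"
      "t3 = -1 \<or> t3 = 1" "t12 = -1 \<or> t12 = 0 \<or> t12 = 1" "t23 = -1 \<or> t23 = 0 \<or> t23 = 1"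
      "t123 = -1 \<or> t123 = 0 \<or> t123 = 1"
    for t1 t2 t3 t12 t23 t123 :: real
    using that(2-7) that(1) by (elim disjE) simp_all
  have "sgn x12 * sgn x23 = sgn x1 * sgn x3 \<or> sgn x2 * sgn x123 = - (sgn x1 * sgn x3)"
    using sum[of "x1 * x3" "x2 * x123"] nz unfolding plucker[symmetric] sgn_mult by simp
  moreover have "sgn x1 = -1 \<or> sgn x1 = 1" "sgn x2 = -1 \<or> sgn x2 = 1" "sgn x3 = -1 \<or> sgn x3 = 1"
    "sgn x12 = -1 \<or> sgn x12 = 0 \<or> sgn x12 = 1" "sgn x23 = -1 \<or> sgn x23 = 0 \<or> sgn x23 = 1"
    "sgn x123 = -1 \<or> sgn x123 = 0 \<or> sgn x123 = 1"
    using nz by (auto simp: sgn_real_def)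
  ultimately show ?thesis unfolding sgn_mult by (rule key)
qed

text \<open>With lower left entries \<open>c\<close>, the function \<open>sgn (c * c' * c'')\<close> of two matrices and their product is, up to sign, the
orientation of the triple of lines spanned by \<open>e, g e, g g' e\<close>, for the first basis vector
\<open>e\<close>.  The cyclic order of lines is invariant, which makes this a cocycle; it represents a
multiple of the Euler class.  It is bounded, and this boundedness is the reason for its use.  Matrices that
fix the line of \<open>e\<close> give degenerate triples and are treated separately.\<close>

lemma sgn_cocycle:
  fixes a1 b1 c1 d1 a2 b2 c2 d2 a3 b3 c3 d3 :: real
  assumes "a1 * d1 - b1 * c1 = 1" "a2 * d2 - b2 * c2 = 1" "a3 * d3 - b3 * c3 = 1"
  defines "c12 \<equiv> c1 * a2 + d1 * c2" and "c23 \<equiv> c2 * a3 + d2 * c3"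
  defines "c123 \<equiv> c12 * a3 + (c1 * b2 + d1 * d2) * c3"
  shows "sgn (c1 * c2 * c12) + sgn (c12 * c3 * c123) = sgn (c2 * c3 * c23) + sgn (c1 * c23 * c123)"
proof -
  have same: "sgn x = sgn y" if "x * y = 1" for x y :: real
    using that zero_less_mult_iff[of x y] by (auto simp: sgn_real_def)
  consider "c1 = 0" | "c2 = 0" | "c3 = 0" | "c1 \<noteq> 0" "c2 \<noteq> 0" "c3 \<noteq> 0" by blast
  then show ?thesis
  proof cases
    case 1
    then have "c12 = d1 * c2" "c123 = d1 * c23" "d1 \<noteq> 0"
      using assms(1) by (auto simp: c12_def c23_def c123_def algebra_simps)
    then show ?thesis using 1 by (simp add: sgn_mult)
  next
    case 2
    then have "c12 = c1 * a2" "c23 = d2 * c3"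
      by (auto simp: c12_def c23_def)
    moreover have "sgn a2 = sgn d2" using same[of a2 d2] assms(2) 2 by simp
    ultimately show ?thesis using 2 by (simp add: sgn_mult)
  next
    case 3
    then have "c23 = c2 * a3" "c123 = c12 * a3" "a3 \<noteq> 0"
      using assms(3) by (auto simp: c12_def c23_def c123_def algebra_simps)
    then show ?thesis using 3 by (simp add: sgn_mult)
  next
    case 4
    have "c12 * c23 - (c1 * c3 + c2 * c123) = c1 * c3 * (a2 * d2 - b2 * c2 - 1)"
      by (simp add: c12_def c23_def c123_def algebra_simps)
    then have "c12 * c23 = c1 * c3 + c2 * c123" using assms(2) by simp
    then show ?thesis using 4 by (rule sgn_plucker)
  qed
qed

type_synonym sl2_heisenberg = "(real \<times> real \<times> real \<times> real) \<times> real \<times> real \<times> real"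

text \<open>The quotient by the central last coordinate is \<open>SL\<^sub>2\<close> times the plane of pairs \<open>(p, q)\<close>.  The factor 4 is the
value that balances the Euler number of the matrices below, which contributes \<open>-4\<close> to the last
coordinate of the relator.\<close>

definition euler_heisenberg :: "sl2_heisenberg monoid" where
  "euler_heisenberg =
     \<lparr> carrier = {((a, b, c, d), p, q, s). a * d - b * c = 1},
       mult = (\<lambda>((a, b, c, d), p, q, s) ((a', b', c', d'), p', q', s').
         ((a * a' + b * c', a * b' + b * d', c * a' + d * c', c * b' + d * d'),
          p + p', q + q', s + s' + 4 * p * q' + sgn (c * c' * (c * a' + d * c')))),
       one = ((1, 0, 0, 1), 0, 0, 0) \<rparr>"

definition euler_heisenberg_inv :: "sl2_heisenberg \<Rightarrow> sl2_heisenberg" where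
  "euler_heisenberg_inv =
     (\<lambda>((a, b, c, d), p, q, s). ((d, - b, - c, a), - p, - q, - s + 4 * p * q))"

lemma group_euler_heisenberg: "group euler_heisenberg"
proof (rule groupI)
  fix x y z
  assume "x \<in> carrier euler_heisenberg" "y \<in> carrier euler_heisenberg" "z \<in> carrier euler_heisenberg"
  moreover obtain a1 b1 c1 d1 p1 q1 s1 where x: "x = ((a1, b1, c1, d1), p1, q1, s1)" by (cases x) auto
  moreover obtain a2 b2 c2 d2 p2 q2 s2 where y: "y = ((a2, b2, c2, d2), p2, q2, s2)" by (cases y) auto
  moreover obtain a3 b3 c3 d3 p3 q3 s3 where z: "z = ((a3, b3, c3, d3), p3, q3, s3)" by (cases z) auto
  ultimately have det: "a1 * d1 - b1 * c1 = 1" "a2 * d2 - b2 * c2 = 1" "a3 * d3 - b3 * c3 = 1"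
    by (auto simp: euler_heisenberg_def)
  show "x \<otimes>\<^bsub>euler_heisenberg\<^esub> y \<otimes>\<^bsub>euler_heisenberg\<^esub> z
      = x \<otimes>\<^bsub>euler_heisenberg\<^esub> (y \<otimes>\<^bsub>euler_heisenberg\<^esub> z)"
  proof -
    have e123: "c1 * (a2 * a3 + b2 * c3) + d1 * (c2 * a3 + d2 * c3)
        = (c1 * a2 + d1 * c2) * a3 + (c1 * b2 + d1 * d2) * c3" by (simp add: algebra_simps)
    have "4 * (p1 + p2) * q3 = 4 * p1 * q3 + 4 * p2 * q3" "4 * p1 * (q2 + q3) = 4 * p1 * q2 + 4 * p1 * q3"
      by (simp_all add: algebra_simps)
    then have S: "s1 + s2 + 4 * p1 * q2 + sgn (c1 * c2 * (c1 * a2 + d1 * c2)) + s3 + 4 * (p1 + p2) * q3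
        + sgn ((c1 * a2 + d1 * c2) * c3 * ((c1 * a2 + d1 * c2) * a3 + (c1 * b2 + d1 * d2) * c3))
      = s1 + (s2 + s3 + 4 * p2 * q3 + sgn (c2 * c3 * (c2 * a3 + d2 * c3))) + 4 * p1 * (q2 + q3)
        + sgn (c1 * (c2 * a3 + d2 * c3) * ((c1 * a2 + d1 * c2) * a3 + (c1 * b2 + d1 * d2) * c3))"
      using sgn_cocycle[OF det] by linarith
    show ?thesis unfolding x y z euler_heisenberg_def
      by (simp only: monoid.simps prod.case prod.inject e123 S) (simp add: algebra_simps)
  qed
next
  fix x y
  assume "x \<in> carrier euler_heisenberg" "y \<in> carrier euler_heisenberg"
  moreover obtain a1 b1 c1 d1 p1 q1 s1 where x: "x = ((a1, b1, c1, d1), p1, q1, s1)" by (cases x) auto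
  moreover obtain a2 b2 c2 d2 p2 q2 s2 where y: "y = ((a2, b2, c2, d2), p2, q2, s2)" by (cases y) auto
  moreover have "(a1 * a2 + b1 * c2) * (c1 * b2 + d1 * d2) - (a1 * b2 + b1 * d2) * (c1 * a2 + d1 * c2)
       = (a1 * d1 - b1 * c1) * (a2 * d2 - b2 * c2)" by (simp add: algebra_simps)
  ultimately show "x \<otimes>\<^bsub>euler_heisenberg\<^esub> y \<in> carrier euler_heisenberg"
    by (simp add: euler_heisenberg_def)
next
  fix x assume x: "x \<in> carrier euler_heisenberg"
  show "\<exists>y\<in>carrier euler_heisenberg. y \<otimes>\<^bsub>euler_heisenberg\<^esub> x = \<one>\<^bsub>euler_heisenberg\<^esub>"
    by (rule bexI[of _ "euler_heisenberg_inv x"])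
      (use x in \<open>auto simp: euler_heisenberg_def euler_heisenberg_inv_def mult.commute\<close>)
qed (auto simp: euler_heisenberg_def)

interpretation EH: group euler_heisenberg by (rule group_euler_heisenberg)

lemma inv_euler_heisenberg:
  assumes "x \<in> carrier euler_heisenberg"
  shows "inv\<^bsub>euler_heisenberg\<^esub> x = euler_heisenberg_inv x"
  by (rule EH.inv_equality)
    (use assms in \<open>auto simp: euler_heisenberg_def euler_heisenberg_inv_def mult.commute\<close>)

text \<open>The matrices for \<open>i = 1\<close> are the conjugates of those for \<open>i = 0\<close> by a matrix of positive determinant
and trace zero that inverts the commutator of the latter.  That commutator is hyperbolic with negative
trace, so the two handles turn the circle in the same sense and their Euler numbers add up instead of cancelling.\<close>

definition handle_a :: "nat \<Rightarrow> sl2_heisenberg" where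
  "handle_a i = (if i = 0 then ((1, -2, -1, 3), 1, 0, 0)
     else if i = 1 then ((3, 2 / 7, 7, 1), 0, 0, 0) else ((1, 0, 0, 1), 0, 0, 0))"

definition handle_b :: "nat \<Rightarrow> sl2_heisenberg" where
  "handle_b i = (if i = 0 then ((1, 2, 1, 3), 0, 1, 0)
     else if i = 1 then ((3, - 2 / 7, - 7, 1), 0, 0, 0) else ((1, 0, 0, 1), 0, 0, 0))"

lemma handle_closed [simp]:
  "handle_a i \<in> carrier euler_heisenberg" "handle_b i \<in> carrier euler_heisenberg"
  by (auto simp: handle_a_def handle_b_def euler_heisenberg_def)

text \<open>The sign cocycle contributes \<open>-1\<close> and \<open>-3\<close>, and the Heisenberg part of the first pair 4.\<close>

lemma handle_commutator:
  "commutator euler_heisenberg (handle_a 0) (handle_b 0) = ((-15, 8, 28, -15), 0, 0, 3)"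
  "commutator euler_heisenberg (handle_a 1) (handle_b 1) = ((-15, -8, -28, -15), 0, 0, -3)"
  unfolding commutator_def
  by (simp_all add: inv_euler_heisenberg)
    (simp_all add: handle_a_def handle_b_def euler_heisenberg_inv_def euler_heisenberg_def)

lemma handle_relation:
  assumes "l \<ge> 2"
  shows "list_product euler_heisenberg
     (map (\<lambda>i. commutator euler_heisenberg (handle_a i) (handle_b i)) [0..<l])
     = \<one>\<^bsub>euler_heisenberg\<^esub>"
proof -
  have split: "[0..<l] = 0 # 1 # [2..<l]" using assms upt_conv_Cons[of 0 l] upt_conv_Cons[of 1 l]
    by (simp add: numeral_2_eq_2)
  have triv: "commutator euler_heisenberg (handle_a i) (handle_b i) = \<one>\<^bsub>euler_heisenberg\<^esub>" if "i \<ge> 2" for i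
  proof -
    have "handle_a i = \<one>\<^bsub>euler_heisenberg\<^esub>" "handle_b i = \<one>\<^bsub>euler_heisenberg\<^esub>"
      using that by (auto simp: handle_a_def handle_b_def euler_heisenberg_def)
    then show ?thesis by (simp add: commutator_def)
  qed
  have "list_product euler_heisenberg
     (map (\<lambda>i. commutator euler_heisenberg (handle_a i) (handle_b i)) is) = \<one>\<^bsub>euler_heisenberg\<^esub>"
    if "\<forall>i\<in>set is. i \<ge> 2" for "is"
    using that by (induction "is") (auto simp: triv)
  from this[of "[2..<l]"] show ?thesis unfolding split
    by (simp only: list.map foldr.simps o_apply handle_commutator) (simp add: euler_heisenberg_def)
qed

definition eh_p :: "sl2_heisenberg \<Rightarrow> real" where "eh_p = (\<lambda>(_, p, _, _). p)"
definition eh_q :: "sl2_heisenberg \<Rightarrow> real" where "eh_q = (\<lambda>(_, _, q, _). q)"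
definition eh_s :: "sl2_heisenberg \<Rightarrow> real" where "eh_s = (\<lambda>(_, _, _, s). s)"

lemma eh_mult:
  "eh_p (x \<otimes>\<^bsub>euler_heisenberg\<^esub> y) = eh_p x + eh_p y"
  "eh_q (x \<otimes>\<^bsub>euler_heisenberg\<^esub> y) = eh_q x + eh_q y"
  "\<bar>eh_s (x \<otimes>\<^bsub>euler_heisenberg\<^esub> y) - eh_s x - eh_s y - 4 * eh_p x * eh_q y\<bar> \<le> 1"
  by (auto simp: euler_heisenberg_def eh_p_def eh_q_def eh_s_def sgn_real_def split: prod.splits)

text \<open>The only term of the product that is not accounted for by \<open>p\<close> and \<open>q\<close> is the sign cocycle, which is
bounded by 1.\<close>

lemma heisenberg_quasimorphism_pullback:
  assumes "group G" "\<psi> \<in> hom G euler_heisenberg"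
  shows "heisenberg_quasimorphism G (\<lambda>x. 4 * eh_p (\<psi> x)) (\<lambda>x. eh_q (\<psi> x)) (\<lambda>x. eh_s (\<psi> x)) 1"
proof -
  interpret group G by fact
  show ?thesis
    by unfold_locales (use assms(2) eh_mult in \<open>simp_all add: hom_def Pi_def\<close>)
qed

section \<open>Homotopy of paths and the fundamental group\<close>

text \<open>The analogue of \<open>homotopic_paths\<close> for an abstract topology.\<close>

definition path_homotopic :: "'a topology \<Rightarrow> (real \<Rightarrow> 'a) \<Rightarrow> (real \<Rightarrow> 'a) \<Rightarrow> bool" where
  "path_homotopic X p q =
     homotopic_with (\<lambda>h. h 0 = p 0 \<and> h 1 = p 1) (top_of_set {0..1}) X p q"

definition reverse_path :: "(real \<Rightarrow> 'a) \<Rightarrow> real \<Rightarrow> 'a" where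
  "reverse_path p = (\<lambda>t. p (1 - t))"

lemma loop_concat_0_1 [simp]: "loop_concat p q 0 = p 0" "loop_concat p q 1 = q 1"
  by (simp_all add: loop_concat_def)

lemma reverse_path_0_1 [simp]: "reverse_path p 0 = p 1" "reverse_path p 1 = p 0"
  by (simp_all add: reverse_path_def)

lemma path_homotopic_imp:
  assumes "path_homotopic X p q"
  shows "pathin X p" "pathin X q" "q 0 = p 0" "q 1 = p 1"
  using homotopic_with_imp_continuous_maps[OF assms[unfolded path_homotopic_def]]
    homotopic_with_imp_property[OF assms[unfolded path_homotopic_def]]
  by (auto simp: pathin_def)

lemma path_homotopic_refl: "pathin X p \<Longrightarrow> path_homotopic X p p"
  by (simp add: path_homotopic_def pathin_def)

lemma path_homotopic_sym:
  assumes "path_homotopic X p q" shows "path_homotopic X q p"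
  using homotopic_with_symD[OF assms[unfolded path_homotopic_def]] path_homotopic_imp[OF assms]
  by (simp add: path_homotopic_def)

lemma path_homotopic_trans [trans]:
  assumes "path_homotopic X p q" "path_homotopic X q r" shows "path_homotopic X p r"
proof -
  have "homotopic_with (\<lambda>h. h 0 = p 0 \<and> h 1 = p 1) (top_of_set {0..1}) X q r"
    using assms(2) path_homotopic_imp[OF assms(1)] by (simp add: path_homotopic_def)
  with assms(1) show ?thesis unfolding path_homotopic_def by (rule homotopic_with_trans)
qed

text \<open>Every homotopy that is needed for the groupoid laws and for the boundary of the polygon comes from a
straight line homotopy in a convex parameter space.\<close>

lemma path_homotopic_convex:
  fixes S :: "'b::real_normed_vector set"
  assumes "convex S" "continuous_map (top_of_set S) X \<Phi>"
    and u: "continuous_on {0..1} u" "u \<in> {0..1} \<rightarrow> S"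
    and v: "continuous_on {0..1} v" "v \<in> {0..1} \<rightarrow> S"
    and ends: "u 0 = v 0" "u 1 = v 1"
  shows "path_homotopic X (\<lambda>t::real. \<Phi> (u t)) (\<lambda>t. \<Phi> (v t))"
proof -
  let ?h = "\<lambda>z::real \<times> real. (1 - fst z) *\<^sub>R u (snd z) + fst z *\<^sub>R v (snd z)"
  have "continuous_on ({0..1} \<times> {0..1}) ?h"
    by (intro continuous_intros continuous_on_compose2[OF u(1)] continuous_on_compose2[OF v(1)]) auto
  moreover have "?h \<in> ({0..1} \<times> {0..1}) \<rightarrow> S"
    using u(2) v(2) \<open>convex S\<close> by (auto simp: Pi_iff convex_def)
  ultimately have "continuous_map (top_of_set ({0..1} \<times> {0..1})) (top_of_set S) ?h"
    by (auto simp: continuous_map_in_subtopology)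
  then have "continuous_map (top_of_set ({0..1} \<times> {0..1})) X (\<Phi> \<circ> ?h)"
    using assms(2) by (rule continuous_map_compose)
  then show ?thesis
    unfolding path_homotopic_def homotopic_with_def
    by (intro exI[of _ "\<Phi> \<circ> ?h"]) (auto simp: ends algebra_simps simp flip: scaleR_add_left)
qed

lemma path_homotopic_reparam:
  assumes "pathin X p"
    and "continuous_on {0..1} u" "u \<in> {0..1} \<rightarrow> {0..1}"
    and "continuous_on {0..1} v" "v \<in> {0..1} \<rightarrow> {0..1}"
    and "u 0 = v 0" "u 1 = v 1"
  shows "path_homotopic X (\<lambda>t. p (u t)) (\<lambda>t. p (v t))"
  using assms path_homotopic_convex[of "{0..1}" X p u v] by (simp add: pathin_def)

lemma path_homotopic_concat:
  assumes pp: "path_homotopic X p p'" and qq: "path_homotopic X q q'" and pq: "p 1 = q 0"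
  shows "path_homotopic X (loop_concat p q) (loop_concat p' q')"
proof -
  let ?I = "{0..1} \<times> {0..1} :: (real \<times> real) set"
  obtain h where h: "continuous_map (top_of_set ?I) X h" "\<And>x. h (0, x) = p x" "\<And>x. h (1, x) = p' x"
    "\<And>t. t \<in> {0..1} \<Longrightarrow> h (t, 0) = p 0 \<and> h (t, 1) = p 1"
    using pp unfolding path_homotopic_def homotopic_with_def by auto
  obtain k where k: "continuous_map (top_of_set ?I) X k" "\<And>x. k (0, x) = q x" "\<And>x. k (1, x) = q' x"
    "\<And>t. t \<in> {0..1} \<Longrightarrow> k (t, 0) = q 0 \<and> k (t, 1) = q 1"
    using qq unfolding path_homotopic_def homotopic_with_def by auto
  let ?H = "\<lambda>z. if snd z \<le> 1/2 then (h \<circ> (\<lambda>z. (fst z, 2 * snd z))) z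
     else (k \<circ> (\<lambda>z. (fst z, 2 * snd z - 1))) z"
  have "continuous_map (top_of_set ?I) X ?H"
  proof (rule continuous_map_cases_le)
    show "continuous_map (subtopology (top_of_set ?I) {z \<in> topspace (top_of_set ?I). snd z \<le> 1/2}) X
        (h \<circ> (\<lambda>z. (fst z, 2 * snd z)))"
      by (rule continuous_map_compose[OF _ h(1)])
        (auto simp: subtopology_subtopology continuous_map_in_subtopology intro!: continuous_intros)
    show "continuous_map (subtopology (top_of_set ?I) {z \<in> topspace (top_of_set ?I). 1/2 \<le> snd z}) X
        (k \<circ> (\<lambda>z. (fst z, 2 * snd z - 1)))"
      by (rule continuous_map_compose[OF _ k(1)])
        (auto simp: subtopology_subtopology continuous_map_in_subtopology intro!: continuous_intros)
    show "(h \<circ> (\<lambda>z. (fst z, 2 * snd z))) z = (k \<circ> (\<lambda>z. (fst z, 2 * snd z - 1))) z"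
      if "z \<in> topspace (top_of_set ?I)" "snd z = 1/2" for z
    proof -
      have z: "2 * snd z = 1" "fst z \<in> {0..1}" using that by auto
      then show ?thesis using h(4)[OF z(2)] k(4)[OF z(2)] pq by simp
    qed
  qed (auto intro!: continuous_intros)
  then show ?thesis
    unfolding path_homotopic_def homotopic_with_def
    by (intro exI[of _ ?H]) (auto simp: loop_concat_def h k)
qed

lemma path_homotopic_eq:
  assumes "pathin X p" "\<And>t. t \<in> {0..1} \<Longrightarrow> p t = q t"
  shows "path_homotopic X p q"
  unfolding path_homotopic_def
  by (rule homotopic_with_equal) (use assms in \<open>auto simp: pathin_def\<close>)

lemma pathin_concat:
  assumes "pathin X p" "pathin X q" "p 1 = q 0"
  shows "pathin X (loop_concat p q)"
  using path_homotopic_imp(1)[OF path_homotopic_concat[OF path_homotopic_refl path_homotopic_refl]] assms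
  by blast

lemma pathin_reverse: "pathin X p \<Longrightarrow> pathin X (reverse_path p)"
  unfolding reverse_path_def
  by (rule path_homotopic_imp(1)[OF path_homotopic_reparam[of X p "\<lambda>t. 1 - t" "\<lambda>t. 1 - t"]])
    (auto intro!: continuous_intros)

lemma path_homotopic_assoc:
  assumes "pathin X p" "pathin X q" "pathin X r" "p 1 = q 0" "q 1 = r 0"
  shows "path_homotopic X (loop_concat (loop_concat p q) r) (loop_concat p (loop_concat q r))"
proof -
  \<comment> \<open>the concave piecewise linear function that maps the breakpoints \<open>1/4, 1/2\<close> to \<open>1/2, 3/4\<close>\<close>
  let ?u = "\<lambda>t::real. min (2 * t) (min (t + 1/4) ((t + 1) / 2))"
  have "pathin X (loop_concat p (loop_concat q r))"
    using assms by (simp add: pathin_concat)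
  then have "path_homotopic X (\<lambda>t. loop_concat p (loop_concat q r) (?u t))
      (\<lambda>t. loop_concat p (loop_concat q r) t)"
    by (rule path_homotopic_reparam) (auto intro!: continuous_intros simp: min_le_iff_disj)
  moreover have "loop_concat p (loop_concat q r) (?u t) = loop_concat (loop_concat p q) r t" for t
  proof -
    consider "t \<le> 1/4" | "1/4 < t" "t \<le> 1/2" | "1/2 < t" by linarith
    then show ?thesis
    proof cases
      case 2
      then have "?u t = t + 1/4" by (auto simp: min_def)
      moreover have "2 * (2 * (t + 1/4) - 1) = 2 * (2 * t) - 1" by simp
      ultimately show ?thesis using 2 by (simp add: loop_concat_def)
    next
      case 3
      then have "?u t = (t + 1) / 2" by (auto simp: min_def)
      then show ?thesis using 3 by (simp add: loop_concat_def field_simps)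
    qed (simp add: loop_concat_def min_def)
  qed
  ultimately show ?thesis by simp
qed

lemma path_homotopic_const_left:
  assumes "pathin X p"
  shows "path_homotopic X (loop_concat (\<lambda>_. p 0) p) p"
proof -
  have "path_homotopic X (\<lambda>t. p (max 0 (2 * t - 1))) (\<lambda>t. p t)"
    by (rule path_homotopic_reparam[OF assms]) (auto intro!: continuous_intros)
  moreover have "p (max 0 (2 * t - 1)) = loop_concat (\<lambda>_. p 0) p t" for t
  proof -
    have "max 0 (2 * t - 1) = (if t \<le> 1/2 then 0 else 2 * t - 1)" by auto
    then show ?thesis by (simp add: loop_concat_def)
  qed
  ultimately show ?thesis by simp
qed

lemma path_homotopic_reverse_right:
  assumes "pathin X p"
  shows "path_homotopic X (loop_concat p (reverse_path p)) (\<lambda>_. p 0)"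
proof -
  have "path_homotopic X (\<lambda>t. p (min (2 * t) (2 - 2 * t))) (\<lambda>t. p 0)"
    by (rule path_homotopic_reparam[OF assms]) (auto intro!: continuous_intros simp: min_le_iff_disj)
  moreover have "p (min (2 * t) (2 - 2 * t)) = loop_concat p (reverse_path p) t" for t
    by (auto simp: loop_concat_def reverse_path_def min_def)
  ultimately show ?thesis by simp
qed

lemma reverse_reverse_path [simp]: "reverse_path (reverse_path p) = p"
  by (simp add: reverse_path_def)

lemma path_homotopic_reverse_left:
  assumes "pathin X p"
  shows "path_homotopic X (loop_concat (reverse_path p) p) (\<lambda>_. p 1)"
  using path_homotopic_reverse_right[OF pathin_reverse[OF assms]] by simp

lemma homotopic_rel_base_iff:
  "homotopic_rel_base X x0 p q \<longleftrightarrow> path_homotopic X p q \<and> p 0 = x0 \<and> p 1 = x0"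
proof
  assume h: "homotopic_rel_base X x0 p q"
  from homotopic_with_imp_property[OF this[unfolded homotopic_rel_base_def]]
  have "p 0 = x0" "p 1 = x0" by auto
  with h show "path_homotopic X p q \<and> p 0 = x0 \<and> p 1 = x0"
    by (simp add: homotopic_rel_base_def path_homotopic_def)
next
  assume "path_homotopic X p q \<and> p 0 = x0 \<and> p 1 = x0"
  then have "path_homotopic X p q" and "p 0 = x0" "p 1 = x0" by auto
  then show "homotopic_rel_base X x0 p q"
    unfolding homotopic_rel_base_def path_homotopic_def by simp
qed

lemma mem_loop_class_iff:
  assumes "p \<in> loops X x0" shows "q \<in> loop_class X x0 p \<longleftrightarrow> path_homotopic X p q"
  using assms path_homotopic_imp[of X p q]
  by (auto simp: loop_class_def homotopic_rel_base_iff loops_def)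

lemma loop_class_eq_iff:
  assumes "p \<in> loops X x0" "q \<in> loops X x0"
  shows "loop_class X x0 p = loop_class X x0 q \<longleftrightarrow> path_homotopic X p q"
proof
  assume "loop_class X x0 p = loop_class X x0 q"
  moreover have "q \<in> loop_class X x0 q"
    using assms by (simp add: mem_loop_class_iff path_homotopic_refl loops_def)
  ultimately show "path_homotopic X p q" using assms(1) mem_loop_class_iff by metis
next
  assume pq: "path_homotopic X p q"
  then have "path_homotopic X p r \<longleftrightarrow> path_homotopic X q r" for r
    using path_homotopic_trans path_homotopic_sym by blast
  then show "loop_class X x0 p = loop_class X x0 q"
    using assms by (auto simp: mem_loop_class_iff)
qed

lemma loop_concat_loops: "p \<in> loops X x0 \<Longrightarrow> q \<in> loops X x0 \<Longrightarrow> loop_concat p q \<in> loops X x0"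
  by (auto simp: loops_def pathin_concat)

lemma reverse_path_loops: "p \<in> loops X x0 \<Longrightarrow> reverse_path p \<in> loops X x0"
  by (auto simp: loops_def pathin_reverse)

lemma carrier_fundamental_group: "carrier (fundamental_group X x0) = loop_class X x0 ` loops X x0"
  and one_fundamental_group: "\<one>\<^bsub>fundamental_group X x0\<^esub> = loop_class X x0 (\<lambda>_. x0)"
  by (simp_all add: fundamental_group_def)

lemma loop_class_in_carrier:
  "p \<in> loops X x0 \<Longrightarrow> loop_class X x0 p \<in> carrier (fundamental_group X x0)"
  unfolding carrier_fundamental_group by (rule imageI)

lemma mult_fundamental_group:
  assumes "p \<in> loops X x0" "q \<in> loops X x0"
  shows "loop_class X x0 p \<otimes>\<^bsub>fundamental_group X x0\<^esub> loop_class X x0 q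
           = loop_class X x0 (loop_concat p q)"
proof -
  have *: "loop_class X x0 (loop_concat p' q') = loop_class X x0 (loop_concat p q)"
    if p': "p' \<in> loop_class X x0 p" and q': "q' \<in> loop_class X x0 q" for p' q'
  proof (subst loop_class_eq_iff)
    have "p' \<in> loops X x0" "q' \<in> loops X x0" using p' q' by (auto simp: loop_class_def)
    then show "loop_concat p' q' \<in> loops X x0" by (rule loop_concat_loops)
    show "loop_concat p q \<in> loops X x0" using assms by (rule loop_concat_loops)
    show "path_homotopic X (loop_concat p' q') (loop_concat p q)"
      using p' q' assms by (intro path_homotopic_sym[OF path_homotopic_concat])
        (auto simp: mem_loop_class_iff loops_def)
  qed
  have "p \<in> loop_class X x0 p" "q \<in> loop_class X x0 q"
    using assms by (auto simp: mem_loop_class_iff path_homotopic_refl loops_def)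
  then have ne: "loop_class X x0 p \<noteq> {}" "loop_class X x0 q \<noteq> {}" by auto
  have "(\<Union>p'\<in>loop_class X x0 p. \<Union>q'\<in>loop_class X x0 q. loop_class X x0 (loop_concat p' q'))
      = (\<Union>p'\<in>loop_class X x0 p. \<Union>q'\<in>loop_class X x0 q. loop_class X x0 (loop_concat p q))"
    by (intro SUP_cong refl *)
  also have "\<dots> = loop_class X x0 (loop_concat p q)" using ne by simp
  finally show ?thesis by (simp add: fundamental_group_def)
qed

lemma loops_const: "x0 \<in> topspace X \<Longrightarrow> (\<lambda>_. x0) \<in> loops X x0"
  by (simp add: loops_def)

lemma loop_class_const_left:
  assumes "x0 \<in> topspace X" "p \<in> loops X x0"
  shows "loop_class X x0 (loop_concat (\<lambda>_. x0) p) = loop_class X x0 p"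
proof (subst loop_class_eq_iff)
  show "path_homotopic X (loop_concat (\<lambda>_. x0) p) p"
    using path_homotopic_const_left[of X p] assms(2) by (auto simp: loops_def)
qed (use assms in \<open>simp_all add: loops_const loop_concat_loops\<close>)

lemma loop_class_reverse_left:
  assumes "x0 \<in> topspace X" "p \<in> loops X x0"
  shows "loop_class X x0 (loop_concat (reverse_path p) p) = loop_class X x0 (\<lambda>_. x0)"
proof (subst loop_class_eq_iff)
  show "path_homotopic X (loop_concat (reverse_path p) p) (\<lambda>_. x0)"
    using path_homotopic_reverse_left[of X p] assms(2) by (auto simp: loops_def)
qed (use assms in \<open>simp_all add: loops_const loop_concat_loops reverse_path_loops\<close>)

lemma loop_class_assoc:
  assumes "p \<in> loops X x0" "q \<in> loops X x0" "r \<in> loops X x0"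
  shows "loop_class X x0 (loop_concat (loop_concat p q) r) = loop_class X x0 (loop_concat p (loop_concat q r))"
proof (subst loop_class_eq_iff)
  show "path_homotopic X (loop_concat (loop_concat p q) r) (loop_concat p (loop_concat q r))"
    using path_homotopic_assoc[of X p q r] assms by (auto simp: loops_def)
qed (use assms in \<open>simp_all add: loop_concat_loops\<close>)

lemma group_fundamental_group:
  assumes x0: "x0 \<in> topspace X"
  shows "group (fundamental_group X x0)"
proof (rule groupI)
  show "\<one>\<^bsub>fundamental_group X x0\<^esub> \<in> carrier (fundamental_group X x0)"
    unfolding one_fundamental_group by (rule loop_class_in_carrier[OF loops_const[OF x0]])
  fix x assume "x \<in> carrier (fundamental_group X x0)"
  then obtain p where p: "p \<in> loops X x0" "x = loop_class X x0 p" by (auto simp: carrier_fundamental_group)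
  show "\<one>\<^bsub>fundamental_group X x0\<^esub> \<otimes>\<^bsub>fundamental_group X x0\<^esub> x = x"
    using p loops_const[OF x0] x0
    by (simp add: one_fundamental_group mult_fundamental_group loop_class_const_left)
  have "loop_class X x0 (reverse_path p) \<otimes>\<^bsub>fundamental_group X x0\<^esub> x = \<one>\<^bsub>fundamental_group X x0\<^esub>"
    using p x0 by (simp add: one_fundamental_group mult_fundamental_group loop_class_reverse_left
        reverse_path_loops)
  then show "\<exists>y\<in>carrier (fundamental_group X x0).
      y \<otimes>\<^bsub>fundamental_group X x0\<^esub> x = \<one>\<^bsub>fundamental_group X x0\<^esub>"
    using loop_class_in_carrier[OF reverse_path_loops[OF p(1)]] by blast
  fix y assume "y \<in> carrier (fundamental_group X x0)"
  then obtain q where q: "q \<in> loops X x0" "y = loop_class X x0 q" by (auto simp: carrier_fundamental_group)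
  show "x \<otimes>\<^bsub>fundamental_group X x0\<^esub> y \<in> carrier (fundamental_group X x0)"
    using p q by (simp add: mult_fundamental_group loop_class_in_carrier loop_concat_loops)
  fix z assume "z \<in> carrier (fundamental_group X x0)"
  then obtain r where r: "r \<in> loops X x0" "z = loop_class X x0 r" by (auto simp: carrier_fundamental_group)
  show "x \<otimes>\<^bsub>fundamental_group X x0\<^esub> y \<otimes>\<^bsub>fundamental_group X x0\<^esub> z
     = x \<otimes>\<^bsub>fundamental_group X x0\<^esub> (y \<otimes>\<^bsub>fundamental_group X x0\<^esub> z)"
    using p q r by (simp add: mult_fundamental_group loop_concat_loops loop_class_assoc)
qed

lemma inv_fundamental_group:
  assumes x0: "x0 \<in> topspace X" and p: "p \<in> loops X x0"
  shows "inv\<^bsub>fundamental_group X x0\<^esub> loop_class X x0 p = loop_class X x0 (reverse_path p)"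
proof (rule group.inv_equality[OF group_fundamental_group[OF x0]])
  show "loop_class X x0 (reverse_path p) \<otimes>\<^bsub>fundamental_group X x0\<^esub> loop_class X x0 p
     = \<one>\<^bsub>fundamental_group X x0\<^esub>"
    using p x0 by (simp add: one_fundamental_group mult_fundamental_group loop_class_reverse_left
        reverse_path_loops)
qed (use p reverse_path_loops[OF p] in \<open>simp_all add: loop_class_in_carrier\<close>)

text \<open>Conjugation by a path \<open>s\<close>, which moves loops at its end to loops at its start.\<close>

definition move_base :: "(real \<Rightarrow> 'a) \<Rightarrow> (real \<Rightarrow> 'a) \<Rightarrow> real \<Rightarrow> 'a" where
  "move_base s p = loop_concat s (loop_concat p (reverse_path s))"

lemma move_base_loops:
  "pathin X s \<Longrightarrow> p \<in> loops X (s 1) \<Longrightarrow> move_base s p \<in> loops X (s 0)"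
  by (auto simp: move_base_def loops_def pathin_concat pathin_reverse)

lemma move_base_homotopic:
  assumes "pathin X s" "p 0 = s 1" "p 1 = s 1" "path_homotopic X p q"
  shows "path_homotopic X (move_base s p) (move_base s q)"
  unfolding move_base_def using assms
  by (intro path_homotopic_concat path_homotopic_refl pathin_reverse) auto

lemma move_base_concat:
  assumes s: "pathin X s" and p: "p \<in> loops X (s 1)" and q: "q \<in> loops X (s 1)"
  shows "path_homotopic X (loop_concat (move_base s p) (move_base s q)) (move_base s (loop_concat p q))"
proof -
  note [simp] = pathin_concat pathin_reverse path_homotopic_refl
  have p': "pathin X p" "p 0 = s 1" "p 1 = s 1" and q': "pathin X q" "q 0 = s 1" "q 1 = s 1"
    using p q by (auto simp: loops_def)
  let ?r = "reverse_path s" and ?m = "loop_concat"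
  let ?y = "?m q ?r"
  have "path_homotopic X (?m (?m s (?m p ?r)) (?m s ?y)) (?m s (?m (?m p ?r) (?m s ?y)))"
    by (rule path_homotopic_assoc) (use s p' q' in simp_all)
  also have "path_homotopic X \<dots> (?m s (?m p (?m ?r (?m s ?y))))"
    by (intro path_homotopic_concat path_homotopic_refl path_homotopic_assoc) (use s p' q' in simp_all)
  also have "path_homotopic X \<dots> (?m s (?m p (?m (?m ?r s) ?y)))"
    by (intro path_homotopic_concat path_homotopic_refl path_homotopic_sym[OF path_homotopic_assoc])
      (use s p' q' in simp_all)
  also have "path_homotopic X \<dots> (?m s (?m p (?m (\<lambda>_. s 1) ?y)))"
    by (intro path_homotopic_concat path_homotopic_refl path_homotopic_reverse_left) (use s p' q' in simp_all)
  also have "path_homotopic X \<dots> (?m s (?m p ?y))"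
  proof -
    have "path_homotopic X (?m (\<lambda>_. s 1) ?y) ?y"
      using path_homotopic_const_left[of X ?y] s q' by simp
    from path_homotopic_concat[OF path_homotopic_refl path_homotopic_concat[OF path_homotopic_refl this]]
    show ?thesis using s p' q' by simp
  qed
  also have "path_homotopic X \<dots> (?m s (?m (?m p q) ?r))"
    by (intro path_homotopic_concat path_homotopic_refl path_homotopic_sym[OF path_homotopic_assoc])
      (use s p' q' in simp_all)
  finally show ?thesis by (simp add: move_base_def)
qed

lemma move_base_hom:
  assumes s: "pathin X s"
  obtains \<theta> where "\<theta> \<in> hom (fundamental_group X (s 1)) (fundamental_group X (s 0))"
    "\<And>p. p \<in> loops X (s 1) \<Longrightarrow> \<theta> (loop_class X (s 1) p) = loop_class X (s 0) (move_base s p)"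
proof -
  define \<theta> where "\<theta> C = loop_class X (s 0) (move_base s (SOME p. p \<in> C))" for C
  have \<theta>: "\<theta> (loop_class X (s 1) p) = loop_class X (s 0) (move_base s p)" if p: "p \<in> loops X (s 1)" for p
  proof -
    have "p \<in> loop_class X (s 1) p" using p by (simp add: mem_loop_class_iff path_homotopic_refl loops_def)
    moreover define q where "q = (SOME q. q \<in> loop_class X (s 1) p)"
    ultimately have "q \<in> loop_class X (s 1) p"
      using someI[of "\<lambda>q. q \<in> loop_class X (s 1) p" p] by (simp only:)
    then have *: "path_homotopic X p q" "q \<in> loops X (s 1)"
      using p by (simp add: mem_loop_class_iff, simp add: loop_class_def)
    have "path_homotopic X (move_base s q) (move_base s p)"
      using path_homotopic_sym[OF move_base_homotopic[OF s _ _ *(1)]] p by (simp add: loops_def)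
    then show ?thesis unfolding \<theta>_def q_def[symmetric]
      using * s p by (simp add: loop_class_eq_iff move_base_loops)
  qed
  have "\<theta> \<in> hom (fundamental_group X (s 1)) (fundamental_group X (s 0))"
    by (auto simp: hom_def carrier_fundamental_group \<theta> move_base_loops s mult_fundamental_group
        loop_concat_loops loop_class_eq_iff intro!: path_homotopic_sym[OF move_base_concat])
  then show ?thesis using \<theta> that by blast
qed

section \<open>Holonomy of flat bundles\<close>

text \<open>A principal bundle with discrete fibre \<open>H\<close>, trivialised pointwise and without regard to continuity.  A chart
\<open>(U, \<sigma>)\<close> is a locally constant section over \<open>U\<close>, written in that trivialisation, so that \<open>\<sigma>\<close> itself may jump; only the
quotient of two charts has to be locally constant.\<close>

definition flat_atlas ::
  "('e, 'm) monoid_scheme \<Rightarrow> 'a topology \<Rightarrow> ('a set \<times> ('a \<Rightarrow> 'e)) set \<Rightarrow> bool" where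
  "flat_atlas H X S \<longleftrightarrow>
     (\<forall>U \<sigma>. (U, \<sigma>) \<in> S \<longrightarrow> openin X U \<and> \<sigma> \<in> U \<rightarrow> carrier H) \<and>
     (\<forall>x\<in>topspace X. \<exists>U \<sigma>. (U, \<sigma>) \<in> S \<and> x \<in> U) \<and>
     (\<forall>U \<sigma> U' \<sigma>' x. (U, \<sigma>) \<in> S \<and> (U', \<sigma>') \<in> S \<and> x \<in> U \<inter> U' \<longrightarrow>
        (\<exists>V g. openin X V \<and> x \<in> V \<and> V \<subseteq> U \<inter> U' \<and> g \<in> carrier H \<and>
          (\<forall>y\<in>V. \<sigma>' y = g \<otimes>\<^bsub>H\<^esub> \<sigma> y)))"

text \<open>A section of the bundle pulled back along \<open>h\<close>.\<close>

definition flat_section ::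
  "('e, 'm) monoid_scheme \<Rightarrow> ('a set \<times> ('a \<Rightarrow> 'e)) set \<Rightarrow> 'z::topological_space set \<Rightarrow> ('z \<Rightarrow> 'a)
     \<Rightarrow> ('z \<Rightarrow> 'e) \<Rightarrow> bool" where
  "flat_section H S Z h f \<longleftrightarrow>
     (\<forall>z\<in>Z. \<exists>U \<sigma> g W. (U, \<sigma>) \<in> S \<and> g \<in> carrier H \<and> openin (top_of_set Z) W \<and> z \<in> W \<and>
        (\<forall>w\<in>W. h w \<in> U \<and> f w = g \<otimes>\<^bsub>H\<^esub> \<sigma> (h w)))"

lemma flat_sectionE:
  assumes "flat_section H S Z h f" "z \<in> Z"
  obtains U \<sigma> g W where "(U, \<sigma>) \<in> S" "g \<in> carrier H" "openin (top_of_set Z) W" "z \<in> W"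
    "\<And>w. w \<in> W \<Longrightarrow> h w \<in> U" "\<And>w. w \<in> W \<Longrightarrow> f w = g \<otimes>\<^bsub>H\<^esub> \<sigma> (h w)"
proof -
  from assms obtain U \<sigma> g W where "(U, \<sigma>) \<in> S \<and> g \<in> carrier H \<and> openin (top_of_set Z) W \<and> z \<in> W \<and>
        (\<forall>w\<in>W. h w \<in> U \<and> f w = g \<otimes>\<^bsub>H\<^esub> \<sigma> (h w))"
    unfolding flat_section_def by meson
  then show ?thesis using that[of U \<sigma> g W] by simp
qed

lemma flat_sectionI:
  assumes "\<And>z. z \<in> Z \<Longrightarrow> \<exists>U \<sigma> g W. (U, \<sigma>) \<in> S \<and> g \<in> carrier H \<and> openin (top_of_set Z) W \<and> z \<in> W \<and>
     (\<forall>w\<in>W. h w \<in> U \<and> f w = g \<otimes>\<^bsub>H\<^esub> \<sigma> (h w))"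
  shows "flat_section H S Z h f"
  using assms unfolding flat_section_def by (intro ballI)

lemma flat_section_compose:
  assumes f: "flat_section H S Z h f" and c: "continuous_on Y c" "c \<in> Y \<rightarrow> Z"
  shows "flat_section H S Y (\<lambda>y. h (c y)) (\<lambda>y. f (c y))"
proof (rule flat_sectionI)
  fix y assume y: "y \<in> Y"
  then have "c y \<in> Z" using c by auto
  from flat_sectionE[OF f this] obtain U \<sigma> g W where W: "(U, \<sigma>) \<in> S" "g \<in> carrier H"
    "openin (top_of_set Z) W" "c y \<in> W"
    "\<And>w. w \<in> W \<Longrightarrow> h w \<in> U" "\<And>w. w \<in> W \<Longrightarrow> f w = g \<otimes>\<^bsub>H\<^esub> \<sigma> (h w)" by metis
  have "openin (top_of_set Y) (Y \<inter> c -` W)"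
    using continuous_openin_preimage[OF c W(3)] .
  then show "\<exists>U \<sigma> g W. (U, \<sigma>) \<in> S \<and> g \<in> carrier H \<and> openin (top_of_set Y) W \<and> y \<in> W \<and>
     (\<forall>w\<in>W. h (c w) \<in> U \<and> f (c w) = g \<otimes>\<^bsub>H\<^esub> \<sigma> (h (c w)))"
    using W y by (intro exI[of _ U] exI[of _ \<sigma>] exI[of _ g] exI[of _ "Y \<inter> c -` W"]) auto
qed

lemma flat_section_subset:
  "flat_section H S Z h f \<Longrightarrow> Y \<subseteq> Z \<Longrightarrow> flat_section H S Y h f"
  using flat_section_compose[of H S Z h f Y "\<lambda>y. y"] by (auto simp: continuous_on_id)

lemma flat_section_cong:
  assumes "flat_section H S Z h f" "\<And>z. z \<in> Z \<Longrightarrow> h' z = h z" "\<And>z. z \<in> Z \<Longrightarrow> f' z = f z"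
  shows "flat_section H S Z h' f'"
proof (rule flat_sectionI)
  fix z assume "z \<in> Z"
  from flat_sectionE[OF assms(1) this] obtain U \<sigma> g W where W: "(U, \<sigma>) \<in> S" "g \<in> carrier H"
    "openin (top_of_set Z) W" "z \<in> W"
    "\<And>w. w \<in> W \<Longrightarrow> h w \<in> U" "\<And>w. w \<in> W \<Longrightarrow> f w = g \<otimes>\<^bsub>H\<^esub> \<sigma> (h w)" by metis
  moreover have "W \<subseteq> Z" using W(3) by (rule openin_imp_subset)
  ultimately show "\<exists>U \<sigma> g W. (U, \<sigma>) \<in> S \<and> g \<in> carrier H \<and> openin (top_of_set Z) W \<and> z \<in> W \<and>
     (\<forall>w\<in>W. h' w \<in> U \<and> f' w = g \<otimes>\<^bsub>H\<^esub> \<sigma> (h' w))"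
    using assms(2,3) by (intro exI[of _ U] exI[of _ \<sigma>] exI[of _ g] exI[of _ W]) (auto simp: subset_iff)
qed

locale flat_structure = H: group H for H :: "('e, 'm) monoid_scheme" (structure) +
  fixes X :: "'a topology" and S :: "('a set \<times> ('a \<Rightarrow> 'e)) set"
  assumes atlas: "flat_atlas H X S"
begin

lemma atlas_chart: "(U, \<sigma>) \<in> S \<Longrightarrow> openin X U" "(U, \<sigma>) \<in> S \<Longrightarrow> x \<in> U \<Longrightarrow> \<sigma> x \<in> carrier H"
  using atlas unfolding flat_atlas_def by (blast, blast)

lemma atlas_cover:
  assumes "x \<in> topspace X" obtains U \<sigma> where "(U, \<sigma>) \<in> S" "x \<in> U"
  using atlas assms unfolding flat_atlas_def by meson

lemma atlas_transition:
  assumes "(U, \<sigma>) \<in> S" "(U', \<sigma>') \<in> S" "x \<in> U" "x \<in> U'"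
  obtains V g where "openin X V" "x \<in> V" "V \<subseteq> U \<inter> U'" "g \<in> carrier H"
    "\<And>y. y \<in> V \<Longrightarrow> \<sigma>' y = g \<otimes> \<sigma> y"
proof -
  have "(U, \<sigma>) \<in> S \<and> (U', \<sigma>') \<in> S \<and> x \<in> U \<inter> U'" using assms by simp
  then obtain V g where "openin X V \<and> x \<in> V \<and> V \<subseteq> U \<inter> U' \<and> g \<in> carrier H \<and> (\<forall>y\<in>V. \<sigma>' y = g \<otimes> \<sigma> y)"
    using atlas unfolding flat_atlas_def by meson
  then show ?thesis using that[of V g] by simp
qed

lemma flat_section_closed:
  assumes "flat_section H S Z h f" "z \<in> Z" shows "f z \<in> carrier H"
  using flat_sectionE[OF assms] atlas_chart(2) by (metis H.m_closed)

text \<open>Near a common point two sections are expressed in one chart by constants; this reduces statements about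
sections to comparing constants.\<close>

lemma flat_sections_compare:
  assumes h: "continuous_map (top_of_set Z) X h"
    and f: "flat_section H S Z1 h f" and f': "flat_section H S Z2 h f'"
    and Z: "Z1 \<subseteq> Z" "Z2 \<subseteq> Z" and z: "z \<in> Z1" "z \<in> Z2"
  obtains U \<sigma> g g' T where "(U, \<sigma>) \<in> S" "g \<in> carrier H" "g' \<in> carrier H"
    "openin (top_of_set Z) T" "z \<in> T" "\<And>w. w \<in> T \<Longrightarrow> h w \<in> U"
    "\<And>w. w \<in> T \<inter> Z1 \<Longrightarrow> f w = g \<otimes> \<sigma> (h w)" "\<And>w. w \<in> T \<inter> Z2 \<Longrightarrow> f' w = g' \<otimes> \<sigma> (h w)"
proof -
  obtain U \<sigma> g W where W: "(U, \<sigma>) \<in> S" "g \<in> carrier H" "openin (top_of_set Z1) W" "z \<in> W"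
    "\<And>w. w \<in> W \<Longrightarrow> h w \<in> U" "\<And>w. w \<in> W \<Longrightarrow> f w = g \<otimes> \<sigma> (h w)"
    by (rule flat_sectionE[OF f z(1)]) blast
  obtain U' \<sigma>' g' W' where W': "(U', \<sigma>') \<in> S" "g' \<in> carrier H" "openin (top_of_set Z2) W'" "z \<in> W'"
    "\<And>w. w \<in> W' \<Longrightarrow> h w \<in> U'" "\<And>w. w \<in> W' \<Longrightarrow> f' w = g' \<otimes> \<sigma>' (h w)"
    by (rule flat_sectionE[OF f' z(2)]) blast
  obtain V k where V: "openin X V" "h z \<in> V" "V \<subseteq> U \<inter> U'" "k \<in> carrier H"
    "\<And>y. y \<in> V \<Longrightarrow> \<sigma>' y = k \<otimes> \<sigma> y"
    by (rule atlas_transition[OF W(1) W'(1) W(5)[OF W(4)] W'(5)[OF W'(4)]]) blast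
  obtain O1 where O1: "open O1" "W = Z1 \<inter> O1" using W(3) by (auto simp: openin_open)
  obtain O2 where O2: "open O2" "W' = Z2 \<inter> O2" using W'(3) by (auto simp: openin_open)
  let ?T = "{w \<in> Z. h w \<in> V} \<inter> (O1 \<inter> O2)"
  have "openin (top_of_set Z) {w \<in> Z. h w \<in> V}"
    using openin_continuous_map_preimage[OF h V(1)] by simp
  then have T: "openin (top_of_set Z) ?T"
    using O1(1) O2(1) by (simp add: openin_Int_open open_Int)
  show ?thesis
  proof (rule that[OF W(1,2) _ T])
    show "g' \<otimes> k \<in> carrier H" using W'(2) V(4) by simp
    show "z \<in> ?T" using z Z W(4) W'(4) O1 O2 V(2) by auto
    show "h w \<in> U" if "w \<in> ?T" for w using that V(3) by auto
    show "f w = g \<otimes> \<sigma> (h w)" if "w \<in> ?T \<inter> Z1" for w using that O1(2) W(6) by auto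
    show "f' w = g' \<otimes> k \<otimes> \<sigma> (h w)" if w: "w \<in> ?T \<inter> Z2" for w
    proof -
      have "h w \<in> V" "w \<in> W'" using w O2(2) by auto
      then show ?thesis using W'(2,6) V(3-5) atlas_chart(2)[OF W(1)] by (auto simp: H.m_assoc)
    qed
  qed
qed

lemma flat_section_unique:
  assumes "connected Z" and h: "continuous_map (top_of_set Z) X h"
    and f: "flat_section H S Z h f" and f': "flat_section H S Z h f'"
  obtains g where "g \<in> carrier H" "\<And>z. z \<in> Z \<Longrightarrow> f' z = g \<otimes> f z"
proof (cases "Z = {}")
  case False
  then obtain z0 where z0: "z0 \<in> Z" by blast
  let ?d = "\<lambda>z. f' z \<otimes> inv f z"
  have "?d constant_on Z"
  proof (rule locally_constant_imp_constant[OF \<open>connected Z\<close>])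
    fix z assume z: "z \<in> Z"
    obtain U \<sigma> g g' T where T: "(U, \<sigma>) \<in> S" "g \<in> carrier H" "g' \<in> carrier H"
      "openin (top_of_set Z) T" "z \<in> T" "\<And>w. w \<in> T \<Longrightarrow> h w \<in> U"
      "\<And>w. w \<in> T \<inter> Z \<Longrightarrow> f w = g \<otimes> \<sigma> (h w)" "\<And>w. w \<in> T \<inter> Z \<Longrightarrow> f' w = g' \<otimes> \<sigma> (h w)"
      by (rule flat_sections_compare[OF h f f' order_refl order_refl z z]) blast
    have "?d w = g' \<otimes> inv g" if "w \<in> T" for w
    proof -
      have "w \<in> T \<inter> Z" using that openin_imp_subset[OF T(4)] by auto
      then show ?thesis
        using T atlas_chart(2)[OF T(1) T(6)[OF that]]
        by (simp add: H.inv_mult_group H.m_assoc H.inv_cancel)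
    qed
    then show "\<exists>T. openin (top_of_set Z) T \<and> z \<in> T \<and> (\<forall>x\<in>T. ?d x = ?d z)"
      using T(4,5) by auto
  qed
  then obtain c where c: "\<And>z. z \<in> Z \<Longrightarrow> ?d z = c" by (auto simp: constant_on_def)
  note cl = flat_section_closed[OF f] flat_section_closed[OF f']
  show ?thesis
  proof (rule that)
    show "c \<in> carrier H" using c[OF z0] cl z0 by auto
    show "f' z = c \<otimes> f z" if "z \<in> Z" for z
      using cl that by (simp add: H.m_assoc flip: c[OF that])
  qed
qed (use that[of \<one>] in auto)

lemma flat_section_mult:
  assumes "flat_section H S Z h f" "g \<in> carrier H"
  shows "flat_section H S Z h (\<lambda>z. g \<otimes> f z)"
proof (rule flat_sectionI)
  fix z assume "z \<in> Z"
  from flat_sectionE[OF assms(1) this] obtain U \<sigma> k W where W: "(U, \<sigma>) \<in> S" "k \<in> carrier H"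
    "openin (top_of_set Z) W" "z \<in> W"
    "\<And>w. w \<in> W \<Longrightarrow> h w \<in> U" "\<And>w. w \<in> W \<Longrightarrow> f w = k \<otimes> \<sigma> (h w)" by metis
  then show "\<exists>U \<sigma> k W. (U, \<sigma>) \<in> S \<and> k \<in> carrier H \<and> openin (top_of_set Z) W \<and> z \<in> W \<and>
     (\<forall>w\<in>W. h w \<in> U \<and> g \<otimes> f w = k \<otimes> \<sigma> (h w))"
    using assms(2) atlas_chart(2)[OF W(1)]
    by (intro exI[of _ U] exI[of _ \<sigma>] exI[of _ "g \<otimes> k"] exI[of _ W]) (auto simp: H.m_assoc)
qed

text \<open>On the connected intersection the two sections differ by a constant, which can be removed.\<close>

lemma flat_section_glue:
  fixes Z1 Z2 :: "'z::topological_space set"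
  assumes closed: "closed Z1" "closed Z2" and conn: "connected (Z1 \<inter> Z2)"
    and h: "continuous_map (top_of_set (Z1 \<union> Z2)) X h"
    and f1: "flat_section H S Z1 h f1" and f2: "flat_section H S Z2 h f2"
  obtains f where "flat_section H S (Z1 \<union> Z2) h f"
proof -
  have "flat_section H S (Z1 \<inter> Z2) h f1" "flat_section H S (Z1 \<inter> Z2) h f2"
    using f1 f2 by (auto elim: flat_section_subset)
  moreover have "continuous_map (top_of_set (Z1 \<inter> Z2)) X h"
    using h by (rule continuous_map_from_subtopology_mono) auto
  ultimately obtain k where k: "k \<in> carrier H" "\<And>z. z \<in> Z1 \<inter> Z2 \<Longrightarrow> f1 z = k \<otimes> f2 z"
    using flat_section_unique[OF conn] by metis
  define f where "f z = (if z \<in> Z1 then f1 z else k \<otimes> f2 z)" for z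
  have g1: "flat_section H S Z1 h f" using f1 by (rule flat_section_cong) (auto simp: f_def)
  have g2: "flat_section H S Z2 h f"
    using flat_section_mult[OF f2 k(1)] by (rule flat_section_cong) (auto simp: f_def k)
  \<comment> \<open>at a point of only one of the closed sets, a neighbourhood avoids the other\<close>
  have one_side: "\<exists>U \<sigma> g W. (U, \<sigma>) \<in> S \<and> g \<in> carrier H \<and> openin (top_of_set (A \<union> B)) W \<and> z \<in> W \<and>
     (\<forall>w\<in>W. h w \<in> U \<and> f w = g \<otimes> \<sigma> (h w))"
    if A: "flat_section H S A h f" and B: "closed B" and z: "z \<in> A" "z \<notin> B" for A B z
  proof -
    obtain U \<sigma> g W where W: "(U, \<sigma>) \<in> S" "g \<in> carrier H" "openin (top_of_set A) W" "z \<in> W"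
      "\<And>w. w \<in> W \<Longrightarrow> h w \<in> U" "\<And>w. w \<in> W \<Longrightarrow> f w = g \<otimes> \<sigma> (h w)"
      by (rule flat_sectionE[OF A z(1)]) blast
    obtain O1 where O1: "open O1" "W = A \<inter> O1" using W(3) by (auto simp: openin_open)
    have "openin (top_of_set (A \<union> B)) ((A \<union> B) \<inter> (O1 - B))"
      using O1(1) B by (intro openin_open_Int open_Diff)
    moreover have "(A \<union> B) \<inter> (O1 - B) \<subseteq> W" using O1(2) by auto
    ultimately show ?thesis using W O1 z
      by (intro exI[of _ U] exI[of _ \<sigma>] exI[of _ g] exI[of _ "(A \<union> B) \<inter> (O1 - B)"]) auto
  qed
  have "flat_section H S (Z1 \<union> Z2) h f"
  proof (rule flat_sectionI)
    fix z assume "z \<in> Z1 \<union> Z2"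
    then consider "z \<in> Z1" "z \<notin> Z2" | "z \<in> Z2" "z \<notin> Z1" | "z \<in> Z1" "z \<in> Z2" by blast
    then show "\<exists>U \<sigma> g W. (U, \<sigma>) \<in> S \<and> g \<in> carrier H \<and> openin (top_of_set (Z1 \<union> Z2)) W \<and> z \<in> W \<and>
     (\<forall>w\<in>W. h w \<in> U \<and> f w = g \<otimes> \<sigma> (h w))"
    proof cases
      case 1
      then show ?thesis using one_side[OF g1 closed(2)] by blast
    next
      case 2
      then show ?thesis using one_side[OF g2 closed(1)] by (simp add: Un_commute)
    next
      case 3
      obtain U \<sigma> g g' T where T: "(U, \<sigma>) \<in> S" "g \<in> carrier H" "g' \<in> carrier H"
        "openin (top_of_set (Z1 \<union> Z2)) T" "z \<in> T" "\<And>w. w \<in> T \<Longrightarrow> h w \<in> U"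
        "\<And>w. w \<in> T \<inter> Z1 \<Longrightarrow> f w = g \<otimes> \<sigma> (h w)" "\<And>w. w \<in> T \<inter> Z2 \<Longrightarrow> f w = g' \<otimes> \<sigma> (h w)"
        by (rule flat_sections_compare[OF h g1 g2 _ _ 3]) blast+
      have "g \<otimes> \<sigma> (h z) = g' \<otimes> \<sigma> (h z)" using T(7,8)[of z] T(5) 3 by simp
      then have "g = g'" using T(2,3) atlas_chart(2)[OF T(1) T(6)[OF T(5)]] by simp
      then have "f w = g \<otimes> \<sigma> (h w)" if "w \<in> T" for w
        using T(7,8) that openin_imp_subset[OF T(4)] by blast
      then show ?thesis using T by (intro exI[of _ U] exI[of _ \<sigma>] exI[of _ g] exI[of _ T]) auto
    qed
  qed
  then show ?thesis by (rule that)
qed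

lemma flat_section_local:
  assumes h: "continuous_map (top_of_set Z) X h" and z: "z \<in> Z"
  obtains T f where "openin (top_of_set Z) T" "z \<in> T" "flat_section H S T h f"
proof -
  have "h z \<in> topspace X" using h z by (auto simp: continuous_map_def)
  then obtain U \<sigma> where U: "(U, \<sigma>) \<in> S" "h z \<in> U" by (rule atlas_cover)
  let ?T = "{w \<in> Z. h w \<in> U}"
  have "openin (top_of_set Z) ?T"
    using openin_continuous_map_preimage[OF h atlas_chart(1)[OF U(1)]] by simp
  moreover have "flat_section H S ?T h (\<lambda>w. \<sigma> (h w))"
    using U atlas_chart(2)[OF U(1)]
    by (intro flat_sectionI exI[of _ U] exI[of _ \<sigma>] exI[of _ \<one>] exI[of _ ?T]) auto
  ultimately show ?thesis using that U z by blast
qed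

lemma flat_section_strip:
  fixes h :: "real \<times> real \<Rightarrow> 'a"
  assumes h: "continuous_map (top_of_set ({0..1} \<times> {0..1})) X h" and s0: "s0 \<in> {0..1}"
  shows "\<exists>\<delta>>0. \<exists>f. flat_section H S (({s0 - \<delta>..s0 + \<delta>} \<inter> {0..1}) \<times> {0..1}) h f"
proof -
  let ?I = "\<lambda>\<delta>. {s0 - \<delta>..s0 + \<delta>} \<inter> {0..1}"
  define P where "P c d \<longleftrightarrow> (\<exists>\<delta>>0. \<exists>f. flat_section H S (?I \<delta> \<times> ({c..d} \<inter> {0..1})) h f)" for c d
  from zero_le_one have "P 0 1"
  proof (induction rule: Bolzano[where P = P])
    case (trans a b c)
    then obtain d1 f1 d2 f2 where d: "d1 > 0" "d2 > 0"
      "flat_section H S (?I d1 \<times> ({a..b} \<inter> {0..1})) h f1"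
      "flat_section H S (?I d2 \<times> ({b..c} \<inter> {0..1})) h f2" unfolding P_def by metis
    define d where "d = min d1 d2"
    let ?Z1 = "?I d \<times> ({a..b} \<inter> {0..1})" and ?Z2 = "?I d \<times> ({b..c} \<inter> {0..1})"
    have "flat_section H S ?Z1 h f1" using d(3) by (rule flat_section_subset) (auto simp: d_def)
    moreover have "flat_section H S ?Z2 h f2" using d(4) by (rule flat_section_subset) (auto simp: d_def)
    moreover have "closed ?Z1" "closed ?Z2" by (intro closed_Times closed_Int closed_atLeastAtMost)+
    moreover have "?Z1 \<inter> ?Z2 = ?I d \<times> ({a..b} \<inter> {0..1} \<inter> ({b..c} \<inter> {0..1}))" by auto
    then have "connected (?Z1 \<inter> ?Z2)"
      by (simp only:) (intro convex_connected convex_Times convex_Int convex_real_interval)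
    moreover have "continuous_map (top_of_set (?Z1 \<union> ?Z2)) X h"
      using h by (rule continuous_map_from_subtopology_mono) auto
    ultimately obtain f where "flat_section H S (?Z1 \<union> ?Z2) h f" by (metis flat_section_glue)
    moreover have "?Z1 \<union> ?Z2 = ?I d \<times> ({a..c} \<inter> {0..1})" using trans by auto
    ultimately show ?case unfolding P_def using d(1,2) by (intro exI[of _ d]) (auto simp: d_def)
  next
    case (local x)
    then have "(s0, x) \<in> {0..1} \<times> {0..1}" using s0 by simp
    from flat_section_local[OF h this] obtain T f where T: "openin (top_of_set ({0..1} \<times> {0..1})) T"
      "(s0, x) \<in> T" "flat_section H S T h f" by blast
    then obtain e where e: "e > 0" "ball (s0, x) e \<inter> ({0..1} \<times> {0..1}) \<subseteq> T"
      by (auto simp: openin_contains_ball)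
    have "P a b" if ab: "a \<le> x" "x \<le> b" "b - a < e / 2" for a b
    proof -
      have "?I (e / 4) \<times> ({a..b} \<inter> {0..1}) \<subseteq> T"
      proof
        fix z assume z: "z \<in> ?I (e / 4) \<times> ({a..b} \<inter> {0..1})"
        have "dist (s0, x) z \<le> dist s0 (fst z) + dist x (snd z)"
          using sqrt_sum_squares_le_sum_abs[of "dist s0 (fst z)" "dist x (snd z)"]
          by (simp add: dist_prod_def)
        also have "\<dots> < e" using z ab e(1) by (auto simp: dist_real_def)
        finally show "z \<in> T" using e(2) z by auto
      qed
      then show ?thesis unfolding P_def using e(1) flat_section_subset[OF T(3)]
        by (intro exI[of _ "e / 4"]) auto
    qed
    then show ?case using e(1) by (intro exI[of _ "e / 2"]) auto
  qed
  then show ?thesis by (simp add: P_def)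
qed

text \<open>Sections over small rectangles are glued along edges: first along a vertical strip, by
\<open>flat_section_strip\<close>, and then across the strips.\<close>

lemma flat_section_square:
  fixes h :: "real \<times> real \<Rightarrow> 'a"
  assumes h: "continuous_map (top_of_set ({0..1} \<times> {0..1})) X h"
  obtains f where "flat_section H S ({0..1} \<times> {0..1}) h f"
proof -
  define P where "P a b \<longleftrightarrow> (\<exists>f. flat_section H S (({a..b} \<inter> {0..1}) \<times> {0..1}) h f)" for a b
  from zero_le_one have "P 0 1"
  proof (induction rule: Bolzano[where P = P])
    case (trans a b c)
    then obtain f1 f2 where f: "flat_section H S (({a..b} \<inter> {0..1}) \<times> {0..1}) h f1"
      "flat_section H S (({b..c} \<inter> {0..1}) \<times> {0..1}) h f2" unfolding P_def by metis
    let ?Z1 = "({a..b} \<inter> {0..1}) \<times> {0..1::real}" and ?Z2 = "({b..c} \<inter> {0..1}) \<times> {0..1::real}"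
    have "closed ?Z1" "closed ?Z2" by (intro closed_Times closed_Int closed_atLeastAtMost)+
    moreover have "?Z1 \<inter> ?Z2 = ({a..b} \<inter> {0..1} \<inter> ({b..c} \<inter> {0..1})) \<times> {0..1}" by auto
    then have "connected (?Z1 \<inter> ?Z2)"
      by (simp only:) (intro convex_connected convex_Times convex_Int convex_real_interval)
    moreover have "continuous_map (top_of_set (?Z1 \<union> ?Z2)) X h"
      using h by (rule continuous_map_from_subtopology_mono) auto
    ultimately obtain f where "flat_section H S (?Z1 \<union> ?Z2) h f" using f by (metis flat_section_glue)
    moreover have "?Z1 \<union> ?Z2 = ({a..c} \<inter> {0..1}) \<times> {0..1}" using trans by auto
    ultimately show ?case unfolding P_def by auto
  next
    case (local x)
    then obtain d f where d: "d > 0" "flat_section H S (({x - d..x + d} \<inter> {0..1}) \<times> {0..1}) h f"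
      using flat_section_strip[OF h, of x] by auto
    have "P a b" if "a \<le> x" "x \<le> b" "b - a < d" for a b
      unfolding P_def by (rule exI, rule flat_section_subset[OF d(2)]) (use that in auto)
    then show ?case using d(1) by blast
  qed
  then show ?thesis using that by (auto simp: P_def)
qed

lemma flat_section_path:
  assumes "pathin X p"
  obtains f where "flat_section H S {0..1} p f"
proof -
  have "continuous_map (top_of_set ({0..1} \<times> {0..1})) (top_of_set {0..1}) (snd :: real \<times> real \<Rightarrow> real)"
    by (auto simp: continuous_map_in_subtopology continuous_on_snd continuous_on_id)
  then have "continuous_map (top_of_set ({0..1} \<times> {0..1})) X (p \<circ> (snd :: real \<times> real \<Rightarrow> real))"
    using assms unfolding pathin_def by (rule continuous_map_compose)
  then obtain f :: "real \<times> real \<Rightarrow> 'e" where "flat_section H S ({0..1} \<times> {0..1}) (p \<circ> snd) f"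
    by (rule flat_section_square)
  then have "flat_section H S {0..1} (\<lambda>t. (p \<circ> snd) (0::real, t)) (\<lambda>t. f (0, t))"
    by (rule flat_section_compose) (auto intro!: continuous_intros)
  then show ?thesis using that by (simp add: o_def)
qed

text \<open>Parallel transport along \<open>p\<close>.  It does not depend on the section, since two sections differ by a
factor on the left (\<open>holonomy_eq\<close>).\<close>

definition holonomy :: "(real \<Rightarrow> 'a) \<Rightarrow> 'e" where
  "holonomy p = (let f = SOME f. flat_section H S {0..1} p f in inv (f 0) \<otimes> f 1)"

lemma holonomy_eq:
  assumes p: "pathin X p" and f: "flat_section H S {0..1} p f"
  shows "holonomy p = inv (f 0) \<otimes> f 1"
proof -
  define f' where "f' = (SOME f. flat_section H S {0..1} p f)"
  have f': "flat_section H S {0..1} p f'" unfolding f'_def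
    using someI[of "\<lambda>f. flat_section H S {0..1} p f" f] f by (simp only:)
  have "connected {0..1::real}" by simp
  from flat_section_unique[OF this p[unfolded pathin_def] f f'] obtain g
    where "g \<in> carrier H" "\<And>z. z \<in> {0..1} \<Longrightarrow> f' z = g \<otimes> f z" by blast
  moreover have "f 0 \<in> carrier H" "f 1 \<in> carrier H" using flat_section_closed[OF f] by auto
  ultimately have "inv (f' 0) \<otimes> f' 1 = inv (f 0) \<otimes> f 1"
    by (simp add: H.inv_mult_group H.m_assoc H.inv_cancel)
  then show ?thesis by (simp add: holonomy_def Let_def f'_def)
qed

lemma holonomy_closed: "pathin X p \<Longrightarrow> holonomy p \<in> carrier H"
  using flat_section_path holonomy_eq flat_section_closed
  by (metis H.inv_closed H.m_closed atLeastAtMost_iff order_refl zero_le_one)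

lemma flat_section_constant_path:
  assumes x: "x \<in> topspace X" and f: "flat_section H S {0..1::real} (\<lambda>_. x) f"
  shows "f 0 = f 1"
proof -
  have "f constant_on {0..1}"
  proof (rule locally_constant_imp_constant)
    fix t :: real assume "t \<in> {0..1}"
    from flat_sectionE[OF f this] obtain U \<sigma> g W where "openin (top_of_set {0..1}) W" "t \<in> W"
      "\<And>w. w \<in> W \<Longrightarrow> f w = g \<otimes> \<sigma> x" by metis
    then show "\<exists>T. openin (top_of_set {0..1}) T \<and> t \<in> T \<and> (\<forall>u\<in>T. f u = f t)" by auto
  qed simp
  then show ?thesis by (auto simp: constant_on_def)
qed

text \<open>A section over the square of the homotopy is constant on the two sides that are mapped to the end
points, so both paths read off the same two values from it.\<close>

lemma holonomy_homotopic:
  assumes pq: "path_homotopic X p q"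
  shows "holonomy p = holonomy q"
proof -
  note paths = path_homotopic_imp[OF pq]
  obtain h :: "real \<times> real \<Rightarrow> 'a" where h: "continuous_map (top_of_set ({0..1} \<times> {0..1})) X h"
    "\<forall>x. h (0, x) = p x" "\<forall>x. h (1, x) = q x"
    "\<forall>t\<in>{0..1}. h (t, 0) = p 0 \<and> h (t, 1) = p 1"
    using pq unfolding path_homotopic_def homotopic_with_def prod_topology_subtopology_eu by blast
  obtain f where f: "flat_section H S ({0..1} \<times> {0..1}) h f" by (rule flat_section_square[OF h(1)])
  have side: "flat_section H S {0..1} (\<lambda>t. h (c t)) (\<lambda>t. f (c t))"
    if "continuous_on {0..1} c" "c \<in> {0..1} \<rightarrow> {0..1} \<times> {0..1}" for c :: "real \<Rightarrow> real \<times> real"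
    using flat_section_compose[OF f that] .
  have "flat_section H S {0..1} p (\<lambda>t. f (0, t))"
    by (rule flat_section_cong[OF side[of "\<lambda>t. (0, t)"]]) (use h(2) in \<open>auto intro!: continuous_intros\<close>)
  moreover have "flat_section H S {0..1} q (\<lambda>t. f (1, t))"
    by (rule flat_section_cong[OF side[of "\<lambda>t. (1, t)"]]) (use h(3) in \<open>auto intro!: continuous_intros\<close>)
  moreover have "flat_section H S {0..1} (\<lambda>_. p 0) (\<lambda>t. f (t, 0))"
    by (rule flat_section_cong[OF side[of "\<lambda>t. (t, 0)"]]) (use h(4) in \<open>auto intro!: continuous_intros\<close>)
  then have "f (0, 0) = f (1, 0)"
    by (rule flat_section_constant_path[rotated]) (use path_start_in_topspace[OF paths(1)] in simp)
  moreover have "flat_section H S {0..1} (\<lambda>_. p 1) (\<lambda>t. f (t, 1))"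
    by (rule flat_section_cong[OF side[of "\<lambda>t. (t, 1)"]]) (use h(4) in \<open>auto intro!: continuous_intros\<close>)
  then have "f (0, 1) = f (1, 1)"
    by (rule flat_section_constant_path[rotated]) (use path_finish_in_topspace[OF paths(1)] in simp)
  ultimately show ?thesis using holonomy_eq paths(1,2) by simp
qed

lemma holonomy_concat:
  assumes p: "pathin X p" and q: "pathin X q" and pq: "p 1 = q 0"
  shows "holonomy (loop_concat p q) = holonomy p \<otimes> holonomy q"
proof -
  note c = pathin_concat[OF p q pq]
  obtain f where f: "flat_section H S {0..1} (loop_concat p q) f" by (rule flat_section_path[OF c])
  have "flat_section H S {0..1} (\<lambda>t. loop_concat p q (t / 2)) (\<lambda>t. f (t / 2))"
    using f by (rule flat_section_compose) (auto intro!: continuous_intros)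
  then have "flat_section H S {0..1} p (\<lambda>t. f (t / 2))"
    by (rule flat_section_cong) (auto simp: loop_concat_def)
  moreover have "flat_section H S {0..1} (\<lambda>t. loop_concat p q ((1 + t) / 2)) (\<lambda>t. f ((1 + t) / 2))"
    using f by (rule flat_section_compose) (auto intro!: continuous_intros)
  then have "flat_section H S {0..1} q (\<lambda>t. f ((1 + t) / 2))"
    by (rule flat_section_cong) (auto simp: loop_concat_def pq add_divide_distrib)
  moreover have "f 0 \<in> carrier H" "f (1/2) \<in> carrier H" "f 1 \<in> carrier H"
    using flat_section_closed[OF f] by auto
  ultimately show ?thesis
    using holonomy_eq[OF p] holonomy_eq[OF q] holonomy_eq[OF c f] by (simp add: H.m_assoc H.inv_cancel)
qed

lemma holonomy_const:
  assumes "x \<in> topspace X" shows "holonomy (\<lambda>_. x) = \<one>"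
proof -
  have p: "pathin X (\<lambda>_. x)" using assms by simp
  obtain f :: "real \<Rightarrow> 'e" where f: "flat_section H S {0..1} (\<lambda>_. x) f" by (rule flat_section_path[OF p])
  have "f 1 \<in> carrier H" by (rule flat_section_closed[OF f]) simp
  then show ?thesis using holonomy_eq[OF p f] flat_section_constant_path[OF assms f] by simp
qed

lemma holonomy_reverse:
  assumes "pathin X p" shows "holonomy (reverse_path p) = inv (holonomy p)"
proof -
  have "holonomy p \<otimes> holonomy (reverse_path p) = holonomy (loop_concat p (reverse_path p))"
    using assms by (simp add: holonomy_concat pathin_reverse)
  also have "\<dots> = \<one>"
    using holonomy_homotopic[OF path_homotopic_reverse_right[OF assms]]
      holonomy_const[OF path_start_in_topspace[OF assms]] by simp
  finally have "inv (holonomy (reverse_path p)) = holonomy p"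
    using assms by (intro H.inv_equality) (simp_all add: holonomy_closed pathin_reverse)
  then show ?thesis using assms by (metis H.inv_inv holonomy_closed pathin_reverse)
qed

lemma holonomy_hom:
  obtains \<psi> where "\<psi> \<in> hom (fundamental_group X x0) H"
    "\<And>p. p \<in> loops X x0 \<Longrightarrow> \<psi> (loop_class X x0 p) = holonomy p"
proof -
  define \<psi> where "\<psi> C = holonomy (SOME p. p \<in> C)" for C
  have \<psi>: "\<psi> (loop_class X x0 p) = holonomy p" if p: "p \<in> loops X x0" for p
  proof -
    have "p \<in> loop_class X x0 p" using p by (simp add: mem_loop_class_iff path_homotopic_refl loops_def)
    then have "(SOME q. q \<in> loop_class X x0 p) \<in> loop_class X x0 p"
      using someI[of "\<lambda>q. q \<in> loop_class X x0 p" p] by (simp only:)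
    then have "path_homotopic X p (SOME q. q \<in> loop_class X x0 p)"
      unfolding mem_loop_class_iff[OF p] .
    then show ?thesis unfolding \<psi>_def by (rule holonomy_homotopic[symmetric])
  qed
  have "\<psi> \<in> hom (fundamental_group X x0) H"
  proof (rule homI)
    fix x assume "x \<in> carrier (fundamental_group X x0)"
    then obtain p where p: "p \<in> loops X x0" "x = loop_class X x0 p" by (auto simp: carrier_fundamental_group)
    then show "\<psi> x \<in> carrier H" using holonomy_closed[of p] by (simp add: \<psi> loops_def)
    fix y assume "y \<in> carrier (fundamental_group X x0)"
    then obtain q where q: "q \<in> loops X x0" "y = loop_class X x0 q" by (auto simp: carrier_fundamental_group)
    have "holonomy (loop_concat p q) = holonomy p \<otimes> holonomy q"
      using holonomy_concat[of p q] p q by (simp add: loops_def)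
    then show "\<psi> (x \<otimes>\<^bsub>fundamental_group X x0\<^esub> y) = \<psi> x \<otimes> \<psi> y"
      using p q by (simp add: mult_fundamental_group \<psi> loop_concat_loops)
  qed
  then show ?thesis using \<psi> that by blast
qed

end

section \<open>Flat bundles over the closed surface\<close>

text \<open>The argument in units of one edge, so that vertex \<open>k\<close> of the polygon has angle \<open>k\<close> up to multiples of \<open>4 * l\<close>.\<close>

definition angle :: "nat \<Rightarrow> complex \<Rightarrow> real" where
  "angle l z = 4 * real l * Arg z / (2 * pi)"

lemma polar_angle:
  assumes "l \<ge> 1"
  shows "z = of_real (cmod z) * cis (2 * pi * angle l z / (4 * real l))"
proof -
  have "2 * pi * angle l z / (4 * real l) = Arg z" using assms by (simp add: angle_def field_simps)
  then show ?thesis using rcis_cmod_Arg[of z] by (simp add: rcis_def)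
qed

lemma angle_unique:
  assumes l: "l \<ge> 1" and r: "r > 0" and z: "z = of_real r * cis (2 * pi * \<theta> / (4 * real l))"
  obtains m :: int where "angle l z = \<theta> + of_int (4 * int l * m)"
proof -
  have "cmod z = r" using z r by (simp add: norm_mult)
  then have "cis (2 * pi * angle l z / (4 * real l)) = cis (2 * pi * \<theta> / (4 * real l))"
    using polar_angle[OF l, of z] z r by simp
  then have "sin (2 * pi * angle l z / (4 * real l)) = sin (2 * pi * \<theta> / (4 * real l)) \<and>
      cos (2 * pi * angle l z / (4 * real l)) = cos (2 * pi * \<theta> / (4 * real l))"
    by (simp add: complex_eq_iff)
  then obtain m :: int where "2 * pi * angle l z / (4 * real l) = 2 * pi * \<theta> / (4 * real l) + 2 * pi * m"
    unfolding sin_cos_eq_iff by blast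
  then have "2 * pi * angle l z = 2 * pi * (\<theta> + 4 * real l * m)" using l by (simp add: field_simps)
  then have "angle l z = \<theta> + 4 * real l * m" by simp
  then show ?thesis using that[of m] by simp
qed

lemma angle_near:
  assumes l: "l \<ge> 1" and z: "z \<noteq> 0" and e: "e > 0"
  obtains d where "d > 0" "\<And>w. dist w z < d \<Longrightarrow> w \<noteq> 0 \<and>
     (\<exists>\<theta>. \<bar>\<theta> - angle l z\<bar> < e \<and> w = of_real (cmod w) * cis (2 * pi * \<theta> / (4 * real l)))"
proof -
  have "continuous (at z) (\<lambda>w. Arg (w / z))"
    by (rule continuous_at_compose[unfolded o_def, of z "\<lambda>w. w / z" Arg])
      (use z in \<open>auto intro!: continuous_intros continuous_at_Arg\<close>)
  moreover have "e * (2 * pi) / (4 * real l) > 0" using e l by simp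
  ultimately obtain d where d: "d > 0"
    "\<And>w. dist w z < d \<Longrightarrow> dist (Arg (w / z)) (Arg (z / z)) < e * (2 * pi) / (4 * real l)"
    unfolding continuous_at_eps_delta by blast
  show ?thesis
  proof (rule that)
    show "min d (cmod z) > 0" using d z by simp
    fix w assume w: "dist w z < min d (cmod z)"
    have w0: "w \<noteq> 0" using w z by (auto simp: dist_norm)
    define \<theta> where "\<theta> = angle l z + 4 * real l * Arg (w / z) / (2 * pi)"
    have "\<bar>Arg (w / z)\<bar> < e * (2 * pi) / (4 * real l)" using d(2)[of w] w z by (simp add: dist_real_def)
    then have "\<bar>4 * real l * Arg (w / z) / (2 * pi)\<bar> < e"
      using l by (simp add: abs_mult field_simps)
    then have "\<bar>\<theta> - angle l z\<bar> < e" by (simp add: \<theta>_def)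
    moreover have "2 * pi * \<theta> / (4 * real l) = Arg z + Arg (w / z)"
      using l by (simp add: \<theta>_def angle_def field_simps)
    then have "of_real (cmod w) * cis (2 * pi * \<theta> / (4 * real l))
      = rcis (cmod z) (Arg z) * rcis (cmod (w / z)) (Arg (w / z))"
      using z by (simp add: rcis_mult) (simp add: rcis_def norm_divide)
    then have "w = of_real (cmod w) * cis (2 * pi * \<theta> / (4 * real l))"
      using z by (simp add: rcis_cmod_Arg)
    ultimately show "w \<noteq> 0 \<and> (\<exists>\<theta>. \<bar>\<theta> - angle l z\<bar> < e \<and>
        w = of_real (cmod w) * cis (2 * pi * \<theta> / (4 * real l)))" using w0 by blast
  qed
qed

lemma norm_polygon_edge [simp]: "cmod (polygon_edge l k t) = 1"
  by (simp add: polygon_edge_def)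

lemma polygon_edge_end: "polygon_edge l k 1 = polygon_edge l (Suc k) 0"
  by (simp add: polygon_edge_def add.commute)

lemma continuous_polygon_edge: "continuous_on S (polygon_edge l k)"
  unfolding polygon_edge_def divide_inverse by (intro continuous_intros)

lemma edge_gluing_norm: "edge_gluing l z w \<Longrightarrow> cmod z = 1 \<and> cmod w = 1"
  by (induction rule: edge_gluing.induct) simp_all

lemma periodic_int:
  fixes W :: "int \<Rightarrow> 'e"
  assumes "\<forall>k. W (k + N) = W k"
  shows "W (k + N * m) = W k"
proof (induction m rule: int_induct[where k = 0])
  case (step1 i)
  then show ?case using assms[rule_format, of "k + N * i"] by (simp add: algebra_simps)
next
  case (step2 i)
  then show ?case using assms[rule_format, of "k + N * (i - 1)"] by (simp add: algebra_simps)
qed simp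

lemma sector_value:
  assumes l: "l \<ge> 1" and r: "r > 0" and z: "z = of_real r * cis (2 * pi * \<theta> / (4 * real l))"
    and W: "\<forall>k. W (k + 4 * int l) = W k"
  shows "angle l z + \<delta> \<in> \<int> \<longleftrightarrow> \<theta> + \<delta> \<in> \<int>" "W \<lfloor>angle l z + \<delta>\<rfloor> = W \<lfloor>\<theta> + \<delta>\<rfloor>"
proof -
  obtain m :: int where m: "angle l z = \<theta> + of_int (4 * int l * m)"
    by (rule angle_unique[OF l r z])
  then have eq: "angle l z + \<delta> = (\<theta> + \<delta>) + of_int (4 * int l * m)" by simp
  show "angle l z + \<delta> \<in> \<int> \<longleftrightarrow> \<theta> + \<delta> \<in> \<int>"
    unfolding eq by (rule add_in_Ints_iff_right) (rule Ints_of_int)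
  have "\<lfloor>angle l z + \<delta>\<rfloor> = \<lfloor>\<theta> + \<delta>\<rfloor> + 4 * int l * m" unfolding eq by (rule floor_add_int[symmetric])
  then show "W \<lfloor>angle l z + \<delta>\<rfloor> = W \<lfloor>\<theta> + \<delta>\<rfloor>" by (simp add: periodic_int[OF W])
qed

lemma sector_value_edge:
  assumes "l \<ge> 1" "\<forall>k. W (k + 4 * int l) = W k"
  shows "angle l (polygon_edge l k t) + \<delta> \<in> \<int> \<longleftrightarrow> real k + t + \<delta> \<in> \<int>"
    "W \<lfloor>angle l (polygon_edge l k t) + \<delta>\<rfloor> = W \<lfloor>real k + t + \<delta>\<rfloor>"
proof -
  have "polygon_edge l k t = of_real 1 * cis (2 * pi * (real k + t) / (4 * real l))"
    by (simp add: polygon_edge_def)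
  note sector_value[OF assms(1) zero_less_one this assms(2)]
  then show "angle l (polygon_edge l k t) + \<delta> \<in> \<int> \<longleftrightarrow> real k + t + \<delta> \<in> \<int>"
    "W \<lfloor>angle l (polygon_edge l k t) + \<delta>\<rfloor> = W \<lfloor>real k + t + \<delta>\<rfloor>" by auto
qed

locale polygon_bundle = H: group H for H :: "('e, 'm) monoid_scheme" (structure) +
  fixes l :: nat and X :: "'a topology" and F :: "complex \<Rightarrow> 'a" and A B :: "nat \<Rightarrow> 'e"
  assumes l: "l \<ge> 1"
    and quotient: "quotient_map (top_of_set (cball 0 1)) X F"
    and fibres: "\<And>z w. z \<in> cball 0 1 \<Longrightarrow> w \<in> cball 0 1 \<Longrightarrow> F z = F w \<longleftrightarrow> equivclp (edge_gluing l) z w"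
    and AB: "\<And>i. A i \<in> carrier H" "\<And>i. B i \<in> carrier H"
    and relation: "list_product H (map (\<lambda>i. commutator H (A i) (B i)) [0..<l]) = \<one>"
begin

text \<open>A locally constant section over the image of \<open>N\<close> of the bundle obtained from the polygon by gluing.  In
terms of the polygon it is a locally constant function on a saturated open set that is multiplied by
\<open>A\<^sub>i\<close> or \<open>B\<^sub>i\<inverse>\<close> when passing from an edge to its partner.\<close>

definition polygon_section :: "complex set \<Rightarrow> (complex \<Rightarrow> 'e) \<Rightarrow> bool" where
  "polygon_section N u \<longleftrightarrow>
     N \<subseteq> cball 0 1 \<and> u \<in> N \<rightarrow> carrier H \<and>
     (\<forall>z w. edge_gluing l z w \<longrightarrow> (z \<in> N \<longleftrightarrow> w \<in> N)) \<and>
     (\<forall>z\<in>N. \<exists>d>0. \<forall>w\<in>cball 0 1. dist w z < d \<longrightarrow> w \<in> N \<and> u w = u z) \<and>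
     (\<forall>i<l. \<forall>t\<in>{0..1}. polygon_edge l (4 * i) t \<in> N \<longrightarrow>
        u (polygon_edge l (4 * i + 2) (1 - t)) = u (polygon_edge l (4 * i) t) \<otimes> A i) \<and>
     (\<forall>i<l. \<forall>t\<in>{0..1}. polygon_edge l (4 * i + 1) t \<in> N \<longrightarrow>
        u (polygon_edge l (4 * i + 3) (1 - t)) = u (polygon_edge l (4 * i + 1) t) \<otimes> inv (B i))"

lemma ball_section: "polygon_section (ball 0 1) (\<lambda>_. \<one>)"
  unfolding polygon_section_def
proof (intro conjI allI impI ballI)
  fix z :: complex assume z: "z \<in> ball 0 1"
  then obtain d where "d > 0" "ball z d \<subseteq> ball 0 1" using openE[OF open_ball] by blast
  then show "\<exists>d>0. \<forall>w\<in>cball 0 1. dist w z < d \<longrightarrow> w \<in> ball 0 1 \<and> \<one> = \<one>"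
    by (intro exI[of _ d]) (auto simp: dist_commute subset_iff)
next
  fix z w assume "edge_gluing l z w"
  then show "z \<in> ball 0 1 \<longleftrightarrow> w \<in> ball 0 1" using edge_gluing_norm[of l z w] by simp
qed auto

text \<open>Values \<open>W k\<close> on \<open>4 * l\<close> sectors, separated by rays, form a section whenever they match on the
boundary.  The shift \<open>\<delta>\<close> is 0 for rays through the vertices and 1/2 for rays through the midpoints of the edges;
these are the positions that the gluing preserves, because it reverses the edges.\<close>

lemma sector_section:
  assumes W: "\<forall>k. W (k + 4 * int l) = W k" "\<And>k. W k \<in> carrier H" and \<delta>: "2 * \<delta> \<in> \<int>"
    and WA: "\<And>i t. i < l \<Longrightarrow> t \<in> {0..1} \<Longrightarrow> t + \<delta> \<notin> \<int> \<Longrightarrow>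
        W \<lfloor>real (4 * i + 2) + (1 - t) + \<delta>\<rfloor> = W \<lfloor>real (4 * i) + t + \<delta>\<rfloor> \<otimes> A i"
    and WB: "\<And>i t. i < l \<Longrightarrow> t \<in> {0..1} \<Longrightarrow> t + \<delta> \<notin> \<int> \<Longrightarrow>
        W \<lfloor>real (4 * i + 3) + (1 - t) + \<delta>\<rfloor> = W \<lfloor>real (4 * i + 1) + t + \<delta>\<rfloor> \<otimes> inv (B i)"
  shows "polygon_section {z \<in> cball 0 1. z \<noteq> 0 \<and> angle l z + \<delta> \<notin> \<int>} (\<lambda>z. W \<lfloor>angle l z + \<delta>\<rfloor>)"
    (is "polygon_section ?N ?u")
proof -
  note edge = sector_value_edge[OF l W(1)]
  have ints: "real k + t + \<delta> \<in> \<int> \<longleftrightarrow> t + \<delta> \<in> \<int>" for k t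
    using add_in_Ints_iff_left[of "real k" "t + \<delta>"] by (simp add: add.assoc)
  have flip: "1 - t + \<delta> \<in> \<int> \<longleftrightarrow> t + \<delta> \<in> \<int>" for t
  proof -
    have "1 - t + \<delta> = (1 + 2 * \<delta>) - (t + \<delta>)" "t + \<delta> = (1 + 2 * \<delta>) - (1 - t + \<delta>)" by simp_all
    then show ?thesis using \<delta> by (metis Ints_1 Ints_add Ints_diff)
  qed
  have mem: "polygon_edge l k t \<in> ?N \<longleftrightarrow> t + \<delta> \<notin> \<int>" for k t
  proof -
    have "polygon_edge l k t \<noteq> 0" using norm_polygon_edge[of l k t] by (metis norm_zero zero_neq_one)
    then show ?thesis by (simp add: edge(1) ints)
  qed
  have near: "\<exists>d>0. \<forall>w\<in>cball 0 1. dist w z < d \<longrightarrow> w \<in> ?N \<and> ?u w = ?u z" if z: "z \<in> ?N" for z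
  proof -
    let ?\<theta> = "angle l z + \<delta>"
    \<comment> \<open>the distance to the two rays that bound the sector\<close>
    define e where "e = min (?\<theta> - \<lfloor>?\<theta>\<rfloor>) (\<lfloor>?\<theta>\<rfloor> + 1 - ?\<theta>)"
    have "?\<theta> \<noteq> of_int \<lfloor>?\<theta>\<rfloor>" using z by (metis (mono_tags, lifting) Ints_of_int mem_Collect_eq)
    then have e: "e > 0" using of_int_floor_le[of ?\<theta>] floor_correct[of ?\<theta>] unfolding e_def by linarith
    obtain d where d: "d > 0" "\<And>w. dist w z < d \<Longrightarrow> w \<noteq> 0 \<and>
      (\<exists>\<theta>. \<bar>\<theta> - angle l z\<bar> < e \<and> w = of_real (cmod w) * cis (2 * pi * \<theta> / (4 * real l)))"
      using angle_near[OF l _ e, of z] z by blast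
    have "w \<in> ?N \<and> ?u w = ?u z" if w: "w \<in> cball 0 1" "dist w z < d" for w
    proof -
      obtain \<theta> where \<theta>: "w \<noteq> 0" "\<bar>\<theta> - angle l z\<bar> < e"
        "w = of_real (cmod w) * cis (2 * pi * \<theta> / (4 * real l))" using d(2)[OF w(2)] by blast
      have bounds: "\<lfloor>?\<theta>\<rfloor> < \<theta> + \<delta>" "\<theta> + \<delta> < \<lfloor>?\<theta>\<rfloor> + 1" using \<theta>(2) unfolding e_def by linarith+
      then have fl: "\<lfloor>\<theta> + \<delta>\<rfloor> = \<lfloor>?\<theta>\<rfloor>" by linarith
      have "\<theta> + \<delta> \<notin> \<int>" using bounds fl by (metis floor_of_int Ints_cases less_irrefl)
      moreover have "cmod w > 0" using \<theta>(1) by simp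
      ultimately show ?thesis
        using sector_value[OF l _ \<theta>(3) W(1), of \<delta>] w(1) \<theta>(1) fl by simp
    qed
    then show ?thesis using d(1) by blast
  qed
  have sat: "z \<in> ?N \<longleftrightarrow> w \<in> ?N" if "edge_gluing l z w" for z w
    using that by cases (simp_all only: mem flip)
  have A: "?u (polygon_edge l (4 * i + 2) (1 - t)) = ?u (polygon_edge l (4 * i) t) \<otimes> A i"
    if "i < l" "t \<in> {0..1}" "polygon_edge l (4 * i) t \<in> ?N" for i t
    unfolding edge(2) using WA[OF that(1,2)] that(3) unfolding mem by blast
  have B: "?u (polygon_edge l (4 * i + 3) (1 - t)) = ?u (polygon_edge l (4 * i + 1) t) \<otimes> inv (B i)"
    if "i < l" "t \<in> {0..1}" "polygon_edge l (4 * i + 1) t \<in> ?N" for i t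
    unfolding edge(2) using WB[OF that(1,2)] that(3) unfolding mem by blast
  show ?thesis unfolding polygon_section_def using near sat A B W(2) by (intro conjI) auto
qed

definition partial_relator :: "nat \<Rightarrow> 'e" where
  "partial_relator i = list_product H (map (\<lambda>i. commutator H (A i) (B i)) [0..<i])"

text \<open>The gluing determines the section around the vertex of the surface from its value at one corner of the
polygon: these are the prefixes of the relator in a suitable order, and corner \<open>4 * i\<close> carries the product
of the first \<open>i\<close> commutators.  The relation closes the cycle of corners (\<open>vertex_label_int\<close>).\<close>

definition vertex_value :: "nat \<Rightarrow> 'e" where
  "vertex_value k = partial_relator (k div 4) \<otimes>
     (if k mod 4 = 0 then \<one> else if k mod 4 = 1 then A (k div 4) \<otimes> B (k div 4) \<otimes> inv (A (k div 4))
      else if k mod 4 = 2 then A (k div 4) \<otimes> B (k div 4) else A (k div 4))"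

lemma partial_relator_closed [simp]: "partial_relator i \<in> carrier H"
  unfolding partial_relator_def by (rule H.list_product_closed) (auto simp: AB)

lemma partial_relator_Suc: "partial_relator (Suc i) = partial_relator i \<otimes> commutator H (A i) (B i)"
  unfolding partial_relator_def using AB
  by (simp add: H.list_product_append image_subset_iff del: foldr_append)

lemma vertex_value_closed [simp]: "vertex_value k \<in> carrier H"
  by (simp add: vertex_value_def AB)

lemma vertex_value_4:
  "vertex_value (4 * i) = partial_relator i"
  "vertex_value (4 * i + 1) = partial_relator i \<otimes> (A i \<otimes> B i \<otimes> inv (A i))"
  "vertex_value (4 * i + 2) = partial_relator i \<otimes> (A i \<otimes> B i)"
  "vertex_value (4 * i + 3) = partial_relator i \<otimes> A i"
  "vertex_value (4 * i + 4) = partial_relator i \<otimes> commutator H (A i) (B i)"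
proof -
  have *: "vertex_value (4 * i + j) = partial_relator i \<otimes>
     (if j = 0 then \<one> else if j = 1 then A i \<otimes> B i \<otimes> inv (A i) else if j = 2 then A i \<otimes> B i else A i)"
    if "j < 4" for j
  proof -
    have "(4 * i + j) div 4 = i" "(4 * i + j) mod 4 = j" using that by simp_all
    then show ?thesis by (simp only: vertex_value_def)
  qed
  show "vertex_value (4 * i) = partial_relator i"
    "vertex_value (4 * i + 1) = partial_relator i \<otimes> (A i \<otimes> B i \<otimes> inv (A i))"
    "vertex_value (4 * i + 2) = partial_relator i \<otimes> (A i \<otimes> B i)"
    "vertex_value (4 * i + 3) = partial_relator i \<otimes> A i"
    using *[of 0] *[of 1] *[of 2] *[of 3] by simp_all
  have "vertex_value (4 * i + 4) = partial_relator (Suc i)" by (simp add: vertex_value_def)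
  then show "vertex_value (4 * i + 4) = partial_relator i \<otimes> commutator H (A i) (B i)"
    by (simp add: partial_relator_Suc)
qed

lemma vertex_value_gluing:
  "vertex_value (4 * i + 3) = vertex_value (4 * i) \<otimes> A i"
  "vertex_value (4 * i + 2) = vertex_value (4 * i + 1) \<otimes> A i"
  "vertex_value (4 * i + 4) = vertex_value (4 * i + 1) \<otimes> inv (B i)"
  "vertex_value (4 * i + 3) = vertex_value (4 * i + 2) \<otimes> inv (B i)"
  unfolding vertex_value_4 using AB by (simp_all add: commutator_def H.m_assoc)

definition vertex_label :: "int \<Rightarrow> 'e" where
  "vertex_label k = vertex_value (nat (k mod (4 * int l)))"

lemma vertex_label_int: "k \<le> 4 * l \<Longrightarrow> vertex_label (int k) = vertex_value k"
proof (cases "k = 4 * l")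
  case True
  have "vertex_value (4 * l) = vertex_value 0"
    using relation vertex_value_4(1)[of l] vertex_value_4(1)[of 0] by (simp add: partial_relator_def)
  then show ?thesis using True by (simp add: vertex_label_def)
next
  case False
  assume "k \<le> 4 * l"
  with False have "int k mod (4 * int l) = int k" by (intro mod_pos_pos_trivial) auto
  then show ?thesis by (simp add: vertex_label_def)
qed

text \<open>The sectors around the corners, bounded by the rays through the midpoints of the edges.\<close>

definition "vertex_star = {z \<in> cball 0 1. z \<noteq> 0 \<and> angle l z + 1/2 \<notin> \<int>}"
definition "vertex_function z = vertex_label \<lfloor>angle l z + 1/2\<rfloor>"

lemma vertex_section: "polygon_section vertex_star vertex_function"
  unfolding vertex_star_def vertex_function_def
proof (rule sector_section)
  fix i :: nat and t :: real assume i: "i < l" and t: "t \<in> {0..1}" "t + 1/2 \<notin> \<int>"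
  have "t \<noteq> 1/2" using t(2) by (metis Ints_1 field_sum_of_halves)
  then have cases: "t < 1/2 \<or> t > 1/2" by linarith
  have label: "vertex_label (int (4 * i + j)) = vertex_value (4 * i + j)" if "j \<le> 4" for j
    by (rule vertex_label_int) (use i that in simp)
  have label0: "vertex_label (int (4 * i)) = vertex_value (4 * i)"
    by (rule vertex_label_int) (use i in simp)
  note labels = label0 label[of 1] label[of 2] label[of 3] label[of 4]
  have "vertex_label \<lfloor>real (4 * i + 2) + (1 - t) + 1/2\<rfloor> = vertex_label \<lfloor>real (4 * i) + t + 1/2\<rfloor> \<otimes> A i \<and>
    vertex_label \<lfloor>real (4 * i + 3) + (1 - t) + 1/2\<rfloor> = vertex_label \<lfloor>real (4 * i + 1) + t + 1/2\<rfloor> \<otimes> inv (B i)"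
    using cases
  proof (elim disjE)
    assume "t < 1/2"
    then have "\<lfloor>real (4 * i) + t + 1/2\<rfloor> = int (4 * i)" "\<lfloor>real (4 * i + 2) + (1 - t) + 1/2\<rfloor> = int (4 * i + 3)"
      "\<lfloor>real (4 * i + 1) + t + 1/2\<rfloor> = int (4 * i + 1)" "\<lfloor>real (4 * i + 3) + (1 - t) + 1/2\<rfloor> = int (4 * i + 4)"
      using t(1) by ((intro floor_unique; simp)+)
    then show ?thesis using labels vertex_value_gluing[of i] by simp
  next
    assume "t > 1/2"
    then have "\<lfloor>real (4 * i) + t + 1/2\<rfloor> = int (4 * i + 1)" "\<lfloor>real (4 * i + 2) + (1 - t) + 1/2\<rfloor> = int (4 * i + 2)"
      "\<lfloor>real (4 * i + 1) + t + 1/2\<rfloor> = int (4 * i + 2)" "\<lfloor>real (4 * i + 3) + (1 - t) + 1/2\<rfloor> = int (4 * i + 3)"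
      using t(1) by ((intro floor_unique; simp)+)
    then show ?thesis using labels vertex_value_gluing[of i] by simp
  qed
  then show "vertex_label \<lfloor>real (4 * i + 2) + (1 - t) + 1/2\<rfloor> = vertex_label \<lfloor>real (4 * i) + t + 1/2\<rfloor> \<otimes> A i"
    "vertex_label \<lfloor>real (4 * i + 3) + (1 - t) + 1/2\<rfloor> = vertex_label \<lfloor>real (4 * i + 1) + t + 1/2\<rfloor> \<otimes> inv (B i)"
    by blast+
qed (auto simp: vertex_label_def)

definition edge_label :: "int \<Rightarrow> 'e" where
  "edge_label k = (let k = nat (k mod (4 * int l)) in
     if k mod 4 = 2 then A (k div 4) else if k mod 4 = 3 then inv (B (k div 4)) else \<one>)"

lemma edge_label_int:
  assumes "i < l"
  shows "edge_label (int (4 * i)) = \<one>" "edge_label (int (4 * i + 1)) = \<one>"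
    "edge_label (int (4 * i + 2)) = A i" "edge_label (int (4 * i + 3)) = inv (B i)"
proof -
  have *: "edge_label (int (4 * i + j)) = (if j = 2 then A i else if j = 3 then inv (B i) else \<one>)"
    if "j < 4" for j
  proof -
    have "int (4 * i + j) mod (4 * int l) = int (4 * i + j)"
      using that assms by (intro mod_pos_pos_trivial) auto
    moreover have "(4 * i + j) div 4 = i" "(4 * i + j) mod 4 = j" using that by simp_all
    ultimately show ?thesis unfolding edge_label_def Let_def by (simp only: nat_int if_True)
  qed
  show "edge_label (int (4 * i)) = \<one>" "edge_label (int (4 * i + 1)) = \<one>"
    "edge_label (int (4 * i + 2)) = A i" "edge_label (int (4 * i + 3)) = inv (B i)"
    using *[of 0] *[of 1] *[of 2] *[of 3] by simp_all
qed

text \<open>The sectors over the open edges are glued only in pairs, so their values are subject to no relation.\<close>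

lemma edge_section:
  "polygon_section {z \<in> cball 0 1. z \<noteq> 0 \<and> angle l z + 0 \<notin> \<int>} (\<lambda>z. edge_label \<lfloor>angle l z + 0\<rfloor>)"
proof (rule sector_section)
  fix i :: nat and t :: real assume i: "i < l" and t: "t \<in> {0..1}" "t + 0 \<notin> \<int>"
  have "t \<noteq> 0" "t \<noteq> 1" using t(2) by auto
  then have "0 < t" "t < 1" using t(1) by auto
  then have "\<lfloor>real (4 * i) + t + 0\<rfloor> = int (4 * i)" "\<lfloor>real (4 * i + 2) + (1 - t) + 0\<rfloor> = int (4 * i + 2)"
      "\<lfloor>real (4 * i + 1) + t + 0\<rfloor> = int (4 * i + 1)" "\<lfloor>real (4 * i + 3) + (1 - t) + 0\<rfloor> = int (4 * i + 3)"
    by ((intro floor_unique; simp)+)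
  note floors = this
  show "edge_label \<lfloor>real (4 * i + 2) + (1 - t) + 0\<rfloor> = edge_label \<lfloor>real (4 * i) + t + 0\<rfloor> \<otimes> A i"
    "edge_label \<lfloor>real (4 * i + 3) + (1 - t) + 0\<rfloor> = edge_label \<lfloor>real (4 * i + 1) + t + 0\<rfloor> \<otimes> inv (B i)"
    unfolding floors edge_label_int[OF i] using AB by simp_all
qed (auto simp: edge_label_def AB Let_def)

lemma polygon_section_cover:
  assumes "z \<in> cball 0 1"
  obtains N u where "polygon_section N u" "z \<in> N"
proof (cases "z = 0")
  case True
  then show ?thesis using that ball_section by (metis centre_in_ball zero_less_one)
next
  case False
  have "angle l z + 1/2 \<notin> \<int> \<or> angle l z + 0 \<notin> \<int>"
  proof (rule ccontr)
    assume "\<not> ?thesis"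
    then have "(angle l z + 1/2) - (angle l z + 0) \<in> \<int>" by (intro Ints_diff) auto
    then have "(1/2 :: real) \<in> \<int>" by simp
    then show False by (auto elim!: Ints_cases simp: field_simps)
  qed
  then show ?thesis
  proof
    assume "angle l z + 1/2 \<notin> \<int>"
    then show ?thesis using that[OF vertex_section] assms False by (simp add: vertex_star_def)
  next
    assume "angle l z + 0 \<notin> \<int>"
    then show ?thesis using that[OF edge_section] assms False by simp
  qed
qed

lemma F_in_topspace: "z \<in> cball 0 1 \<Longrightarrow> F z \<in> topspace X"
  using quotient by (auto simp: quotient_map_def)

lemma edge_gluing_in_disc: "edge_gluing l z w \<Longrightarrow> z \<in> cball 0 1 \<and> w \<in> cball 0 1"
  using edge_gluing_norm[of l z w] by simp

lemma polygon_sectionD: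
  assumes "polygon_section N u"
  shows "N \<subseteq> cball 0 1" "z \<in> N \<Longrightarrow> u z \<in> carrier H"
    "edge_gluing l z w \<Longrightarrow> z \<in> N \<longleftrightarrow> w \<in> N"
    "z \<in> N \<Longrightarrow> \<exists>d>0. \<forall>w\<in>cball 0 1. dist w z < d \<longrightarrow> w \<in> N \<and> u w = u z"
    "i < l \<Longrightarrow> t \<in> {0..1} \<Longrightarrow> polygon_edge l (4 * i) t \<in> N \<Longrightarrow>
        u (polygon_edge l (4 * i + 2) (1 - t)) = u (polygon_edge l (4 * i) t) \<otimes> A i"
    "i < l \<Longrightarrow> t \<in> {0..1} \<Longrightarrow> polygon_edge l (4 * i + 1) t \<in> N \<Longrightarrow>
        u (polygon_edge l (4 * i + 3) (1 - t)) = u (polygon_edge l (4 * i + 1) t) \<otimes> inv (B i)"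
  using assms unfolding polygon_section_def by (blast+)

lemma gluing_multiplier:
  assumes "edge_gluing l z w"
  obtains g where "g \<in> carrier H" "\<And>N u. polygon_section N u \<Longrightarrow> z \<in> N \<Longrightarrow> u w = u z \<otimes> g"
  using assms
proof cases
  case (a i t)
  show ?thesis by (rule that[of "A i"]) (use a AB polygon_sectionD(5)[of _ _ i t] in auto)
next
  case (b i t)
  show ?thesis by (rule that[of "inv (B i)"]) (use b AB polygon_sectionD(6)[of _ _ i t] in auto)
qed

lemma polygon_section_saturated:
  assumes "polygon_section N u" "equivclp (edge_gluing l) z w"
  shows "z \<in> N \<longleftrightarrow> w \<in> N"
  using assms(2) by (induction rule: equivclp_induct) (use polygon_sectionD(3)[OF assms(1)] in blast)+

text \<open>Both sections are multiplied on the right by the same factor along the gluing, so their quotient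
descends to the surface.\<close>

lemma ratio_fibre:
  assumes u: "polygon_section N u" and v: "polygon_section N' v"
    and zw: "equivclp (edge_gluing l) z w" and z: "z \<in> N" "z \<in> N'"
  shows "v w \<otimes> inv (u w) = v z \<otimes> inv (u z)"
  using zw
proof (induction rule: equivclp_induct)
  case (step y w)
  have y: "y \<in> N" "y \<in> N'"
    using polygon_section_saturated[OF u step(1)] polygon_section_saturated[OF v step(1)] z by auto
  have *: "v b \<otimes> inv (u b) = v a \<otimes> inv (u a)" if "edge_gluing l a b" "a \<in> N" "a \<in> N'" for a b
  proof -
    obtain g where g: "g \<in> carrier H" "\<And>N u. polygon_section N u \<Longrightarrow> a \<in> N \<Longrightarrow> u b = u a \<otimes> g"
      by (rule gluing_multiplier[OF \<open>edge_gluing l a b\<close>]) blast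
    then show ?thesis
      using g(2)[OF u] g(2)[OF v] that polygon_sectionD(2)[OF u] polygon_sectionD(2)[OF v]
      by (simp add: H.inv_mult_group H.m_assoc H.inv_cancel)
  qed
  from step(2) have "v w \<otimes> inv (u w) = v y \<otimes> inv (u y)"
  proof
    assume "edge_gluing l y w" then show ?thesis using *[of y w] y by simp
  next
    assume wy: "edge_gluing l w y"
    then show ?thesis using *[OF wy] y polygon_sectionD(3)[OF u wy] polygon_sectionD(3)[OF v wy] by simp
  qed
  then show ?case using step.IH by simp
qed simp

text \<open>The choice of a point in every fibre is the pointwise trivialisation of the bundle that
\<open>flat_atlas\<close> presupposes.\<close>

definition representative :: "'a \<Rightarrow> complex" where
  "representative x = (SOME z. z \<in> cball 0 1 \<and> F z = x)"

lemma representative: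
  assumes "x \<in> topspace X"
  shows "representative x \<in> cball 0 1" "F (representative x) = x"
proof -
  have "x \<in> F ` cball 0 1" using assms quotient by (simp add: quotient_map_def)
  then have "\<exists>z. z \<in> cball 0 1 \<and> F z = x" by blast
  then show "representative x \<in> cball 0 1" "F (representative x) = x"
    unfolding representative_def by (metis (mono_tags, lifting) someI_ex)+
qed

lemma representative_equiv:
  "z \<in> cball 0 1 \<Longrightarrow> equivclp (edge_gluing l) z (representative (F z))"
  using representative[OF F_in_topspace] fibres by metis

lemma openin_saturated_image:
  assumes "N \<subseteq> cball 0 1" "\<And>z. z \<in> N \<Longrightarrow> \<exists>d>0. \<forall>w\<in>cball 0 1. dist w z < d \<longrightarrow> w \<in> N"
    and "\<And>z w. equivclp (edge_gluing l) z w \<Longrightarrow> z \<in> N \<Longrightarrow> w \<in> N"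
  shows "openin X (F ` N)"
proof -
  have "{z \<in> cball 0 1. F z \<in> F ` N} = N"
  proof (intro equalityI subsetI)
    fix w assume w: "w \<in> {z \<in> cball 0 1. F z \<in> F ` N}"
    then obtain z where z: "z \<in> N" "F z = F w" "w \<in> cball 0 1" by auto
    then have "equivclp (edge_gluing l) z w" using fibres assms(1) by blast
    then show "w \<in> N" using assms(3) z(1) by blast
  qed (use assms(1) in auto)
  moreover have "openin (top_of_set (cball 0 1)) N"
    unfolding openin_euclidean_subtopology_iff using assms(1,2) by blast
  moreover have "F ` N \<subseteq> topspace X" using assms(1) F_in_topspace by blast
  moreover have "openin (top_of_set (cball 0 1)) {z \<in> topspace (top_of_set (cball 0 1)). F z \<in> F ` N}
      \<longleftrightarrow> openin X (F ` N)"
    using quotient \<open>F ` N \<subseteq> topspace X\<close> unfolding quotient_map_def by blast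
  ultimately show ?thesis by (simp only: topspace_euclidean_subtopology)
qed

definition atlas :: "('a set \<times> ('a \<Rightarrow> 'e)) set" where
  "atlas = {(F ` N, \<lambda>x. u (representative x)) | N u. polygon_section N u}"

lemma mem_image_iff:
  assumes u: "polygon_section N u" and x: "x \<in> topspace X"
  shows "x \<in> F ` N \<longleftrightarrow> representative x \<in> N"
proof
  assume "x \<in> F ` N"
  then obtain z where z: "z \<in> N" "x = F z" by blast
  then have "z \<in> cball 0 1" using polygon_sectionD(1)[OF u] by blast
  then show "representative x \<in> N"
    using polygon_section_saturated[OF u representative_equiv] z by blast
qed (use representative(2)[OF x] in force)

lemma openin_section: "polygon_section N u \<Longrightarrow> openin X (F ` N)"
  by (rule openin_saturated_image)
    (use polygon_sectionD(1) polygon_section_saturated in \<open>blast, metis polygon_sectionD(4), blast\<close>)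

lemma flat_atlas: "flat_atlas H X atlas"
  unfolding flat_atlas_def
proof (intro conjI allI impI ballI)
  fix U \<sigma> assume "(U, \<sigma>) \<in> atlas"
  then obtain N u where N: "polygon_section N u" "U = F ` N" "\<sigma> = (\<lambda>x. u (representative x))"
    by (auto simp: atlas_def)
  then show U: "openin X U" using openin_section by simp
  show "\<sigma> \<in> U \<rightarrow> carrier H"
    using N mem_image_iff[OF N(1)] polygon_sectionD(2)[OF N(1)] openin_subset[OF U] by auto
next
  fix x assume x: "x \<in> topspace X"
  then obtain N u where N: "polygon_section N u" "representative x \<in> N"
    using polygon_section_cover[OF representative(1)] by blast
  then have "x \<in> F ` N" using mem_image_iff x by blast
  then show "\<exists>U \<sigma>. (U, \<sigma>) \<in> atlas \<and> x \<in> U" using N(1) unfolding atlas_def by blast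
next
  fix U \<sigma> U' \<sigma>' x assume asm: "(U, \<sigma>) \<in> atlas \<and> (U', \<sigma>') \<in> atlas \<and> x \<in> U \<inter> U'"
  then obtain N u N' v where N: "polygon_section N u" "U = F ` N" "\<sigma> = (\<lambda>x. u (representative x))"
    and N': "polygon_section N' v" "U' = F ` N'" "\<sigma>' = (\<lambda>x. v (representative x))"
    by (auto simp: atlas_def)
  note uD = polygon_sectionD[OF N(1)] and vD = polygon_sectionD[OF N'(1)]
  have x: "x \<in> topspace X" using asm openin_subset[OF openin_section[OF N(1)]] N(2) by blast
  have r: "representative x \<in> N" "representative x \<in> N'"
    using asm mem_image_iff[OF N(1) x] mem_image_iff[OF N'(1) x] N(2) N'(2) by auto
  define g where "g = v (representative x) \<otimes> inv (u (representative x))"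
  define M where "M = {z \<in> N \<inter> N'. v z \<otimes> inv (u z) = g}"
  have "openin X (F ` M)"
  proof (rule openin_saturated_image)
    show "M \<subseteq> cball 0 1" using uD(1) by (auto simp: M_def)
    fix z assume z: "z \<in> M"
    then obtain d1 d2 where d: "d1 > 0" "\<forall>w\<in>cball 0 1. dist w z < d1 \<longrightarrow> w \<in> N \<and> u w = u z"
      "d2 > 0" "\<forall>w\<in>cball 0 1. dist w z < d2 \<longrightarrow> w \<in> N' \<and> v w = v z"
      using uD(4)[of z] vD(4)[of z] unfolding M_def by blast
    then show "\<exists>d>0. \<forall>w\<in>cball 0 1. dist w z < d \<longrightarrow> w \<in> M"
      using z by (intro exI[of _ "min d1 d2"]) (auto simp: M_def)
  next
    fix z w assume zw: "equivclp (edge_gluing l) z w" and z: "z \<in> M"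
    then show "w \<in> M"
      using polygon_section_saturated[OF N(1) zw] polygon_section_saturated[OF N'(1) zw]
        ratio_fibre[OF N(1) N'(1) zw] by (auto simp: M_def)
  qed
  moreover have "x \<in> F ` M"
    using r representative(2)[OF x] by (auto simp: M_def g_def intro!: image_eqI[of x F "representative x"])
  moreover have "F ` M \<subseteq> U \<inter> U'" using N(2) N'(2) by (auto simp: M_def)
  moreover have "g \<in> carrier H" using r uD(2) vD(2) by (simp add: g_def)
  moreover have "\<sigma>' y = g \<otimes> \<sigma> y" if y: "y \<in> F ` M" for y
  proof -
    obtain z where z: "z \<in> M" "y = F z" using y by blast
    then have zN: "z \<in> N" "z \<in> N'" "z \<in> cball 0 1" using uD(1) by (auto simp: M_def)
    have e: "equivclp (edge_gluing l) z (representative y)" using representative_equiv[OF zN(3)] z(2) by simp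
    have ry: "representative y \<in> N" "representative y \<in> N'"
      using polygon_section_saturated[OF N(1) e] polygon_section_saturated[OF N'(1) e] zN by auto
    have "v (representative y) \<otimes> inv (u (representative y)) = g"
      using ratio_fibre[OF N(1) N'(1) e zN(1,2)] z(1) by (simp add: M_def)
    then show ?thesis using uD(2)[OF ry(1)] vD(2)[OF ry(2)] N(3) N'(3)
      by (simp add: H.m_assoc flip: \<open>_ = g\<close>)
  qed
  ultimately show "\<exists>V g. openin X V \<and> x \<in> V \<and> V \<subseteq> U \<inter> U' \<and> g \<in> carrier H \<and> (\<forall>y\<in>V. \<sigma>' y = g \<otimes> \<sigma> y)"
    by blast
qed

sublocale flat_structure H X atlas
  by unfold_locales (rule flat_atlas)

text \<open>The section that is \<open>\<one>\<close> at a point of the disc, evaluated at the representative of the fibre of this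
point.  For a path in the disc it yields a section along the image of the path, since the bundle is trivial over the
disc.\<close>

definition lift_value :: "complex \<Rightarrow> 'e" where
  "lift_value z = (SOME g. \<exists>N u. polygon_section N u \<and> z \<in> N \<and> g = inv (u z) \<otimes> u (representative (F z)))"

lemma lift_value_eq:
  assumes u: "polygon_section N u" and z: "z \<in> N"
  shows "lift_value z = inv (u z) \<otimes> u (representative (F z))"
proof -
  have "\<exists>N u. polygon_section N u \<and> z \<in> N \<and> lift_value z = inv (u z) \<otimes> u (representative (F z))"
    unfolding lift_value_def by (rule someI_ex) (use u z in blast)
  then obtain N' v where v: "polygon_section N' v" "z \<in> N'"
    "lift_value z = inv (v z) \<otimes> v (representative (F z))" by blast
  let ?r = "representative (F z)"
  have e: "equivclp (edge_gluing l) z ?r"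
    using representative_equiv z polygon_sectionD(1)[OF u] by blast
  have r: "?r \<in> N" "?r \<in> N'"
    using polygon_section_saturated[OF u e] polygon_section_saturated[OF v(1) e] z v(2) by auto
  note cl = polygon_sectionD(2)[OF u z] polygon_sectionD(2)[OF u r(1)]
    polygon_sectionD(2)[OF v(1,2)] polygon_sectionD(2)[OF v(1) r(2)]
  have "v ?r = v z \<otimes> inv (u z) \<otimes> u ?r"
    using ratio_fibre[OF u v(1) e z v(2)] cl by (metis H.inv_closed H.inv_solve_right' H.m_closed)
  then show ?thesis using v(3) cl by (simp add: H.m_assoc H.inv_cancel)
qed

lemma pathin_disc: 
  assumes "continuous_on {0..1} c" "c \<in> {0..1} \<rightarrow> cball 0 1"
  shows "pathin X (\<lambda>t. F (c t))"
proof -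
  have "continuous_map (top_of_set {0..1}) (top_of_set (cball 0 1)) c"
    using assms by (auto simp: continuous_map_in_subtopology)
  from continuous_map_compose[OF this quotient_imp_continuous_map[OF quotient]]
  show ?thesis by (simp add: pathin_def o_def)
qed

lemma holonomy_disc:
  assumes c: "continuous_on {0..1} c" "c \<in> {0..1} \<rightarrow> cball 0 1"
  shows "holonomy (\<lambda>t. F (c t)) = inv (lift_value (c 0)) \<otimes> lift_value (c 1)"
proof (rule holonomy_eq[OF pathin_disc[OF c]], rule flat_sectionI)
  fix z :: real assume z: "z \<in> {0..1}"
  then have cz: "c z \<in> cball 0 1" using c(2) by blast
  then obtain N u where u: "polygon_section N u" "c z \<in> N" by (rule polygon_section_cover)
  obtain d where d: "d > 0" "\<forall>w\<in>cball 0 1. dist w (c z) < d \<longrightarrow> w \<in> N \<and> u w = u (c z)"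
    using polygon_sectionD(4)[OF u] by blast
  let ?W = "{0..1} \<inter> c -` ball (c z) d"
  have "openin (top_of_set {0..1}) ?W" using c(1) by (rule continuous_openin_preimage_gen) simp
  moreover have "z \<in> ?W" using z d(1) by simp
  moreover have "F (c w) \<in> F ` N \<and> lift_value (c w) = inv (u (c z)) \<otimes> u (representative (F (c w)))"
    if "w \<in> ?W" for w
  proof -
    have "c w \<in> N" "u (c w) = u (c z)" using that d(2) c(2) by (auto simp: dist_commute)
    then show ?thesis using lift_value_eq[OF u(1)] by auto
  qed
  moreover have "(F ` N, \<lambda>x. u (representative x)) \<in> atlas" using u(1) by (auto simp: atlas_def)
  moreover have "inv (u (c z)) \<in> carrier H" using polygon_sectionD(2)[OF u] by simp
  ultimately show "\<exists>U \<sigma> g W. (U, \<sigma>) \<in> atlas \<and> g \<in> carrier H \<and> openin (top_of_set {0..1}) W \<and> z \<in> W \<and>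
       (\<forall>w\<in>W. F (c w) \<in> U \<and> lift_value (c w) = g \<otimes> \<sigma> (F (c w)))"
    by (intro exI[of _ "F ` N"] exI[of _ "\<lambda>x. u (representative x)"] exI[of _ "inv (u (c z))"]
        exI[of _ ?W]) blast
qed

lemma vertex_in_star: "polygon_edge l k 0 \<in> vertex_star"
  "vertex_function (polygon_edge l k 0) = vertex_label (int k)"
proof -
  have per: "\<forall>k. vertex_label (k + 4 * int l) = vertex_label k" by (simp add: vertex_label_def)
  have "\<lfloor>real k + 0 + 1/2\<rfloor> = int k" by (rule floor_unique) simp_all
  then show "vertex_function (polygon_edge l k 0) = vertex_label (int k)"
    unfolding vertex_function_def sector_value_edge(2)[OF l per] by simp
  have "real k + 0 + 1/2 \<notin> \<int>"
  proof
    assume "real k + 0 + 1/2 \<in> \<int>"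
    then have "(real k + 0 + 1/2) - real k \<in> \<int>" by (rule Ints_diff) simp
    then show False by (auto elim!: Ints_cases simp: field_simps)
  qed
  then have "angle l (polygon_edge l k 0) + 1/2 \<notin> \<int>" unfolding sector_value_edge(1)[OF l per] .
  moreover have "polygon_edge l k 0 \<noteq> 0" using norm_polygon_edge[of l k 0] by (metis norm_zero zero_neq_one)
  ultimately show "polygon_edge l k 0 \<in> vertex_star" by (simp add: vertex_star_def)
qed

lemma F_edge_gluing: "edge_gluing l z w \<Longrightarrow> F w = F z"
  using fibres[of z w] edge_gluing_in_disc[of z w] by (metis r_into_equivclp)

lemma glue_a: "i < l \<Longrightarrow> t \<in> {0..1} \<Longrightarrow> F (polygon_edge l (4 * i + 2) (1 - t)) = F (polygon_edge l (4 * i) t)"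
  by (rule F_edge_gluing, rule edge_gluing.a) auto

lemma glue_b: "i < l \<Longrightarrow> t \<in> {0..1} \<Longrightarrow> F (polygon_edge l (4 * i + 3) (1 - t)) = F (polygon_edge l (4 * i + 1) t)"
  by (rule F_edge_gluing, rule edge_gluing.b) auto

text \<open>The four edges of a handle identify the corners \<open>4 * i, \<dots>, 4 * i + 4\<close>, in the order
\<open>0, 3, 2, 1, 4\<close>.\<close>

lemma vertices_identified:
  assumes "k \<le> 4 * l" shows "F (polygon_edge l k 0) = F 1"
proof -
  have four: "F (polygon_edge l (4 * i + j) 0) = F (polygon_edge l (4 * i) 0)" if "i < l" "j \<le> 4" for i j
  proof -
    define V where "V j = F (polygon_edge l (4 * i + j) 0)" for j
    have V_end: "F (polygon_edge l (4 * i + j) 1) = V (Suc j)" for j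
      by (simp add: V_def polygon_edge_end)
    have "V 3 = V 0" using glue_a[OF that(1), of 0] V_end[of 2] by (simp add: V_def[of 0])
    moreover have "V 2 = V 1" using glue_a[OF that(1), of 1] V_end[of 0] by (simp add: V_def[of 2])
    moreover have "V 4 = V 1" using glue_b[OF that(1), of 0] V_end[of 3] by (simp add: V_def[of "Suc 0"])
    moreover have "V 3 = V 2" using glue_b[OF that(1), of 1] V_end[of 1] by (simp add: V_def[of 3] numeral_2_eq_2)
    moreover have "j = 0 \<or> j = 1 \<or> j = 2 \<or> j = 3 \<or> j = 4" using that by linarith
    ultimately have "V j = V 0" by (elim disjE) simp_all
    then show ?thesis by (simp add: V_def)
  qed
  have base: "F (polygon_edge l (4 * i) 0) = F 1" if "i \<le> l" for i
    using that
  proof (induction i)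
    case 0
    then show ?case by (simp add: polygon_edge_def)
  next
    case (Suc i)
    then show ?case using four[of i 4] by (simp add: add.commute)
  qed
  show ?thesis
  proof (cases "k = 4 * l")
    case True
    then show ?thesis using base[of l] by simp
  next
    case False
    then have "k div 4 < l" using assms by auto
    then show ?thesis using four[of "k div 4" "k mod 4"] base[of "k div 4"] by simp
  qed
qed

definition edge_path :: "nat \<Rightarrow> real \<Rightarrow> 'a" where
  "edge_path k t = F (polygon_edge l k t)"

text \<open>An edge path starts and ends at the vertex of the surface.  The section around the
vertex has the values \<open>vertex_value k\<close> and \<open>vertex_value (Suc k)\<close> at the two corners; relative to it, the section that is
constant along the edge changes by their quotient.\<close>

lemma holonomy_edge_path:
  obtains g where "g \<in> carrier H"
    "\<And>k. k < 4 * l \<Longrightarrow> holonomy (edge_path k) = g \<otimes> (vertex_value k \<otimes> inv (vertex_value (Suc k))) \<otimes> inv g"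
proof -
  define g where "g = vertex_function (representative (F 1))"
  have star: "1 \<in> vertex_star" using vertex_in_star(1)[of 0] by (simp add: polygon_edge_def)
  then have "equivclp (edge_gluing l) 1 (representative (F 1))" by (intro representative_equiv) simp
  then have "representative (F 1) \<in> vertex_star"
    using polygon_section_saturated[OF vertex_section] star by blast
  then have g: "g \<in> carrier H" unfolding g_def by (rule polygon_sectionD(2)[OF vertex_section])
  have lv: "lift_value (polygon_edge l k 0) = inv (vertex_value k) \<otimes> g" if "k \<le> 4 * l" for k
    using lift_value_eq[OF vertex_section vertex_in_star(1), of k] vertices_identified[OF that]
    by (simp add: vertex_in_star(2) vertex_label_int[OF that] g_def)
  have "holonomy (edge_path k) = inv g \<otimes> (vertex_value k \<otimes> inv (vertex_value (Suc k))) \<otimes> inv (inv g)"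
    if k: "k < 4 * l" for k
  proof -
    have "holonomy (\<lambda>t. F (polygon_edge l k t)) = inv (lift_value (polygon_edge l k 0)) \<otimes> lift_value (polygon_edge l k 1)"
      by (rule holonomy_disc) (auto simp: continuous_polygon_edge)
    then have "holonomy (edge_path k) = inv (inv (vertex_value k) \<otimes> g) \<otimes> (inv (vertex_value (Suc k)) \<otimes> g)"
      using k lv[of k] lv[of "Suc k"] by (simp add: edge_path_def[abs_def] polygon_edge_end)
    then show ?thesis using g by (simp add: H.inv_mult_group H.m_assoc)
  qed
  then show ?thesis using that[of "inv g"] g by simp
qed

lemma holonomy_edge_path_conj:
  obtains h k where "\<And>i. i < l \<Longrightarrow> h i \<in> carrier H" "\<And>i. i < l \<Longrightarrow> k i \<in> carrier H"
    "\<And>i. i < l \<Longrightarrow> holonomy (edge_path (4 * i)) = h i \<otimes> inv (B i) \<otimes> inv (h i)"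
    "\<And>i. i < l \<Longrightarrow> holonomy (edge_path (4 * i + 1)) = k i \<otimes> inv (A i) \<otimes> inv (k i)"
proof -
  obtain g where g: "g \<in> carrier H"
    "\<And>k. k < 4 * l \<Longrightarrow> holonomy (edge_path k) = g \<otimes> (vertex_value k \<otimes> inv (vertex_value (Suc k))) \<otimes> inv g"
    by (rule holonomy_edge_path) blast
  have S: "Suc (4 * i) = 4 * i + 1" "Suc (4 * i + 1) = 4 * i + 2" for i by simp_all
  show ?thesis
  proof (rule that)
    fix i assume i: "i < l"
    show "g \<otimes> partial_relator i \<otimes> A i \<in> carrier H" "g \<otimes> partial_relator i \<otimes> (A i \<otimes> B i) \<in> carrier H"
      using g(1) AB by simp_all
    have "4 * i < 4 * l" "4 * i + 1 < 4 * l" using i by simp_all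
    from g(2)[OF this(1)] g(2)[OF this(2)]
    show "holonomy (edge_path (4 * i)) = (g \<otimes> partial_relator i \<otimes> A i) \<otimes> inv (B i)
        \<otimes> inv (g \<otimes> partial_relator i \<otimes> A i)"
      "holonomy (edge_path (4 * i + 1)) = (g \<otimes> partial_relator i \<otimes> (A i \<otimes> B i)) \<otimes> inv (A i)
        \<otimes> inv (g \<otimes> partial_relator i \<otimes> (A i \<otimes> B i))"
      unfolding S vertex_value_4 using g(1) AB
      by (simp_all add: H.inv_mult_group H.m_assoc H.inv_cancel)
  qed
qed

lemma edge_path_loop: "k < 4 * l \<Longrightarrow> edge_path k \<in> loops X (F 1)"
  using pathin_disc[of "polygon_edge l k"] vertices_identified[of k] vertices_identified[of "Suc k"]
  by (simp add: loops_def edge_path_def[abs_def] continuous_polygon_edge polygon_edge_end)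

text \<open>The first \<open>n\<close> edges of the boundary of the polygon, traversed as one path.\<close>

definition arc :: "nat \<Rightarrow> real \<Rightarrow> 'a" where
  "arc n t = F (cis (2 * pi * (real n * t) / (4 * real l)))"

lemma continuous_boundary: "continuous_map (top_of_set UNIV) X (\<lambda>\<tau>::real. F (cis (2 * pi * \<tau> / (4 * real l))))"
proof -
  have "continuous_on UNIV (\<lambda>\<tau>::real. cis (2 * pi * \<tau> / (4 * real l)))"
    using l by (intro continuous_intros) auto
  then have "continuous_map (top_of_set UNIV) (top_of_set (cball 0 1)) (\<lambda>\<tau>::real. cis (2 * pi * \<tau> / (4 * real l)))"
    by (auto simp: continuous_map_in_subtopology)
  from continuous_map_compose[OF this quotient_imp_continuous_map[OF quotient]]
  show ?thesis by (simp add: o_def)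
qed

lemma arc_Suc: "path_homotopic X (loop_concat (arc n) (edge_path n)) (arc (Suc n))"
proof -
  let ?\<Phi> = "\<lambda>\<tau>::real. F (cis (2 * pi * \<tau> / (4 * real l)))"
  let ?u = "loop_concat (\<lambda>t. real n * t) (\<lambda>t. real n + t)"
  have "pathin euclideanreal ?u"
    by (rule pathin_concat) (auto simp: pathin_def intro!: continuous_intros)
  then have "continuous_on {0..1} ?u" by (simp add: pathin_def)
  then have "path_homotopic X (\<lambda>t. ?\<Phi> (?u t)) (\<lambda>t. ?\<Phi> (real (Suc n) * t))"
    by (intro path_homotopic_convex[OF convex_UNIV continuous_boundary]) (auto intro!: continuous_intros)
  moreover have "(\<lambda>t. ?\<Phi> (?u t)) = loop_concat (arc n) (edge_path n)"
    by (auto simp: loop_concat_def arc_def edge_path_def polygon_edge_def)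
  moreover have "(\<lambda>t. ?\<Phi> (real (Suc n) * t)) = arc (Suc n)" by (simp add: arc_def[abs_def])
  ultimately show ?thesis by simp
qed

text \<open>The whole boundary of the polygon contracts in the disc.\<close>

lemma arc_full: "path_homotopic X (arc (4 * l)) (\<lambda>_. F 1)"
proof -
  have "path_homotopic X (\<lambda>t. F (cis (2 * pi * (real (4 * l) * t) / (4 * real l)))) (\<lambda>t. F 1)"
    by (rule path_homotopic_convex[OF convex_cball[of 0 1] quotient_imp_continuous_map[OF quotient]])
      (use l in \<open>auto intro!: continuous_intros\<close>)
  then show ?thesis unfolding arc_def[abs_def] .
qed

abbreviation "\<pi> \<equiv> fundamental_group X (F 1)"

abbreviation "edge_class k \<equiv> loop_class X (F 1) (edge_path k)"

lemma F1: "F 1 \<in> topspace X" by (rule F_in_topspace) simp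

interpretation \<pi>: group \<pi> by (rule group_fundamental_group[OF F1])

lemma arc_loop: "n \<le> 4 * l \<Longrightarrow> arc n \<in> loops X (F 1)"
proof -
  assume n: "n \<le> 4 * l"
  have "arc n 1 = F (polygon_edge l n 0)" by (simp add: arc_def polygon_edge_def)
  moreover have "pathin X (arc n)" using path_homotopic_imp(1)[OF arc_Suc[of n]]
    unfolding arc_def[abs_def] by (intro pathin_disc) (use l in \<open>auto intro!: continuous_intros\<close>)
  moreover have "arc n 0 = F 1" by (simp add: arc_def)
  ultimately show ?thesis using vertices_identified[OF n] by (simp add: loops_def)
qed

lemma edge_class_product:
  "n \<le> 4 * l \<Longrightarrow> list_product \<pi> (map edge_class [0..<n]) = loop_class X (F 1) (arc n)"
proof (induction n)
  case 0
  have "arc 0 = (\<lambda>_. F 1)" by (simp add: arc_def[abs_def])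
  then show ?case by (simp add: one_fundamental_group)
next
  case (Suc n)
  have "edge_class n \<in> carrier \<pi>" using Suc.prems by (intro loop_class_in_carrier edge_path_loop) simp
  then have "list_product \<pi> (map edge_class [0..<Suc n]) = list_product \<pi> (map edge_class [0..<n]) \<otimes>\<^bsub>\<pi>\<^esub> edge_class n"
    using Suc.prems by (simp add: \<pi>.list_product_append loop_class_in_carrier edge_path_loop image_subset_iff del: foldr_append)
  also have "\<dots> = loop_class X (F 1) (loop_concat (arc n) (edge_path n))"
    using Suc by (simp add: mult_fundamental_group arc_loop edge_path_loop)
  also have "\<dots> = loop_class X (F 1) (arc (Suc n))"
    using arc_Suc[of n] Suc.prems by (simp add: loop_class_eq_iff loop_concat_loops arc_loop edge_path_loop)
  finally show ?case .
qed

text \<open>Opposite orientation of paired edges makes the edges \<open>4 * i + 2\<close> and \<open>4 * i + 3\<close> inverse to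
\<open>4 * i\<close> and \<open>4 * i + 1\<close>, so the boundary word of the polygon is the product of commutators.\<close>

lemma edge_class_relation:
  "list_product \<pi> (map (\<lambda>i. commutator \<pi> (edge_class (4 * i)) (edge_class (4 * i + 1))) [0..<l]) = \<one>\<^bsub>\<pi>\<^esub>"
proof -
  have cl: "edge_class k \<in> carrier \<pi>" if "k < 4 * l" for k
    using that by (intro loop_class_in_carrier edge_path_loop)
  have inverse: "edge_class k = inv\<^bsub>\<pi>\<^esub> edge_class j"
    if kj: "k < 4 * l" "j < 4 * l" "\<And>t. t \<in> {0..1} \<Longrightarrow> edge_path k (1 - t) = edge_path j t" for k j
  proof -
    have "edge_path k t = reverse_path (edge_path j) t" if "t \<in> {0..1}" for t
      using kj(3)[of "1 - t"] that by (simp add: reverse_path_def)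
    then have "path_homotopic X (edge_path k) (reverse_path (edge_path j))"
      using edge_path_loop[OF kj(1)] by (intro path_homotopic_eq) (auto simp: loops_def)
    then show ?thesis
      using edge_path_loop[OF kj(1)] edge_path_loop[OF kj(2)]
      by (simp add: inv_fundamental_group[OF F1] loop_class_eq_iff reverse_path_loops)
  qed
  have word: "edge_class (4 * i) \<otimes>\<^bsub>\<pi>\<^esub> edge_class (4 * i + 1) \<otimes>\<^bsub>\<pi>\<^esub> edge_class (4 * i + 2) \<otimes>\<^bsub>\<pi>\<^esub> edge_class (4 * i + 3)
      = commutator \<pi> (edge_class (4 * i)) (edge_class (4 * i + 1))" if i: "i < l" for i
  proof -
    have "edge_class (4 * i + 2) = inv\<^bsub>\<pi>\<^esub> edge_class (4 * i)"
      by (rule inverse) (use i glue_a[OF i] in \<open>auto simp: edge_path_def\<close>)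
    moreover have "edge_class (4 * i + 3) = inv\<^bsub>\<pi>\<^esub> edge_class (4 * i + 1)"
      by (rule inverse) (use i glue_b[OF i] in \<open>auto simp: edge_path_def\<close>)
    ultimately show ?thesis by (simp only: commutator_def)
  qed
  have "list_product \<pi> (map (\<lambda>i. commutator \<pi> (edge_class (4 * i)) (edge_class (4 * i + 1))) [0..<l])
     = list_product \<pi> (map (\<lambda>i. edge_class (4 * i) \<otimes>\<^bsub>\<pi>\<^esub> edge_class (4 * i + 1) \<otimes>\<^bsub>\<pi>\<^esub> edge_class (4 * i + 2)
         \<otimes>\<^bsub>\<pi>\<^esub> edge_class (4 * i + 3)) [0..<l])"
    by (intro arg_cong[of _ _ "list_product \<pi>"] map_cong refl) (simp only: word set_upt atLeastLessThan_iff)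
  also have "\<dots> = list_product \<pi> (map edge_class [0..<4 * l])"
    by (rule \<pi>.list_product_fours[symmetric]) (rule cl)
  also have "\<dots> = loop_class X (F 1) (arc (4 * l))" by (rule edge_class_product) simp
  also have "\<dots> = \<one>\<^bsub>\<pi>\<^esub>"
    unfolding one_fundamental_group using arc_full loop_class_eq_iff[OF arc_loop loops_const[OF F1]] by simp
  finally show ?thesis .
qed

text \<open>The base point of the surface is joined to the vertex by a path, along which the loops of the edges are
moved.  Homomorphisms to the reals do not see the conjugating elements.\<close>

lemma fundamental_group_hom:
  assumes x0: "x0 \<in> topspace X"
  obtains \<psi> a b h k where "\<psi> \<in> hom (fundamental_group X x0) H"
    "\<And>i. i < l \<Longrightarrow> a i \<in> carrier (fundamental_group X x0)"
    "\<And>i. i < l \<Longrightarrow> b i \<in> carrier (fundamental_group X x0)"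
    "list_product (fundamental_group X x0)
       (map (\<lambda>i. commutator (fundamental_group X x0) (a i) (b i)) [0..<l]) = \<one>\<^bsub>fundamental_group X x0\<^esub>"
    "\<And>i. i < l \<Longrightarrow> h i \<in> carrier H" "\<And>i. i < l \<Longrightarrow> k i \<in> carrier H"
    "\<And>i. i < l \<Longrightarrow> \<psi> (a i) = h i \<otimes> inv (B i) \<otimes> inv (h i)"
    "\<And>i. i < l \<Longrightarrow> \<psi> (b i) = k i \<otimes> inv (A i) \<otimes> inv (k i)"
proof -
  let ?G = "fundamental_group X x0"
  define z0 where "z0 = representative x0"
  define s where "s t = F ((1 - t) *\<^sub>R z0 + t *\<^sub>R 1)" for t
  have z0: "z0 \<in> cball 0 1" "F z0 = x0" using representative[OF x0] by (simp_all add: z0_def)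
  have s: "pathin X s" unfolding s_def
    by (rule pathin_disc) (use z0(1) convexD_alt[OF convex_cball[of 0 1], of z0 1] in \<open>auto intro!: continuous_intros simp: Pi_iff\<close>)
  have ends: "s 0 = x0" "s 1 = F 1" by (simp_all add: s_def z0)
  obtain \<theta> where \<theta>: "\<theta> \<in> hom \<pi> ?G"
    "\<And>p. p \<in> loops X (F 1) \<Longrightarrow> \<theta> (loop_class X (F 1) p) = loop_class X x0 (move_base s p)"
    using move_base_hom[OF s] unfolding ends by metis
  interpret G: group ?G by (rule group_fundamental_group[OF x0])
  interpret \<theta>: group_hom \<pi> ?G \<theta> by unfold_locales (rule \<theta>(1))
  obtain \<psi> where \<psi>: "\<psi> \<in> hom ?G H" "\<And>p. p \<in> loops X x0 \<Longrightarrow> \<psi> (loop_class X x0 p) = holonomy p"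
    by (rule holonomy_hom[of x0]) blast
  have cl: "edge_class k \<in> carrier \<pi>" if "k < 4 * l" for k
    using that by (intro loop_class_in_carrier edge_path_loop)
  have conj: "\<psi> (\<theta> (edge_class k)) = holonomy s \<otimes> holonomy (edge_path k) \<otimes> inv (holonomy s)"
    if k: "k < 4 * l" for k
  proof -
    have e: "pathin X (edge_path k)" "edge_path k 0 = F 1" "edge_path k 1 = F 1"
      using edge_path_loop[OF k] by (auto simp: loops_def)
    have "move_base s (edge_path k) \<in> loops X x0"
      using move_base_loops[OF s] edge_path_loop[OF k] by (simp add: ends)
    then have "\<psi> (\<theta> (edge_class k)) = holonomy (move_base s (edge_path k))"
      using \<psi>(2) \<theta>(2)[OF edge_path_loop[OF k]] by simp
    also have "\<dots> = holonomy s \<otimes> (holonomy (edge_path k) \<otimes> inv (holonomy s))"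
      unfolding move_base_def using s e
      by (simp add: holonomy_concat pathin_concat pathin_reverse holonomy_reverse ends)
    finally show ?thesis using s e by (simp add: H.m_assoc holonomy_closed)
  qed
  obtain h k where hk: "\<And>i. i < l \<Longrightarrow> h i \<in> carrier H" "\<And>i. i < l \<Longrightarrow> k i \<in> carrier H"
    "\<And>i. i < l \<Longrightarrow> holonomy (edge_path (4 * i)) = h i \<otimes> inv (B i) \<otimes> inv (h i)"
    "\<And>i. i < l \<Longrightarrow> holonomy (edge_path (4 * i + 1)) = k i \<otimes> inv (A i) \<otimes> inv (k i)"
    by (rule holonomy_edge_path_conj) blast
  have hs: "holonomy s \<in> carrier H" using s by (rule holonomy_closed)
  show ?thesis
  proof (rule that[OF \<psi>(1)])
    fix i assume i: "i < l"
    show "\<theta> (edge_class (4 * i)) \<in> carrier ?G" "\<theta> (edge_class (4 * i + 1)) \<in> carrier ?G"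
      using cl[of "4 * i"] cl[of "4 * i + 1"] i by simp_all
    show "holonomy s \<otimes> h i \<in> carrier H" "holonomy s \<otimes> k i \<in> carrier H" using hk(1,2)[OF i] hs by simp_all
    show "\<psi> (\<theta> (edge_class (4 * i))) = (holonomy s \<otimes> h i) \<otimes> inv (B i) \<otimes> inv (holonomy s \<otimes> h i)"
      "\<psi> (\<theta> (edge_class (4 * i + 1))) = (holonomy s \<otimes> k i) \<otimes> inv (A i) \<otimes> inv (holonomy s \<otimes> k i)"
      using i hk(1,2)[OF i] hk(3,4)[OF i] hs AB conj[of "4 * i"] conj[of "4 * i + 1"]
      by (simp_all add: H.m_assoc H.inv_mult_group)
  next
    let ?R = "map (\<lambda>i. commutator \<pi> (edge_class (4 * i)) (edge_class (4 * i + 1))) [0..<l]"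
    have R: "set ?R \<subseteq> carrier \<pi>" using cl by auto
    have "map (\<lambda>i. commutator ?G (\<theta> (edge_class (4 * i))) (\<theta> (edge_class (4 * i + 1)))) [0..<l] = map \<theta> ?R"
      unfolding map_map o_def by (intro map_cong refl) (use cl in \<open>simp add: \<theta>.hom_commutator\<close>)
    then show "list_product ?G (map (\<lambda>i. commutator ?G (\<theta> (edge_class (4 * i))) (\<theta> (edge_class (4 * i + 1)))) [0..<l])
        = \<one>\<^bsub>?G\<^esub>"
      using \<theta>.hom_list_product[OF R] edge_class_relation by (simp only: \<theta>.hom_one)
  qed
qed

end

section \<open>Non-equivalence\<close>

theorem theorem1p4:
  fixes l :: nat and X :: "'a topology" and x0 :: 'a
    and G :: "(real \<Rightarrow> 'a) set monoid"
  assumes "l \<ge> 2"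
    and "closed_oriented_surface l X"
    and "x0 \<in> topspace X"
    and "G = fundamental_group X x0"
  shows "\<not> scl_equivalent G (derived G (carrier G))"
proof -
  obtain F where F: "quotient_map (top_of_set (cball 0 1)) X F"
    "\<And>z w. z \<in> cball 0 1 \<Longrightarrow> w \<in> cball 0 1 \<Longrightarrow> F z = F w \<longleftrightarrow> equivclp (edge_gluing l) z w"
    using assms(2) unfolding closed_oriented_surface_def by blast
  let ?E = euler_heisenberg
  interpret polygon_bundle ?E l X F handle_a handle_b
    by unfold_locales (use assms(1) F handle_relation[OF assms(1)] in simp_all)
  obtain \<psi> a b h k where \<psi>: "\<psi> \<in> hom G ?E"
    and ab: "\<And>i. i < l \<Longrightarrow> a i \<in> carrier G" "\<And>i. i < l \<Longrightarrow> b i \<in> carrier G"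
    and rel: "list_product G (map (\<lambda>i. commutator G (a i) (b i)) [0..<l]) = \<one>\<^bsub>G\<^esub>"
    and hk: "\<And>i. i < l \<Longrightarrow> h i \<in> carrier ?E" "\<And>i. i < l \<Longrightarrow> k i \<in> carrier ?E"
    and \<psi>ab: "\<And>i. i < l \<Longrightarrow> \<psi> (a i) = h i \<otimes>\<^bsub>?E\<^esub> inv\<^bsub>?E\<^esub> (handle_b i) \<otimes>\<^bsub>?E\<^esub> inv\<^bsub>?E\<^esub> (h i)"
      "\<And>i. i < l \<Longrightarrow> \<psi> (b i) = k i \<otimes>\<^bsub>?E\<^esub> inv\<^bsub>?E\<^esub> (handle_a i) \<otimes>\<^bsub>?E\<^esub> inv\<^bsub>?E\<^esub> (k i)"
    unfolding assms(4) by (rule fundamental_group_hom[OF assms(3)]) blast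
  interpret heisenberg_quasimorphism G "\<lambda>x. 4 * eh_p (\<psi> x)" "\<lambda>x. eh_q (\<psi> x)" "\<lambda>x. eh_s (\<psi> x)" 1
    using heisenberg_quasimorphism_pullback[OF _ \<psi>] group_fundamental_group[OF assms(3)] assms(4) by simp
  have inv_pq: "eh_p (inv\<^bsub>?E\<^esub> x) = - eh_p x" "eh_q (inv\<^bsub>?E\<^esub> x) = - eh_q x" if "x \<in> carrier ?E" for x
    using that by (auto simp: inv_euler_heisenberg euler_heisenberg_inv_def eh_p_def eh_q_def split: prod.splits)
  \<comment> \<open>only the handle with index 0 has nonzero coordinates \<open>p, q\<close>; the conjugations do not affect them\<close>
  have "(\<Sum>i\<leftarrow>[0..<l]. 4 * eh_p (\<psi> (a i)) * eh_q (\<psi> (b i)) - 4 * eh_p (\<psi> (b i)) * eh_q (\<psi> (a i)))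
      = (\<Sum>i\<leftarrow>[0..<l]. if i = 0 then - 4 else 0)"
  proof (intro arg_cong[of _ _ sum_list] map_cong refl)
    fix i assume "i \<in> set [0..<l]"
    then have i: "i < l" by simp
    have "eh_p (\<psi> (a i)) = - eh_p (handle_b i)" "eh_q (\<psi> (a i)) = - eh_q (handle_b i)"
      "eh_p (\<psi> (b i)) = - eh_p (handle_a i)" "eh_q (\<psi> (b i)) = - eh_q (handle_a i)"
      unfolding \<psi>ab[OF i] using hk[OF i] by (simp_all add: eh_mult inv_pq)
    then show "4 * eh_p (\<psi> (a i)) * eh_q (\<psi> (b i)) - 4 * eh_p (\<psi> (b i)) * eh_q (\<psi> (a i)) = (if i = 0 then - 4 else 0)"
      by (simp add: handle_a_def handle_b_def eh_p_def eh_q_def)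
  qed
  also have "\<dots> = - 4"
  proof -
    have "[0..<l] = 0 # [1..<l]" using assms(1) by (simp add: upt_conv_Cons)
    moreover have "map (\<lambda>i. if i = 0 then - 4 else 0 :: real) [1..<l] = map (\<lambda>i. 0) [1..<l]"
      by (intro map_cong) auto
    ultimately show ?thesis by (simp only: list.map sum_list.Cons sum_list_0 if_True add_0_right simp_thms)
  qed
  finally show ?thesis
    by (intro not_scl_equivalent_derived[OF _ _ rel]) (use ab in auto)
qed

end
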